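(* Let $-A$ be the generator of a bounded $C_0$-semigroup $(e^{-tA})_{t\ge 0}$ on a Banach space $X$, let $M:=\sup_{t\ge 0}\|e^{-tA}\|$, and let $\alpha\in(0,2]$. Then for all $x\in\operatorname{dom}(A^\alpha)$, $t>0$ and $n\in\mathbb N$: a) (Yosida's approximation) $$\|e^{-tA}x-e^{-ntA(n+A)^{-1}}x\|\le 16M\left(\frac tn\right)^{\alpha/2}\|A^\alpha x\|;$$ b) (Dunford-Segal approximation) $$\|e^{-tA}x-e^{-nt(1-e^{-A/n})}x\|\le 8M\left(\frac tn\right)^{\alpha/2}\|A^\alpha x\|;$$ c) (Euler's approximation) $$\|e^{-tA}x-(1+tA/n)^{-n}x\|\le 8M\left(\frac{t^2}{n}\right)^{\alpha/2}\|A^\alpha x\|.$$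
   Context: $X$ is a complex Banach space. For $\alpha>0$, $A^\alpha$ is the usual fractional power of $A$; explicitly, if $u_\alpha(z)=(z/(z+1))^\alpha=\int_0^\infty e^{-zs}\mu_\alpha(ds)$ with $\mu_\alpha$ a bounded Radon measure on $[0,\infty)$, $u_\alpha(A):=\int_0^\infty e^{-sA}\mu_\alpha(ds)$ and $v_\alpha(A):=\frac1{\Gamma(\alpha)}\int_0^\infty s^{\alpha-1}e^{-s}e^{-sA}\,ds$ (which is injective), then $A^\alpha=v_\alpha(A)^{-1}u_\alpha(A)$ with natural domain. The operators $A(n+A)^{-1}$ and $e^{-A/n}$ (the semigroup at time $1/n$) are bounded, and the exponentials in a) and b) are exponentials of bounded operators. *)

theory Defs
  imports "HOL-Analysis.Analysis"
begin

text \<open>Complex Banach spaces: Banach spaces over the reals whose scalar multiplication extends to a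
  complex one that is compatible with the norm.\<close>

class complex_banach = banach +
  fixes scaleC :: "complex \<Rightarrow> 'a \<Rightarrow> 'a"  (infixr \<open>*\<^sub>C\<close> 75)
  assumes scaleC_add_right: "c *\<^sub>C (x + y) = c *\<^sub>C x + c *\<^sub>C y"
    and scaleC_add_left: "(c + d) *\<^sub>C x = c *\<^sub>C x + d *\<^sub>C x"
    and scaleC_scaleC: "c *\<^sub>C (d *\<^sub>C x) = (c * d) *\<^sub>C x"
    and scaleC_of_real: "complex_of_real r *\<^sub>C x = r *\<^sub>R x"
    and norm_scaleC: "norm (c *\<^sub>C x) = cmod c * norm x"

text \<open>Only the values \<open>T t\<close> with \<open>t \<ge> 0\<close> matter. The type \<open>\<Rightarrow>\<^sub>L\<close> provides real-linear
  bounded operators, so complex homogeneity is required separately.\<close>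

locale bounded_c0_semigroup =
  fixes T :: "real \<Rightarrow> 'a::complex_banach \<Rightarrow>\<^sub>L 'a"
  assumes complex_linear: "0 \<le> t \<Longrightarrow> T t (c *\<^sub>C x) = c *\<^sub>C T t x"
    and semigroup_zero: "T 0 = id_blinfun"
    and semigroup_add: "0 \<le> s \<Longrightarrow> 0 \<le> t \<Longrightarrow> T (s + t) = T s o\<^sub>L T t"
    and strongly_continuous: "((\<lambda>t. T t x) \<longlongrightarrow> x) (at_right 0)"
    and bounded_semigroup: "bounded (T ` {0..})"

text \<open>An unbounded operator is given by its domain \<open>D\<close> and a function whose values off \<open>D\<close>
  are irrelevant.\<close>

definition is_generator ::
    "(real \<Rightarrow> 'a::real_normed_vector \<Rightarrow>\<^sub>L 'a) \<Rightarrow> 'a set \<Rightarrow> ('a \<Rightarrow> 'a) \<Rightarrow> bool" where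
  "is_generator T D B \<longleftrightarrow>
     D = {x. \<exists>y. ((\<lambda>h. (1 / h) *\<^sub>R (T h x - x)) \<longlongrightarrow> y) (at_right 0)} \<and>
     (\<forall>x\<in>D. ((\<lambda>h. (1 / h) *\<^sub>R (T h x - x)) \<longlongrightarrow> B x) (at_right 0))"

text \<open>The library's Bochner integral is restricted to second-countable target spaces. The
  following is the same definition for arbitrary normed spaces; since the approximating functions
  are simple, integrable functions are still essentially separably valued, and the value of the
  integral is unique.\<close>

definition has_bochner_int ::
    "'s measure \<Rightarrow> ('s \<Rightarrow> 'a::real_normed_vector) \<Rightarrow> 'a \<Rightarrow> bool" where
  "has_bochner_int M f y \<longleftrightarrow> f \<in> borel_measurable M \<and>
     (\<exists>g. (\<forall>i. Bochner_Integration.simple_bochner_integrable M (g i)) \<and>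
          (\<lambda>i. \<integral>\<^sup>+s. ennreal (norm (f s - g i s)) \<partial>M) \<longlonglongrightarrow> 0 \<and>
          (\<lambda>i. Bochner_Integration.simple_bochner_integral M (g i)) \<longlonglongrightarrow> y)"

definition bochner_int :: "'s measure \<Rightarrow> ('s \<Rightarrow> 'a::real_normed_vector) \<Rightarrow> 'a" where
  "bochner_int M f = (THE y. has_bochner_int M f y)"

text \<open>The bounded Radon measure \<open>\<mu>\<^sub>\<alpha>\<close> on \<open>[0,\<infinity>)\<close> with Laplace transform
  \<open>(z / (z + 1))\<^sup>\<alpha>\<close> is real but signed. It is represented by a pair of finite Borel measures
  whose difference it is; the difference is determined by its Laplace transform, so nothing below
  depends on the choice of the pair.\<close>

definition represents_mu :: "real \<Rightarrow> real measure \<times> real measure \<Rightarrow> bool" where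
  "represents_mu \<alpha> = (\<lambda>(P, N).
     finite_measure P \<and> sets P = sets (restrict_space borel {0..}) \<and>
     finite_measure N \<and> sets N = sets (restrict_space borel {0..}) \<and>
     (\<forall>z>0. (\<integral>s. exp (- z * s) \<partial>P) - (\<integral>s. exp (- z * s) \<partial>N) = (z / (z + 1)) powr \<alpha>))"

definition mu :: "real \<Rightarrow> real measure \<times> real measure" where
  "mu \<alpha> = (SOME p. represents_mu \<alpha> p)"

text \<open>In the following, \<open>A\<close> is the negative of the generator of \<open>T\<close>, i.e. \<open>T s\<close> is
  \<open>e\<^sup>-\<^sup>s\<^sup>A\<close>. The operators \<open>u\<^sub>\<alpha>(A)\<close>, \<open>v\<^sub>\<alpha>(A)\<close> and \<open>A\<^sup>\<alpha>\<close> depend on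
  \<open>A\<close> only through \<open>T\<close>, which is therefore the parameter.\<close>

definition u_op :: "(real \<Rightarrow> 'a::real_normed_vector \<Rightarrow>\<^sub>L 'a) \<Rightarrow> real \<Rightarrow> 'a \<Rightarrow> 'a" where
  "u_op T \<alpha> x = bochner_int (fst (mu \<alpha>)) (\<lambda>s. T s x) - bochner_int (snd (mu \<alpha>)) (\<lambda>s. T s x)"

definition v_op :: "(real \<Rightarrow> 'a::real_normed_vector \<Rightarrow>\<^sub>L 'a) \<Rightarrow> real \<Rightarrow> 'a \<Rightarrow> 'a" where
  "v_op T \<alpha> x = (1 / Gamma \<alpha>) *\<^sub>R
     bochner_int (restrict_space lborel {0..}) (\<lambda>s. (s powr (\<alpha> - 1) * exp (- s)) *\<^sub>R T s x)"

definition frac_pow_dom :: "(real \<Rightarrow> 'a::real_normed_vector \<Rightarrow>\<^sub>L 'a) \<Rightarrow> real \<Rightarrow> 'a set" where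
  "frac_pow_dom T \<alpha> = {x. u_op T \<alpha> x \<in> range (v_op T \<alpha>)}"

definition frac_pow :: "(real \<Rightarrow> 'a::real_normed_vector \<Rightarrow>\<^sub>L 'a) \<Rightarrow> real \<Rightarrow> 'a \<Rightarrow> 'a" where
  "frac_pow T \<alpha> x = inv (v_op T \<alpha>) (u_op T \<alpha> x)"

text \<open>The norm-convergent exponential series. The library's \<open>exp\<close> needs a unital normed algebra
  with \<open>norm 1 = 1\<close>, which fails for the operators on the zero space.\<close>

definition op_exp :: "('a::banach \<Rightarrow>\<^sub>L 'a) \<Rightarrow> 'a \<Rightarrow>\<^sub>L 'a" where
  "op_exp B = (\<Sum>k. (1 / fact k) *\<^sub>R (((o\<^sub>L) B ^^ k) id_blinfun))"

text \<open>For an operator \<open>A\<close> with domain \<open>D\<close>, \<open>op_inv a b D A\<close> is \<open>(a + b A)\<^sup>-\<^sup>1\<close>.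
  It is meaningful where \<open>a + b A\<close> maps \<open>D\<close> bijectively onto the space, as is the case for
  \<open>a, b > 0\<close> and \<open>-A\<close> the generator of a bounded semigroup.\<close>

definition op_inv :: "real \<Rightarrow> real \<Rightarrow> 'a::real_vector set \<Rightarrow> ('a \<Rightarrow> 'a) \<Rightarrow> 'a \<Rightarrow> 'a" where
  "op_inv a b D A = inv_into D (\<lambda>x. a *\<^sub>R x + b *\<^sub>R A x)"

definition yosida :: "'a::real_normed_vector set \<Rightarrow> ('a \<Rightarrow> 'a) \<Rightarrow> nat \<Rightarrow> 'a \<Rightarrow>\<^sub>L 'a" where
  "yosida D A n = Blinfun (\<lambda>x. A (op_inv (real n) 1 D A x))"

end

theory Submission
  imports Defs
begin

text \<open>Passing to the equivalent norm \<open>sup\<^sub>s \<parallel>T\<^sub>s x\<parallel>\<close> makes the semigroup contractive. In this norm each of the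
  three errors \<open>\<Delta>\<close> satisfies \<open>\<parallel>\<Delta>x\<parallel> \<le> 2\<parallel>x\<parallel>\<close> and, by telescoping, \<open>\<parallel>\<Delta>x\<parallel> \<le> K\<parallel>A\<^sup>2x\<parallel>\<close> with \<open>K\<close> equal to
  \<open>t/n\<close>, \<open>t/(2n)\<close> and \<open>t\<^sup>2/(2n)\<close>. Landau's argument gives \<open>\<parallel>\<Delta>x\<parallel> \<le> 2(2K)\<^sup>1\<^sup>/\<^sup>2\<parallel>Ax\<parallel>\<close>. Between consecutive
  integer exponents one interpolates by \<open>x = A(\<epsilon> + A)\<^sup>-\<^sup>1x + \<epsilon>(\<epsilon> + A)\<^sup>-\<^sup>1x\<close>, where for \<open>0 < b \<le> 1\<close> the norm of
  \<open>A(\<epsilon> + A)\<^sup>-\<^sup>1x\<close> is at most \<open>2\<epsilon>\<^sup>-\<^sup>b\<parallel>A\<^sup>bx\<parallel>\<close>, because \<open>z\<^sup>1\<^sup>-\<^sup>b/(z + \<epsilon>)\<close> is the Laplace transform of a signed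
  measure of total mass at most \<open>2\<epsilon>\<^sup>-\<^sup>b\<close>. Identities between operators of the form \<open>\<integral> T\<^sub>s d\<mu>(s)\<close> are
  identities between Laplace transforms of the measures \<open>\<mu>\<close>.\<close>

subsection \<open>Norming functionals\<close>

text \<open>A vector identity is tested with real bounded functionals, which separate points; it
  thereby becomes a statement about the bounded scalar functions
  \<open>s \<mapsto> f (T s x)\<close>. The unbounded operator is reached through bounded ones as
  well: \<open>T r u - u = - J r w\<close> for all \<open>r > 0\<close>, with \<open>J r\<close> the
  integral of the semigroup over \<open>[0,r]\<close>, expresses \<open>A u = w\<close>, so this too
  is a comparison of Laplace transforms. The fractional power enters as the relation
  \<open>v_op T \<alpha> y = u_op T \<alpha> x\<close>. The exponentials in a) and b) have the form
  exp(- c (1 - B)), where B is n times the resolvent at n, or \<open>T (1 / n)\<close>, and is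
  contractive in the new norm. They are limits of the powers ((1 - c/N) + (c/N) B)^N, whose base is
  a convex combination of contractions once N >= c; so they can be telescoped against
  \<open>T (t / N)\<close> just as Euler's scheme against \<open>T (t / n)\<close>. Interpolation
  yields the factor 8 (2K)^(\<alpha>/2). In b) and c), 2K is exactly t/n and t^2/n; in a) it is
  2t/n, and 2^(\<alpha>/2) \<le> 2 turns 8 into 16. The old norm is below the new one, and the new
  one is at most M times the old; the second comparison is made only on the right-hand side, so M
  appears to the first power.\<close>

lemma norming_functional:
  fixes v :: "'a::real_normed_vector"
  obtains f :: "'a \<Rightarrow> real" where "bounded_linear f" "\<And>x. \<bar>f x\<bar> \<le> norm x" "f v = norm v"
proof -
  \<comment> \<open>Hahn-Banach with partial functionals encoded as graphs. The one-sided bound is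
    enough: a subspace is closed under negation, so \<bar>r\<bar> \<le> norm x follows, and applied
    to \<open>(0, r - s)\<close> this makes the graph single-valued.\<close>
  define \<G> where "\<G> = {G :: ('a \<times> real) set. subspace G \<and> (\<forall>(x, r)\<in>G. r \<le> norm x) \<and> (v, norm v) \<in> G}"
  have "\<exists>G\<in>\<G>. \<forall>H\<in>\<G>. G \<subseteq> H \<longrightarrow> H = G"
  proof (rule subset_Zorn)
    fix \<C> assume chain: "subset.chain \<G> \<C>"
    show "\<exists>U\<in>\<G>. \<forall>G\<in>\<C>. G \<subseteq> U"
    proof (cases "\<C> = {}")
      case True
      have "k * norm v \<le> norm (k *\<^sub>R v)" for k
        by (simp add: mult_right_mono)
      then have "\<forall>(x, r)\<in>span {(v, norm v)}. r \<le> norm x"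
        by (auto simp: span_singleton simp del: norm_scaleR)
      then have "span {(v, norm v)} \<in> \<G>"
        by (simp add: \<G>_def span_base)
      then show ?thesis using True by auto
    next
      case False
      have chain2: "G \<subseteq> H \<or> H \<subseteq> G" if "G \<in> \<C>" "H \<in> \<C>" for G H
        using chain that by (auto simp: subset.chain_def)
      have sub: "\<C> \<subseteq> \<G>" using chain by (auto simp: subset.chain_def)
      have "subspace (\<Union>\<C>)"
        unfolding subspace_def
      proof (intro conjI ballI allI)
        show "0 \<in> \<Union>\<C>" using False sub subspace_0 unfolding \<G>_def by blast
      next
        fix x y assume "x \<in> \<Union>\<C>" "y \<in> \<Union>\<C>"
        then obtain G H where "G \<in> \<C>" "H \<in> \<C>" "x \<in> G" "y \<in> H" by auto
        then obtain K where "K \<in> \<C>" "x \<in> K" "y \<in> K" using chain2[of G H] by auto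
        then show "x + y \<in> \<Union>\<C>" using sub by (auto simp: \<G>_def intro: subspace_add)
      next
        fix c x assume "x \<in> \<Union>\<C>"
        then show "c *\<^sub>R x \<in> \<Union>\<C>" using sub by (auto simp: \<G>_def intro: subspace_scale)
      qed
      moreover have "(v, norm v) \<in> \<Union>\<C>" using False sub by (auto simp: \<G>_def)
      moreover have "\<forall>(x, r)\<in>\<Union>\<C>. r \<le> norm x" using sub unfolding \<G>_def by blast
      ultimately have "\<Union>\<C> \<in> \<G>" by (simp add: \<G>_def)
      then show ?thesis by auto
    qed
  qed
  then obtain G where G: "G \<in> \<G>" and maxi: "\<And>H. H \<in> \<G> \<Longrightarrow> G \<subseteq> H \<Longrightarrow> H = G" by blast
  have sG: "subspace G" and nG: "\<And>x r. (x, r) \<in> G \<Longrightarrow> r \<le> norm x" and vG: "(v, norm v) \<in> G"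
    using G by (auto simp: \<G>_def)
  have neg: "(- x, - r) \<in> G" if "(x, r) \<in> G" for x r
    using subspace_neg[OF sG that] by simp
  have add: "(x + y, r + s) \<in> G" if "(x, r) \<in> G" "(y, s) \<in> G" for x y r s
    using subspace_add[OF sG that] by simp
  have scale: "(c *\<^sub>R x, c * r) \<in> G" if "(x, r) \<in> G" for x r c
    using subspace_scale[OF sG that, of c] by simp
  have bnd: "\<bar>r\<bar> \<le> norm x" if "(x, r) \<in> G" for x r
    using nG[OF that] nG[OF neg[OF that]] by auto
  have single: "r = s" if "(x, r) \<in> G" "(x, s) \<in> G" for x r s
    using bnd[OF add[OF that(1) neg[OF that(2)]]] by simp
  have total: "\<exists>r. (w, r) \<in> G" for w
  proof -
    \<comment> \<open>Any value at \<open>w\<close> between all r - norm (x - w) and all norm (y +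
      w) - s is admissible; \<open>c\<close> is the least one. The cases a > 0 and a < 0 below are
      these two bounds, rescaled by the absolute value of \<open>a\<close>.\<close>
    define S where "S = (\<lambda>(x, r). r - norm (x - w)) ` G"
    have G0: "(0, 0) \<in> G" using subspace_0[OF sG] by (simp add: zero_prod_def)
    have le: "r - norm (x - w) \<le> norm (y + w) - s" if "(x, r) \<in> G" "(y, s) \<in> G" for x y r s
    proof -
      have "r + s \<le> norm ((x - w) + (y + w))" using nG[OF add[OF that]] by simp
      also have "\<dots> \<le> norm (x - w) + norm (y + w)" by (rule norm_triangle_ineq)
      finally show ?thesis by simp
    qed
    define c where "c = Sup S"
    have ne: "S \<noteq> {}" using G0 by (auto simp: S_def)
    have up: "r - norm (x - w) \<le> c" if "(x, r) \<in> G" for x r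
      unfolding c_def
    proof (rule cSup_upper)
      show "r - norm (x - w) \<in> S" using that by (force simp: S_def)
      show "bdd_above S" using le[OF _ G0] by (force simp: S_def intro!: bdd_aboveI)
    qed
    have lo: "c \<le> norm (y + w) - s" if "(y, s) \<in> G" for y s
      unfolding c_def using ne le[OF _ that] by (auto simp: S_def intro!: cSup_least)
    define H where "H = {(x + a *\<^sub>R w, r + a * c) | x r a. (x, r) \<in> G}"
    have "subspace H"
      unfolding subspace_def
    proof (intro conjI ballI allI)
      show "0 \<in> H" using G0 by (force simp: H_def zero_prod_def)
    next
      fix p p' assume "p \<in> H" "p' \<in> H"
      then obtain x r a x' r' a' where "(x, r) \<in> G" "(x', r') \<in> G"
        "p = (x + a *\<^sub>R w, r + a * c)" "p' = (x' + a' *\<^sub>R w, r' + a' * c)"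
        unfolding H_def by blast
      then show "p + p' \<in> H"
        unfolding H_def
        by (intro CollectI exI[of _ "x + x'"] exI[of _ "r + r'"] exI[of _ "a + a'"])
           (auto simp: add algebra_simps)
    next
      fix k p assume "p \<in> H"
      then obtain x r a where "(x, r) \<in> G" "p = (x + a *\<^sub>R w, r + a * c)"
        unfolding H_def by blast
      then show "k *\<^sub>R p \<in> H"
        unfolding H_def
        by (intro CollectI exI[of _ "k *\<^sub>R x"] exI[of _ "k * r"] exI[of _ "k * a"])
           (auto simp: scale algebra_simps)
    qed
    moreover have "r + a * c \<le> norm (x + a *\<^sub>R w)" if xr: "(x, r) \<in> G" for x r a
    proof -
      consider "a = 0" | "a > 0" | "a < 0" by linarith
      then show ?thesis
      proof cases
        case 1 then show ?thesis using nG[OF xr] by simp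
      next
        case 2
        have "c \<le> norm (inverse a *\<^sub>R x + w) - inverse a * r" by (rule lo[OF scale[OF xr]])
        then have "a * c \<le> a * (norm (inverse a *\<^sub>R x + w) - inverse a * r)"
          using 2 by (simp add: mult_left_mono)
        also have "\<dots> = norm (a *\<^sub>R (inverse a *\<^sub>R x + w)) - r"
          using 2 by (simp add: right_diff_distrib mult.assoc[symmetric])
        also have "a *\<^sub>R (inverse a *\<^sub>R x + w) = x + a *\<^sub>R w" using 2 by (simp add: scaleR_add_right)
        finally show ?thesis by simp
      next
        case 3
        define b where "b = - a"
        have b: "b > 0" "a = - b" using 3 by (auto simp: b_def)
        have "inverse b * r - norm (inverse b *\<^sub>R x - w) \<le> c" by (rule up[OF scale[OF xr]])
        then have "b * (inverse b * r - norm (inverse b *\<^sub>R x - w)) \<le> b * c"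
          using b by (simp add: mult_left_mono)
        moreover have "b * (inverse b * r - norm (inverse b *\<^sub>R x - w))
            = r - norm (b *\<^sub>R (inverse b *\<^sub>R x - w))"
          using b by (simp add: right_diff_distrib mult.assoc[symmetric])
        moreover have "b *\<^sub>R (inverse b *\<^sub>R x - w) = x + a *\<^sub>R w" using b by (simp add: scaleR_diff_right)
        ultimately show ?thesis using b by simp
      qed
    qed
    moreover have GH: "G \<subseteq> H"
    proof
      fix p assume "p \<in> G"
      then show "p \<in> H" unfolding H_def
        by (intro CollectI exI[of _ "fst p"] exI[of _ "snd p"] exI[of _ 0]) auto
    qed
    moreover have "(v, norm v) \<in> H" using GH vG by blast
    ultimately have "H \<in> \<G>" by (auto simp: \<G>_def H_def)
    then have "H = G" using GH maxi by blast
    moreover have "(0 + 1 *\<^sub>R w, 0 + 1 * c) \<in> H" using G0 unfolding H_def by blast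
    ultimately show ?thesis by auto
  qed
  define f where "f x = (THE r. (x, r) \<in> G)" for x
  have fG: "(x, f x) \<in> G" for x
    using total[of x] single unfolding f_def by (metis (mono_tags) theI)
  have feq: "f x = r" if "(x, r) \<in> G" for x r using single[OF that fG] by simp
  have f_bnd: "\<bar>f x\<bar> \<le> norm x" for x by (rule bnd[OF fG])
  have "bounded_linear f"
    by (rule bounded_linear_intro[of _ 1])
       (use f_bnd in \<open>simp_all add: feq[OF add[OF fG fG]] feq[OF scale[OF fG]]\<close>)
  with f_bnd feq[OF vG] that show ?thesis by blast
qed

lemma eq_if_functionals_eq:
  fixes v w :: "'a::real_normed_vector"
  assumes "\<And>f :: 'a \<Rightarrow> real. bounded_linear f \<Longrightarrow> f v = f w"
  shows "v = w"
proof -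
  obtain f :: "'a \<Rightarrow> real" where f: "bounded_linear f" "f (v - w) = norm (v - w)"
    using norming_functional by metis
  then have "norm (v - w) = f v - f w" by (simp add: linear_simps)
  then show ?thesis using assms[OF f(1)] by simp
qed

subsection \<open>The Bochner integral of weighted continuous functions\<close>

text \<open>In a space that is not second countable, a difference of measurable functions need not
  be measurable. Here only a constant is subtracted on each of the finitely many level sets of
  \<open>S\<close>.\<close>

lemma borel_measurable_diff_simple:
  fixes g S :: "'s \<Rightarrow> 'a::real_normed_vector"
  assumes g: "g \<in> borel_measurable M" and S: "simple_function M S"
  shows "(\<lambda>s. g s - S s) \<in> borel_measurable M"
proof (rule measurable_compose_countable'[where f = "\<lambda>v s. g s - v" and I = "S ` space M"])
  show "countable (S ` space M)" using S by (auto simp: simple_function_def intro: countable_finite)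
  then show "S \<in> measurable M (count_space (S ` space M))"
    using S by (auto intro!: measurable_count_space_eq_countable[THEN iffD2] simp: simple_function_def)
  show "(\<lambda>s. g s - v) \<in> borel_measurable M" for v
    by (rule measurable_compose[OF g], rule borel_measurable_continuous_onI) (intro continuous_intros)
qed

text \<open>Composition with \<open>f\<close> sends the simple approximants of \<open>g\<close> to
  simple approximants of the scalar function, and the bound \<open>K\<close> of \<open>f\<close>
  controls the new error in mean.\<close>

lemma has_bochner_int_functional:
  assumes "has_bochner_int M g y" and f: "bounded_linear (f :: 'a::real_normed_vector \<Rightarrow> real)"
  shows "has_bochner_integral M (\<lambda>s. f (g s)) (f y)"
proof -
  interpret f: bounded_linear f by fact
  obtain K where K: "\<And>x. norm (f x) \<le> norm x * K" and Kpos: "K > 0" using f.pos_bounded by blast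
  obtain S where g: "g \<in> borel_measurable M"
    and S: "\<And>i. Bochner_Integration.simple_bochner_integrable M (S i)"
    and lim0: "(\<lambda>i. \<integral>\<^sup>+s. ennreal (norm (g s - S i s)) \<partial>M) \<longlonglongrightarrow> 0"
    and lim: "(\<lambda>i. Bochner_Integration.simple_bochner_integral M (S i)) \<longlonglongrightarrow> y"
    using assms(1) unfolding has_bochner_int_def by blast
  have meas_f: "f \<in> borel_measurable borel" by (intro borel_measurable_continuous_onI f.continuous_on continuous_on_id)
  have Ss: "simple_function M (S i)" for i
    using S[of i] by (rule simple_bochner_integrable.cases)
  show ?thesis
  proof (rule has_bochner_integral.intros)
    show "(\<lambda>s. f (g s)) \<in> borel_measurable M" using meas_f g by simp
    show "Bochner_Integration.simple_bochner_integrable M (\<lambda>s. f (S i s))" for i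
      by (rule simple_bochner_integrable_compose2[OF _ S S, of "\<lambda>a b. f a"]) (simp add: f.zero)
    show "(\<lambda>i. Bochner_Integration.simple_bochner_integral M (\<lambda>s. f (S i s))) \<longlonglongrightarrow> f y"
      using f.tendsto[OF lim] by (simp add: simple_bochner_integral_linear[OF f.linear S])
    show "(\<lambda>i. \<integral>\<^sup>+s. ennreal (norm (f (g s) - f (S i s))) \<partial>M) \<longlonglongrightarrow> 0"
    proof (rule tendsto_sandwich[OF _ _ tendsto_const])
      show "\<forall>\<^sub>F i in sequentially. 0 \<le> (\<integral>\<^sup>+s. ennreal (norm (f (g s) - f (S i s))) \<partial>M)" by simp
      have "(\<integral>\<^sup>+s. ennreal (norm (f (g s) - f (S i s))) \<partial>M) \<le> ennreal K * (\<integral>\<^sup>+s. ennreal (norm (g s - S i s)) \<partial>M)" for i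
      proof -
        have "(\<integral>\<^sup>+s. ennreal (norm (f (g s) - f (S i s))) \<partial>M) \<le> (\<integral>\<^sup>+s. ennreal K * ennreal (norm (g s - S i s)) \<partial>M)"
          using Kpos K by (intro nn_integral_mono)
            (simp add: f.diff[symmetric] ennreal_mult[symmetric] mult.commute del: real_norm_def)
        also have "\<dots> = ennreal K * (\<integral>\<^sup>+s. ennreal (norm (g s - S i s)) \<partial>M)"
          by (rule nn_integral_cmult)
             (intro measurable_compose[OF _ measurable_ennreal] measurable_compose[OF _ borel_measurable_norm]
               borel_measurable_diff_simple[OF g Ss])
        finally show ?thesis .
      qed
      then show "\<forall>\<^sub>F i in sequentially. (\<integral>\<^sup>+s. ennreal (norm (f (g s) - f (S i s))) \<partial>M)
          \<le> ennreal K * (\<integral>\<^sup>+s. ennreal (norm (g s - S i s)) \<partial>M)" by simp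
      show "(\<lambda>i. ennreal K * (\<integral>\<^sup>+s. ennreal (norm (g s - S i s)) \<partial>M)) \<longlonglongrightarrow> 0"
        using ennreal_tendsto_cmult[OF _ lim0, of "ennreal K"] by simp
    qed
  qed
qed

text \<open>Continuity of \<open>F\<close> replaces separability of the target: \<open>F\<close> is
  evaluated on a finite grid that becomes finer and longer, which gives simple functions converging
  pointwise.\<close>

lemma ex_has_bochner_int:
  fixes F :: "real \<Rightarrow> 'a::banach"
  assumes M: "sets M = sets (restrict_space borel {0..})"
    and w: "integrable M w"
    and F: "continuous_on {0..} F" "bounded (F ` {0..})"
  shows "\<exists>y. has_bochner_int M (\<lambda>s. w s *\<^sub>R F s) y"
proof -
  have sp: "space M = {0..}" using sets_eq_imp_space_eq[OF M] by (simp add: space_restrict_space)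
  obtain C where C: "\<And>s. s \<ge> 0 \<Longrightarrow> norm (F s) \<le> C" 
    using F(2) by (auto simp: bounded_iff)
  have C0: "C \<ge> 0" using C[of 0] norm_ge_zero[of "F 0"] by linarith
  have wm[measurable]: "w \<in> borel_measurable M" using w by auto
  obtain W where W: "\<And>i. simple_function M (W i)" "\<And>s. s \<in> space M \<Longrightarrow> (\<lambda>i. W i s) \<longlonglongrightarrow> w s"
    "\<And>i s. s \<in> space M \<Longrightarrow> norm (W i s) \<le> 2 * norm (w s)"
    using borel_measurable_implies_sequence_metric[OF wm, of 0] unfolding dist_norm diff_0_right by blast
  \<comment> \<open>On \<open>[0,i)\<close> the point \<open>s\<close> is rounded down to a multiple
    of 1/(i+1), elsewhere to \<open>0\<close>. With \<open>W\<close> bounded by twice \<bar>w\<bar>,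
    the approximant \<open>G\<close> is bounded by 2C\<bar>w\<bar> and the error by 3C\<bar>w\<bar>,
    the dominating function used below.\<close>
  define r where "r i s = (if s < real i then real (nat \<lfloor>real (Suc i) * s\<rfloor>) / real (Suc i) else 0)" for i and s :: real
  define G where "G i s = W i s *\<^sub>R F (r i s)" for i s
  have r_lim: "(\<lambda>i. r i s) \<longlonglongrightarrow> s" if s: "s \<ge> 0" for s
  proof (rule tendsto_sandwich)
    obtain N :: nat where N: "s < real N" using reals_Archimedean2 by blast
    have ev: "\<forall>\<^sub>F i in sequentially. i \<ge> N" by (rule eventually_ge_at_top)
    have bounds: "s - 1 / real (Suc i) \<le> r i s \<and> r i s \<le> s" if "i \<ge> N" for i
    proof -
      have "r i s = of_int \<lfloor>real (Suc i) * s\<rfloor> / real (Suc i)" using that N s by (simp add: r_def)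
      moreover have "(real (Suc i) * s - 1) / real (Suc i) \<le> of_int \<lfloor>real (Suc i) * s\<rfloor> / real (Suc i)"
        "of_int \<lfloor>real (Suc i) * s\<rfloor> / real (Suc i) \<le> (real (Suc i) * s) / real (Suc i)"
        by (intro divide_right_mono; linarith)+
      ultimately show ?thesis by (simp add: diff_divide_distrib del: of_nat_Suc)
    qed
    show "\<forall>\<^sub>F i in sequentially. s - 1 / real (Suc i) \<le> r i s" using ev by eventually_elim (use bounds in blast)
    show "\<forall>\<^sub>F i in sequentially. r i s \<le> s" using ev by eventually_elim (use bounds in blast)
    show "(\<lambda>i. s - 1 / real (Suc i)) \<longlonglongrightarrow> s"
      using tendsto_diff[OF tendsto_const[of s] LIMSEQ_inverse_real_of_nat] by (simp add: inverse_eq_divide)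
  qed simp
  have r0: "r i s \<ge> 0" for i s by (simp add: r_def)
  have Fr: "(\<lambda>i. F (r i s)) \<longlonglongrightarrow> F s" if "s \<ge> 0" for s
    using F(1) r_lim[OF that] r0 that by (auto simp: continuous_on_sequentially o_def)
  have Glim: "(\<lambda>i. G i s) \<longlonglongrightarrow> w s *\<^sub>R F s" if "s \<in> space M" for s
    unfolding G_def using that Fr W(2)[OF that] by (intro tendsto_scaleR) (auto simp: sp)
  have r_simple: "simple_function M (r i)" for i
  proof -
    have "finite (r i ` space M)"
    proof (rule finite_subset)
      show "r i ` space M \<subseteq> insert 0 ((\<lambda>k. real k / real (Suc i)) ` {..Suc i * i})"
      proof
        fix x assume "x \<in> r i ` space M"
        then obtain s where s: "s \<ge> 0" "x = r i s" by (auto simp: sp)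
        have "nat \<lfloor>real (Suc i) * s\<rfloor> \<le> Suc i * i" if "s < real i"
        proof -
          have "real (Suc i) * s \<le> real (Suc i) * real i" using that by (intro mult_left_mono) auto
          then have "\<lfloor>real (Suc i) * s\<rfloor> \<le> \<lfloor>real (Suc i * i)\<rfloor>"
            by (intro floor_mono) (simp only: of_nat_mult)
          then show ?thesis unfolding floor_of_nat by linarith
        qed
        then show "x \<in> insert 0 ((\<lambda>k. real k / real (Suc i)) ` {..Suc i * i})"
          unfolding s(2) r_def by (cases "s < real i") (simp_all only: if_True if_False, blast+)
      qed
    qed simp
    moreover have "r i \<in> borel_measurable M"
      unfolding measurable_cong_sets[OF M refl] r_def by (rule measurable_restrict_space1) measurable
    ultimately show ?thesis by (simp add: simple_function_borel_measurable)
  qed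
  have Gs: "simple_function M (G i)" for i
    unfolding G_def by (intro simple_function_compose2[OF W(1) r_simple])
  have Gb: "norm (G i s) \<le> 2 * C * norm (w s)" if "s \<in> space M" for i s
    using mult_mono[OF W(3)[OF that, of i] C[OF r0[of i s]]] by (simp add: G_def mult_ac)
  have Gi: "Bochner_Integration.simple_bochner_integrable M (G i)" for i
  proof (rule simple_bochner_integrableI_bounded[OF Gs])
    have "(\<integral>\<^sup>+s. ennreal (norm (G i s)) \<partial>M) \<le> (\<integral>\<^sup>+s. ennreal (norm (2 * C * w s)) \<partial>M)"
      using Gb C0 by (intro nn_integral_mono) (auto simp: abs_mult)
    also have "\<dots> < \<infinity>" using integrable_mult_right[OF w, of "2 * C"] unfolding integrable_iff_bounded by blast
    finally show "(\<integral>\<^sup>+s. ennreal (norm (G i s)) \<partial>M) < \<infinity>" .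
  qed
  have Fm: "(\<lambda>s. w s *\<^sub>R F s) \<in> borel_measurable M"
    by (rule borel_measurable_LIMSEQ_metric[OF borel_measurable_simple_function[OF Gs] Glim])
  have lim0: "(\<lambda>i. \<integral>\<^sup>+s. ennreal (norm (w s *\<^sub>R F s - G i s)) \<partial>M) \<longlonglongrightarrow> 0"
  proof -
    have "(\<lambda>i. \<integral>\<^sup>+s. ennreal (norm (w s *\<^sub>R F s - G i s)) \<partial>M) \<longlonglongrightarrow> (\<integral>\<^sup>+s. 0 \<partial>M)"
    proof (rule nn_integral_dominated_convergence[where w = "\<lambda>s. ennreal (norm (3 * C * w s))"])
      show "(\<lambda>s. ennreal (norm (w s *\<^sub>R F s - G i s))) \<in> borel_measurable M" for i
        by (intro measurable_compose[OF _ measurable_ennreal] measurable_compose[OF _ borel_measurable_norm]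
             borel_measurable_diff_simple[OF Fm Gs])
      show "(\<integral>\<^sup>+s. ennreal (norm (3 * C * w s)) \<partial>M) < \<infinity>"
        using integrable_mult_right[OF w, of "3 * C"] unfolding integrable_iff_bounded by blast
      show "AE s in M. ennreal (norm (w s *\<^sub>R F s - G i s)) \<le> ennreal (norm (3 * C * w s))" for i
      proof (rule AE_I2)
        fix s assume s: "s \<in> space M"
        have "norm (w s *\<^sub>R F s - G i s) \<le> norm (w s *\<^sub>R F s) + norm (G i s)" by (rule norm_triangle_ineq4)
        also have "\<dots> \<le> C * norm (w s) + 2 * C * norm (w s)"
          using Gb[OF s] mult_right_mono[OF C[of s], of "\<bar>w s\<bar>"] s
          by (intro add_mono) (auto simp: sp mult.commute)
        finally show "ennreal (norm (w s *\<^sub>R F s - G i s)) \<le> ennreal (norm (3 * C * w s))"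
          using C0 by (intro ennreal_leI) (simp add: abs_mult)
      qed
      show "AE s in M. (\<lambda>i. ennreal (norm (w s *\<^sub>R F s - G i s))) \<longlonglongrightarrow> 0"
      proof (rule AE_I2)
        fix s assume s: "s \<in> space M"
        have "(\<lambda>i. norm (w s *\<^sub>R F s - G i s)) \<longlonglongrightarrow> norm (w s *\<^sub>R F s - w s *\<^sub>R F s)"
          by (intro tendsto_intros Glim s)
        then show "(\<lambda>i. ennreal (norm (w s *\<^sub>R F s - G i s))) \<longlonglongrightarrow> 0"
          using tendsto_ennrealI by fastforce
      qed
    qed auto
    then show ?thesis by simp
  qed
  have "Cauchy (\<lambda>i. Bochner_Integration.simple_bochner_integral M (G i))"
  proof (rule CauchyI)
    fix e :: real assume e: "e > 0"
    let ?d = "\<lambda>i. \<integral>\<^sup>+s. ennreal (norm (w s *\<^sub>R F s - G i s)) \<partial>M"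
    have "\<forall>\<^sub>F i in sequentially. ?d i < ennreal (e / 2)"
      using lim0 e by (intro order_tendstoD(2)) auto
    then obtain N where N: "\<And>i. i \<ge> N \<Longrightarrow> ?d i < ennreal (e / 2)" by (auto simp: eventually_sequentially)
    have "norm (Bochner_Integration.simple_bochner_integral M (G i) - Bochner_Integration.simple_bochner_integral M (G j)) < e" if "i \<ge> N" "j \<ge> N" for i j
    proof -
      have dm: "(\<lambda>s. ennreal (norm (w s *\<^sub>R F s - G i s))) \<in> borel_measurable M" for i
        by (intro measurable_compose[OF _ measurable_ennreal] measurable_compose[OF _ borel_measurable_norm]
             borel_measurable_diff_simple[OF Fm Gs])
      have dd: "Bochner_Integration.simple_bochner_integrable M (\<lambda>s. G i s - G j s)"
        by (rule simple_bochner_integrable_compose2[OF _ Gi Gi]) simp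
      have "ennreal (norm (Bochner_Integration.simple_bochner_integral M (G i) - Bochner_Integration.simple_bochner_integral M (G j)))
          = ennreal (norm (Bochner_Integration.simple_bochner_integral M (\<lambda>s. G i s - G j s)))"
        by (simp add: simple_bochner_integral_diff Gi)
      also have "\<dots> \<le> ennreal (Bochner_Integration.simple_bochner_integral M (\<lambda>s. norm (G i s - G j s)))"
        by (intro ennreal_leI simple_bochner_integral_norm_bound dd)
      also have "\<dots> = (\<integral>\<^sup>+s. ennreal (norm (G i s - G j s)) \<partial>M)"
        by (rule simple_bochner_integral_eq_nn_integral)
           (auto intro!: simple_bochner_integrable_compose2[OF _ Gi Gi, of "\<lambda>a b. norm (a - b)"])
      also have "\<dots> \<le> (\<integral>\<^sup>+s. ennreal (norm (w s *\<^sub>R F s - G i s)) + ennreal (norm (w s *\<^sub>R F s - G j s)) \<partial>M)"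
      proof (rule nn_integral_mono)
        fix s
        have "norm (G i s - G j s) \<le> norm (w s *\<^sub>R F s - G i s) + norm (w s *\<^sub>R F s - G j s)"
          by (metis norm_diff_triangle_le norm_minus_commute order_refl)
        then show "ennreal (norm (G i s - G j s)) \<le> ennreal (norm (w s *\<^sub>R F s - G i s)) + ennreal (norm (w s *\<^sub>R F s - G j s))"
          by (metis ennreal_leI ennreal_plus norm_ge_zero)
      qed
      also have "\<dots> = ?d i + ?d j" by (intro nn_integral_add dm)
      also have "\<dots> < ennreal (e / 2) + ennreal (e / 2)" by (intro add_strict_mono N that)
      also have "\<dots> = ennreal e" using e by (simp flip: ennreal_plus)
      finally show ?thesis using e by (simp add: ennreal_less_iff)
    qed
    then show "\<exists>N. \<forall>i\<ge>N. \<forall>j\<ge>N. norm (Bochner_Integration.simple_bochner_integral M (G i) - Bochner_Integration.simple_bochner_integral M (G j)) < e" by blast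
  qed
  then obtain y where "(\<lambda>i. Bochner_Integration.simple_bochner_integral M (G i)) \<longlonglongrightarrow> y"
    by (auto simp: Cauchy_convergent_iff convergent_def)
  then show ?thesis using Fm Gi lim0 unfolding has_bochner_int_def by blast
qed

text \<open>Two Bochner integrals of the same function agree under every functional, hence are
  equal; so \<open>THE\<close> in \<open>bochner_int\<close> denotes a genuine value. All later
  facts about these integrals come from this formula.\<close>

lemma bochner_int_functional:
  fixes F :: "real \<Rightarrow> 'a::banach"
  assumes "sets M = sets (restrict_space borel {0..})" "integrable M w"
    and "continuous_on {0..} F" "bounded (F ` {0..})"
    and f: "bounded_linear (f :: 'a \<Rightarrow> real)"
  shows "f (bochner_int M (\<lambda>s. w s *\<^sub>R F s)) = (\<integral>s. w s * f (F s) \<partial>M)"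
proof -
  obtain y where y: "has_bochner_int M (\<lambda>s. w s *\<^sub>R F s) y" using ex_has_bochner_int[OF assms(1-4)] by blast
  have "z = y" if "has_bochner_int M (\<lambda>s. w s *\<^sub>R F s) z" for z
    by (rule eq_if_functionals_eq)
       (metis has_bochner_integral_eq has_bochner_int_functional that y)
  with y have "bochner_int M (\<lambda>s. w s *\<^sub>R F s) = y" unfolding bochner_int_def by blast
  then show ?thesis
    using has_bochner_int_functional[OF y f] has_bochner_integral_integral_eq
    by (fastforce simp: linear_simps(5)[OF f])
qed

subsection \<open>Uniqueness of Laplace transforms\<close>

text \<open>Only the values on the half-line are restricted; those at negative arguments are
  arbitrary, and \<open>daniell_cong\<close> shows that functionals ignore them.\<close>

definition Cb :: "(real \<Rightarrow> real) set" where
  "Cb = {\<phi>. continuous_on {0..} \<phi> \<and> bounded (\<phi> ` {0..})}"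

text \<open>These are the functionals given by finite signed measures on \<open>[0,\<infinity>)\<close>. Convolution of measures
  becomes an iterated application of functionals, which avoids product measures.\<close>

definition daniell :: "((real \<Rightarrow> real) \<Rightarrow> real) \<Rightarrow> bool" where
  "daniell \<Lambda> \<longleftrightarrow>
     (\<forall>\<phi>\<in>Cb. \<forall>\<psi>\<in>Cb. \<Lambda> (\<lambda>s. \<phi> s + \<psi> s) = \<Lambda> \<phi> + \<Lambda> \<psi>) \<and>
     (\<forall>c. \<forall>\<phi>\<in>Cb. \<Lambda> (\<lambda>s. c * \<phi> s) = c * \<Lambda> \<phi>) \<and>
     (\<exists>K\<ge>0. \<forall>\<phi>\<in>Cb. \<forall>C. (\<forall>s\<ge>0. \<bar>\<phi> s\<bar> \<le> C) \<longrightarrow> \<bar>\<Lambda> \<phi>\<bar> \<le> K * C) \<and>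
     (\<forall>\<Phi> \<phi> C. (\<forall>n. \<Phi> n \<in> Cb) \<longrightarrow> \<phi> \<in> Cb \<longrightarrow> (\<forall>n. \<forall>s\<ge>0. \<bar>\<Phi> n s\<bar> \<le> C) \<longrightarrow>
        (\<forall>s\<ge>0. (\<lambda>n. \<Phi> n s) \<longlonglongrightarrow> \<phi> s) \<longrightarrow> (\<lambda>n. \<Lambda> (\<Phi> n)) \<longlonglongrightarrow> \<Lambda> \<phi>)"

lemma
  assumes "daniell \<Lambda>"
  shows daniell_add: "\<phi> \<in> Cb \<Longrightarrow> \<psi> \<in> Cb \<Longrightarrow> \<Lambda> (\<lambda>s. \<phi> s + \<psi> s) = \<Lambda> \<phi> + \<Lambda> \<psi>"
    and daniell_cmult: "\<phi> \<in> Cb \<Longrightarrow> \<Lambda> (\<lambda>s. c * \<phi> s) = c * \<Lambda> \<phi>"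
    and daniell_bound: "\<exists>K\<ge>0. \<forall>\<phi>\<in>Cb. \<forall>C. (\<forall>s\<ge>0. \<bar>\<phi> s\<bar> \<le> C) \<longrightarrow> \<bar>\<Lambda> \<phi>\<bar> \<le> K * C"
    and daniell_LIMSEQ: "(\<And>n. \<Phi> n \<in> Cb) \<Longrightarrow> \<phi> \<in> Cb \<Longrightarrow> (\<And>n s. s \<ge> 0 \<Longrightarrow> \<bar>\<Phi> n s\<bar> \<le> C) \<Longrightarrow>
        (\<And>s. s \<ge> 0 \<Longrightarrow> (\<lambda>n. \<Phi> n s) \<longlonglongrightarrow> \<phi> s) \<Longrightarrow> (\<lambda>n. \<Lambda> (\<Phi> n)) \<longlonglongrightarrow> \<Lambda> \<phi>"
  using assms unfolding daniell_def by blast+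

lemma CbI: "continuous_on {0..} \<phi> \<Longrightarrow> (\<And>s. s \<ge> 0 \<Longrightarrow> \<bar>\<phi> s\<bar> \<le> C) \<Longrightarrow> \<phi> \<in> Cb"
  unfolding Cb_def bounded_iff by auto

lemma CbE:
  assumes "\<phi> \<in> Cb"
  obtains C where "continuous_on {0..} \<phi>" "\<And>s. s \<ge> 0 \<Longrightarrow> \<bar>\<phi> s\<bar> \<le> C" "C \<ge> 0"
proof -
  obtain C where "\<forall>x\<in>\<phi> ` {0..}. norm x \<le> C" using assms unfolding Cb_def bounded_iff by blast
  then have C: "\<And>s. s \<ge> 0 \<Longrightarrow> \<bar>\<phi> s\<bar> \<le> C" by auto
  then have "C \<ge> 0" using abs_ge_zero[of "\<phi> 0"] by (meson order.trans order_refl)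
  then show ?thesis using that C assms by (auto simp: Cb_def)
qed

lemma Cb_add: "\<phi> \<in> Cb \<Longrightarrow> \<psi> \<in> Cb \<Longrightarrow> (\<lambda>s. \<phi> s + \<psi> s) \<in> Cb"
  unfolding Cb_def by (auto intro: continuous_on_add bounded_plus_comp)

lemma Cb_cmult: "\<phi> \<in> Cb \<Longrightarrow> (\<lambda>s. c * \<phi> s) \<in> Cb"
  unfolding Cb_def using bounded_scaleR_comp[of \<phi> "{0..}" c] by (auto intro: continuous_on_mult)

lemma Cb_shift: "\<phi> \<in> Cb \<Longrightarrow> s \<ge> 0 \<Longrightarrow> (\<lambda>r. \<phi> (s + r)) \<in> Cb"
  unfolding Cb_def
  by (auto intro!: continuous_on_compose2[of "{0..}" \<phi>] continuous_intros elim!: bounded_subset)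

lemma Cb_exp: "z > 0 \<Longrightarrow> (\<lambda>s. exp (- z * s)) \<in> Cb"
  by (rule CbI[of _ 1]) (auto intro!: continuous_intros)

lemma Cb_const: "(\<lambda>s. c) \<in> Cb"
  by (rule CbI[of _ "\<bar>c\<bar>"]) auto

lemma Cb_sum: "(\<And>i. i \<in> I \<Longrightarrow> \<phi> i \<in> Cb) \<Longrightarrow> (\<lambda>s. \<Sum>i\<in>I. \<phi> i s) \<in> Cb"
proof (induction I rule: infinite_finite_induct)
  case (insert i I)
  then show ?case using Cb_add[of "\<phi> i" "\<lambda>s. \<Sum>i\<in>I. \<phi> i s"] by simp
qed (auto intro: Cb_const)

lemma daniell_zero: "daniell \<Lambda> \<Longrightarrow> \<Lambda> (\<lambda>s. 0) = 0"
  using daniell_cmult[of \<Lambda> "\<lambda>s. 0" 0] Cb_const[of 0] by simp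

lemma daniell_sum:
  assumes \<Lambda>: "daniell \<Lambda>" and "\<And>i. i \<in> I \<Longrightarrow> \<phi> i \<in> Cb"
  shows "\<Lambda> (\<lambda>s. \<Sum>i\<in>I. \<phi> i s) = (\<Sum>i\<in>I. \<Lambda> (\<phi> i))"
  using assms(2)
proof (induction I rule: infinite_finite_induct)
  case (insert i I)
  then show ?case
    using daniell_add[OF \<Lambda>, of "\<phi> i" "\<lambda>s. \<Sum>i\<in>I. \<phi> i s"] Cb_sum[of I \<phi>] by simp
qed (auto intro: daniell_zero[OF \<Lambda>])

text \<open>The constant sequence \<phi> converges boundedly on the half-line to \<psi>, so the
  convergence clause of \<open>daniell\<close> identifies the two values.\<close>

lemma daniell_cong:
  assumes "daniell \<Lambda>" "\<phi> \<in> Cb" "\<psi> \<in> Cb" "\<And>s. s \<ge> 0 \<Longrightarrow> \<phi> s = \<psi> s"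
  shows "\<Lambda> \<phi> = \<Lambda> \<psi>"
proof -
  obtain C where "\<And>s. s \<ge> 0 \<Longrightarrow> \<bar>\<phi> s\<bar> \<le> C" using CbE[OF assms(2)] by metis
  then have "(\<lambda>n::nat. \<Lambda> \<phi>) \<longlonglongrightarrow> \<Lambda> \<psi>"
    using assms by (intro daniell_LIMSEQ[OF assms(1)]) auto
  then show ?thesis by (rule LIMSEQ_unique[OF tendsto_const])
qed

text \<open>In the variable \<open>e\<^sup>-\<^sup>s\<close>, functions vanishing at infinity are uniform limits of polynomials
  without constant term.\<close>

lemma daniell_eq_0:
  assumes \<Lambda>: "daniell \<Lambda>" and exp0: "\<And>z. z > 0 \<Longrightarrow> \<Lambda> (\<lambda>s. exp (- z * s)) = 0" and \<phi>: "\<phi> \<in> Cb"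
  shows "\<Lambda> \<phi> = 0"
proof -
  obtain C where cont: "continuous_on {0..} \<phi>" and C: "\<And>s. s \<ge> 0 \<Longrightarrow> \<bar>\<phi> s\<bar> \<le> C" "C \<ge> 0"
    using CbE[OF \<phi>] by metis
  \<comment> \<open>The damping factor exp(- s/(n+1)) makes the function vanish at infinity, where
    an arbitrary member of \<open>Cb\<close> need not have a limit; it tends to \<open>1\<close>
    boundedly as n grows.\<close>
  have "\<exists>\<Psi>. \<Psi> \<in> Cb \<and> \<Lambda> \<Psi> = 0 \<and> (\<forall>s\<ge>0. \<bar>\<Psi> s - exp (- s / real (Suc n)) * \<phi> s\<bar> \<le> 2 / real (Suc n))" for n
  proof -
    define \<epsilon> where "\<epsilon> = 1 / real (Suc n)"
    have \<epsilon>: "\<epsilon> > 0" by (simp add: \<epsilon>_def)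
    \<comment> \<open>This is the damped function in the variable u = exp(- s): the damping factor
      becomes u powr \<epsilon>, which forces h to be continuous at \<open>0\<close> with value
      \<open>0\<close>. The same \<epsilon> serves as the approximation error.\<close>
    define h where "h u = (if u \<le> 0 then 0 else u powr \<epsilon> * \<phi> (- ln u))" for u :: real
    have hb: "\<bar>h u\<bar> \<le> u powr \<epsilon> * C" if "0 \<le> u" "u \<le> 1" for u
      using that C(1)[of "- ln u"] C(2) by (auto simp: h_def abs_mult intro!: mult_left_mono)
    have "continuous_on {0..1} h"
      unfolding continuous_on_def
    proof
      fix u :: real assume u: "u \<in> {0..1}"
      show "(h \<longlongrightarrow> h u) (at u within {0..1})"
      proof (cases "u = 0")
        case True
        have "((\<lambda>u. u powr \<epsilon> * C) \<longlongrightarrow> 0) (at 0 within {0..1})"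
          using \<epsilon> by (intro tendsto_mult_left_zero tendsto_zero_powrI[OF tendsto_ident_at tendsto_const])
            (auto simp: eventually_at_filter)
        then have "(h \<longlongrightarrow> 0) (at 0 within {0..1})"
          by (rule Lim_null_comparison[rotated]) (auto simp: eventually_at_filter intro!: always_eventually hb)
        then show ?thesis using True by (simp add: h_def)
      next
        case False
        have "continuous_on {0<..1} (\<lambda>u. u powr \<epsilon> * \<phi> (- ln u))"
          by (intro continuous_intros continuous_on_compose2[OF cont]) auto
        then have "((\<lambda>u. u powr \<epsilon> * \<phi> (- ln u)) \<longlongrightarrow> u powr \<epsilon> * \<phi> (- ln u)) (at u within {0<..1})"
          using False u by (auto simp: continuous_on_def)
        then have "(h \<longlongrightarrow> h u) (at u within {0<..1})"
          using False u by (subst tendsto_cong[where g = "\<lambda>u. u powr \<epsilon> * \<phi> (- ln u)"])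
            (auto simp: h_def eventually_at_filter)
        moreover have "at u within {0<..1} = at u within {0..1}"
          using False u by (intro at_within_nhd[of _ "{0<..}"]) auto
        ultimately show ?thesis by simp
      qed
    qed
    then obtain g where g: "real_polynomial_function g" "\<And>u. u \<in> {0..1} \<Longrightarrow> \<bar>h u - g u\<bar> < \<epsilon>"
      using Stone_Weierstrass_real_polynomial_function[of "{0..1::real}" h \<epsilon>] \<epsilon> by auto
    obtain a m where a: "g = (\<lambda>u. \<Sum>i\<le>m. a i * u ^ i)"
      using g(1) real_polynomial_function_iff_sum by blast
    have exp_pow: "exp (- s) ^ i = exp (- real i * s)" for s :: real and i
      by (simp add: exp_of_nat_mult[symmetric])
    define \<Psi> where "\<Psi> s = (\<Sum>i\<in>{1..m}. a i * exp (- real i * s))" for s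
    \<comment> \<open>The constant term \<open>a 0\<close> would correspond to z = 0, which
      \<open>exp0\<close> does not cover. Dropping it costs a second \<epsilon>, because
      \<open>a 0\<close> is g 0 and lies within \<epsilon> of h 0 = 0; hence the bound
      2/(n+1).\<close>
    have g_split: "g u = a 0 + (\<Sum>i\<in>{1..m}. a i * u ^ i)" for u
      unfolding a by (simp add: atMost_atLeast0 sum.atLeast_Suc_atMost)
    have "\<Psi> \<in> Cb" unfolding \<Psi>_def by (intro Cb_sum Cb_cmult Cb_exp) auto
    moreover have "\<Lambda> \<Psi> = 0"
    proof -
      have "\<Lambda> \<Psi> = (\<Sum>i\<in>{1..m}. \<Lambda> (\<lambda>s. a i * exp (- real i * s)))"
        unfolding \<Psi>_def by (intro daniell_sum[OF \<Lambda>] Cb_cmult Cb_exp) auto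
      also have "\<dots> = 0"
      proof (intro sum.neutral ballI)
        fix i assume "i \<in> {1..m}"
        then have i: "real i > 0" by simp
        show "\<Lambda> (\<lambda>s. a i * exp (- real i * s)) = 0"
          using daniell_cmult[OF \<Lambda> Cb_exp[OF i], of "a i"] exp0[OF i] by simp
      qed
      finally show ?thesis .
    qed
    moreover have "\<bar>\<Psi> s - exp (- s / real (Suc n)) * \<phi> s\<bar> \<le> 2 / real (Suc n)" if s: "s \<ge> 0" for s
    proof -
      have "\<Psi> s = g (exp (- s)) - g 0"
        unfolding g_split \<Psi>_def exp_pow by (simp add: power_0_left)
      moreover have "h (exp (- s)) = exp (- s / real (Suc n)) * \<phi> s"
        by (simp add: h_def powr_def \<epsilon>_def)
      moreover have "\<bar>h (exp (- s)) - g (exp (- s))\<bar> < \<epsilon>" "\<bar>h 0 - g 0\<bar> < \<epsilon>"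
        using g(2) s by auto
      moreover have "h 0 = 0" by (simp add: h_def)
      ultimately have "\<bar>\<Psi> s - exp (- s / real (Suc n)) * \<phi> s\<bar> \<le> 2 * \<epsilon>" by linarith
      then show ?thesis by (simp add: \<epsilon>_def)
    qed
    ultimately show ?thesis by blast
  qed
  then obtain \<Psi> where \<Psi>: "\<And>n. \<Psi> n \<in> Cb" "\<And>n. \<Lambda> (\<Psi> n) = 0"
    and close: "\<And>n s. s \<ge> 0 \<Longrightarrow> \<bar>\<Psi> n s - exp (- s / real (Suc n)) * \<phi> s\<bar> \<le> 2 / real (Suc n)"
    by metis
  have "(\<lambda>n. \<Lambda> (\<Psi> n)) \<longlonglongrightarrow> \<Lambda> \<phi>"
  proof (rule daniell_LIMSEQ[OF \<Lambda> \<Psi>(1) \<phi>])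
    fix n s assume s: "(s::real) \<ge> 0"
    have "exp (- s / real (Suc n)) * \<bar>\<phi> s\<bar> \<le> 1 * C"
      by (intro mult_mono) (use s C in \<open>auto simp: divide_nonpos_pos\<close>)
    then have "\<bar>exp (- s / real (Suc n)) * \<phi> s\<bar> \<le> C" by (simp add: abs_mult)
    moreover have "2 / real (Suc n) \<le> 2" by (simp add: field_simps)
    ultimately show "\<bar>\<Psi> n s\<bar> \<le> C + 2" using close[OF s, of n] by linarith
  next
    fix s :: real assume s: "s \<ge> 0"
    have inv0: "(\<lambda>n. 1 / real (Suc n)) \<longlonglongrightarrow> 0"
      using LIMSEQ_inverse_real_of_nat by (simp add: inverse_eq_divide)
    have "(\<lambda>n. \<Psi> n s - exp (- s / real (Suc n)) * \<phi> s) \<longlonglongrightarrow> 0"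
    proof (rule Lim_null_comparison)
      show "\<forall>\<^sub>F n in sequentially. norm (\<Psi> n s - exp (- s / real (Suc n)) * \<phi> s) \<le> 2 * (1 / real (Suc n))"
        using close[OF s] by (intro always_eventually allI) (simp del: of_nat_Suc)
      show "(\<lambda>n. 2 * (1 / real (Suc n))) \<longlonglongrightarrow> 0" by (rule tendsto_mult_right_zero[OF inv0])
    qed
    moreover have "(\<lambda>n. exp (- s * (1 / real (Suc n))) * \<phi> s) \<longlonglongrightarrow> exp (- s * 0) * \<phi> s"
      by (intro tendsto_intros inv0)
    ultimately have "(\<lambda>n. (\<Psi> n s - exp (- s / real (Suc n)) * \<phi> s) + exp (- s * (1 / real (Suc n))) * \<phi> s)
        \<longlonglongrightarrow> 0 + exp (- s * 0) * \<phi> s"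
      by (rule tendsto_add)
    then show "(\<lambda>n. \<Psi> n s) \<longlonglongrightarrow> \<phi> s" by simp
  qed
  then have "(\<lambda>n. 0) \<longlonglongrightarrow> \<Lambda> \<phi>" by (simp only: \<Psi>(2))
  then show ?thesis using LIMSEQ_unique[OF tendsto_const] by metis
qed

text \<open>The inner integral of a convolution must again be a test function before the outer
  functional can be applied to it. Its continuity is the convergence clause of
  \<open>daniell\<close> for translates of \<phi>.\<close>

lemma Cb_daniell_shift:
  assumes \<Lambda>: "daniell \<Lambda>" and \<phi>: "\<phi> \<in> Cb"
  shows "(\<lambda>s. \<Lambda> (\<lambda>r. \<phi> (s + r))) \<in> Cb"
proof -
  obtain C where cont: "continuous_on {0..} \<phi>" and C: "\<And>s. s \<ge> 0 \<Longrightarrow> \<bar>\<phi> s\<bar> \<le> C"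
    using CbE[OF \<phi>] by metis
  obtain K where K: "\<And>\<phi> C. \<phi> \<in> Cb \<Longrightarrow> (\<And>s. s \<ge> 0 \<Longrightarrow> \<bar>\<phi> s\<bar> \<le> C) \<Longrightarrow> \<bar>\<Lambda> \<phi>\<bar> \<le> K * C"
    using daniell_bound[OF \<Lambda>] by blast
  show ?thesis
  proof (rule CbI)
    show "\<bar>\<Lambda> (\<lambda>r. \<phi> (s + r))\<bar> \<le> K * C" if "s \<ge> 0" for s
      using that by (intro K Cb_shift \<phi> C) auto
    show "continuous_on {0..} (\<lambda>s. \<Lambda> (\<lambda>r. \<phi> (s + r)))"
      unfolding continuous_on_sequentially o_def
    proof (intro ballI allI impI, elim conjE)
      fix s :: real and x :: "nat \<Rightarrow> real" assume s: "s \<in> {0..}" and x: "\<forall>n. x n \<in> {0..}" "x \<longlonglongrightarrow> s"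
      show "(\<lambda>n. \<Lambda> (\<lambda>r. \<phi> (x n + r))) \<longlonglongrightarrow> \<Lambda> (\<lambda>r. \<phi> (s + r))"
      proof (rule daniell_LIMSEQ[OF \<Lambda>])
        fix r :: real assume r: "r \<ge> 0"
        have "(\<lambda>n. x n + r) \<longlonglongrightarrow> s + r" by (intro tendsto_intros x)
        then show "(\<lambda>n. \<phi> (x n + r)) \<longlonglongrightarrow> \<phi> (s + r)"
          using cont s x r unfolding continuous_on_sequentially o_def
          by (metis add_nonneg_nonneg atLeast_iff)
      qed (use s x in \<open>auto intro: Cb_shift \<phi> C\<close>)
    qed
  qed
qed

lemma daniell_compose:
  assumes \<Lambda>: "daniell \<Lambda>" and \<Lambda>': "daniell \<Lambda>'"
  shows "daniell (\<lambda>\<phi>. \<Lambda> (\<lambda>s. \<Lambda>' (\<lambda>r. \<phi> (s + r))))"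
proof -
  obtain K where K: "\<And>\<phi> C. \<phi> \<in> Cb \<Longrightarrow> (\<And>s. s \<ge> 0 \<Longrightarrow> \<bar>\<phi> s\<bar> \<le> C) \<Longrightarrow> \<bar>\<Lambda> \<phi>\<bar> \<le> K * C" and K0: "K \<ge> 0"
    using daniell_bound[OF \<Lambda>] by blast
  obtain K' where K': "\<And>\<phi> C. \<phi> \<in> Cb \<Longrightarrow> (\<And>s. s \<ge> 0 \<Longrightarrow> \<bar>\<phi> s\<bar> \<le> C) \<Longrightarrow> \<bar>\<Lambda>' \<phi>\<bar> \<le> K' * C" and K0': "K' \<ge> 0"
    using daniell_bound[OF \<Lambda>'] by blast
  note sh = Cb_daniell_shift[OF \<Lambda>']
  have b: "\<bar>\<Lambda>' (\<lambda>r. \<phi> (s + r))\<bar> \<le> K' * C" if "\<phi> \<in> Cb" "\<And>s. s \<ge> 0 \<Longrightarrow> \<bar>\<phi> s\<bar> \<le> C" "s \<ge> 0" for \<phi> C s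
    using that by (intro K' Cb_shift) auto
  show ?thesis
    unfolding daniell_def
  proof (intro conjI ballI allI impI exI[of _ "K * K'"])
    fix \<phi> \<psi> assume \<phi>: "\<phi> \<in> Cb" and \<psi>: "\<psi> \<in> Cb"
    have "\<Lambda> (\<lambda>s. \<Lambda>' (\<lambda>r. \<phi> (s + r) + \<psi> (s + r))) = \<Lambda> (\<lambda>s. \<Lambda>' (\<lambda>r. \<phi> (s + r)) + \<Lambda>' (\<lambda>r. \<psi> (s + r)))"
      using sh[OF Cb_add[OF \<phi> \<psi>]] Cb_add[OF sh[OF \<phi>] sh[OF \<psi>]]
      by (rule daniell_cong[OF \<Lambda>]) (intro daniell_add[OF \<Lambda>'] Cb_shift \<phi> \<psi>)
    then show "\<Lambda> (\<lambda>s. \<Lambda>' (\<lambda>r. \<phi> (s + r) + \<psi> (s + r))) = \<Lambda> (\<lambda>s. \<Lambda>' (\<lambda>r. \<phi> (s + r))) + \<Lambda> (\<lambda>s. \<Lambda>' (\<lambda>r. \<psi> (s + r)))"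
      by (simp add: daniell_add[OF \<Lambda> sh[OF \<phi>] sh[OF \<psi>]])
  next
    fix c \<phi> assume \<phi>: "\<phi> \<in> Cb"
    have "\<Lambda> (\<lambda>s. \<Lambda>' (\<lambda>r. c * \<phi> (s + r))) = \<Lambda> (\<lambda>s. c * \<Lambda>' (\<lambda>r. \<phi> (s + r)))"
      using sh[OF Cb_cmult[OF \<phi>]] Cb_cmult[OF sh[OF \<phi>]]
      by (rule daniell_cong[OF \<Lambda>]) (intro daniell_cmult[OF \<Lambda>'] Cb_shift \<phi>)
    then show "\<Lambda> (\<lambda>s. \<Lambda>' (\<lambda>r. c * \<phi> (s + r))) = c * \<Lambda> (\<lambda>s. \<Lambda>' (\<lambda>r. \<phi> (s + r)))"
      by (simp add: daniell_cmult[OF \<Lambda> sh[OF \<phi>]])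
  next
    fix \<phi> C assume *: "\<phi> \<in> Cb" "\<forall>s\<ge>0. \<bar>\<phi> s\<bar> \<le> C"
    then have "\<bar>\<Lambda> (\<lambda>s. \<Lambda>' (\<lambda>r. \<phi> (s + r)))\<bar> \<le> K * (K' * C)"
      by (intro K sh b) auto
    then show "\<bar>\<Lambda> (\<lambda>s. \<Lambda>' (\<lambda>r. \<phi> (s + r)))\<bar> \<le> K * K' * C" by (simp add: mult.assoc)
  next
    fix \<Phi> \<phi> C
    assume *: "\<forall>n::nat. \<Phi> n \<in> Cb" "\<phi> \<in> Cb" "\<forall>n. \<forall>s\<ge>0. \<bar>\<Phi> n s\<bar> \<le> C" "\<forall>s\<ge>0. (\<lambda>n. \<Phi> n s) \<longlonglongrightarrow> \<phi> s"
    show "(\<lambda>n. \<Lambda> (\<lambda>s. \<Lambda>' (\<lambda>r. \<Phi> n (s + r)))) \<longlonglongrightarrow> \<Lambda> (\<lambda>s. \<Lambda>' (\<lambda>r. \<phi> (s + r)))"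
    proof (rule daniell_LIMSEQ[OF \<Lambda>])
      show "(\<lambda>n. \<Lambda>' (\<lambda>r. \<Phi> n (s + r))) \<longlonglongrightarrow> \<Lambda>' (\<lambda>r. \<phi> (s + r))" if "s \<ge> 0" for s
        using * that by (intro daniell_LIMSEQ[OF \<Lambda>', where C = C] Cb_shift) auto
      show "\<bar>\<Lambda>' (\<lambda>r. \<Phi> n (s + r))\<bar> \<le> K' * C" if "s \<ge> 0" for n s
        using * that by (intro b) auto
    qed (use * in \<open>auto intro: sh\<close>)
  qed (use K0 K0' in simp)
qed

lemma daniell_lincomb:
  assumes \<Lambda>: "daniell \<Lambda>" and \<Lambda>': "daniell \<Lambda>'"
  shows "daniell (\<lambda>\<phi>. a * \<Lambda> \<phi> + b * \<Lambda>' \<phi>)"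
proof -
  obtain K where K: "\<And>\<phi> C. \<phi> \<in> Cb \<Longrightarrow> (\<And>s. s \<ge> 0 \<Longrightarrow> \<bar>\<phi> s\<bar> \<le> C) \<Longrightarrow> \<bar>\<Lambda> \<phi>\<bar> \<le> K * C" and K0: "K \<ge> 0"
    using daniell_bound[OF \<Lambda>] by blast
  obtain K' where K': "\<And>\<phi> C. \<phi> \<in> Cb \<Longrightarrow> (\<And>s. s \<ge> 0 \<Longrightarrow> \<bar>\<phi> s\<bar> \<le> C) \<Longrightarrow> \<bar>\<Lambda>' \<phi>\<bar> \<le> K' * C" and K0': "K' \<ge> 0"
    using daniell_bound[OF \<Lambda>'] by blast
  show ?thesis
    unfolding daniell_def
  proof (intro conjI ballI allI impI exI[of _ "\<bar>a\<bar> * K + \<bar>b\<bar> * K'"])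
    fix \<phi> C assume *: "\<phi> \<in> Cb" "\<forall>s\<ge>0. \<bar>\<phi> s\<bar> \<le> C"
    have "\<bar>a * \<Lambda> \<phi> + b * \<Lambda>' \<phi>\<bar> \<le> \<bar>a\<bar> * \<bar>\<Lambda> \<phi>\<bar> + \<bar>b\<bar> * \<bar>\<Lambda>' \<phi>\<bar>"
      by (metis abs_mult abs_triangle_ineq)
    also have "\<dots> \<le> \<bar>a\<bar> * (K * C) + \<bar>b\<bar> * (K' * C)"
      using * by (intro add_mono mult_left_mono K K') auto
    finally show "\<bar>a * \<Lambda> \<phi> + b * \<Lambda>' \<phi>\<bar> \<le> (\<bar>a\<bar> * K + \<bar>b\<bar> * K') * C" by (simp add: algebra_simps)
  next
    fix \<Phi> \<phi> C
    assume *: "\<forall>n::nat. \<Phi> n \<in> Cb" "\<phi> \<in> Cb" "\<forall>n. \<forall>s\<ge>0. \<bar>\<Phi> n s\<bar> \<le> C" "\<forall>s\<ge>0. (\<lambda>n. \<Phi> n s) \<longlonglongrightarrow> \<phi> s"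
    then show "(\<lambda>n. a * \<Lambda> (\<Phi> n) + b * \<Lambda>' (\<Phi> n)) \<longlonglongrightarrow> a * \<Lambda> \<phi> + b * \<Lambda>' \<phi>"
      by (intro tendsto_intros daniell_LIMSEQ[OF \<Lambda>] daniell_LIMSEQ[OF \<Lambda>']) auto
  qed (use K0 K0' in \<open>auto simp: daniell_add[OF \<Lambda>] daniell_add[OF \<Lambda>'] daniell_cmult[OF \<Lambda>] daniell_cmult[OF \<Lambda>'] algebra_simps\<close>)
qed

lemma daniell_at: "s \<ge> 0 \<Longrightarrow> daniell (\<lambda>\<phi>. \<phi> s)"
  unfolding daniell_def by (auto intro: exI[of _ 1])

lemma daniell_integral:
  assumes M: "sets M = sets (restrict_space borel {0..})" and w: "integrable M w"
  shows "daniell (\<lambda>\<phi>. \<integral>s. w s * \<phi> s \<partial>M)"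
proof -
  have sp: "space M = {0..}" using sets_eq_imp_space_eq[OF M] by (simp add: space_restrict_space)
  have wm[measurable]: "w \<in> borel_measurable M" using w by auto
  have meas[measurable]: "\<phi> \<in> borel_measurable M" if "\<phi> \<in> Cb" for \<phi>
    unfolding measurable_cong_sets[OF M refl]
    using that by (intro borel_measurable_continuous_on_restrict) (auto simp: Cb_def)
  have bnd: "\<bar>w s * \<phi> s\<bar> \<le> \<bar>C * w s\<bar>" if "\<And>s. s \<ge> 0 \<Longrightarrow> \<bar>\<phi> s\<bar> \<le> C" "s \<in> space M" for \<phi> :: "real \<Rightarrow> real" and C s
    using mult_right_mono[of "\<bar>\<phi> s\<bar>" "\<bar>C\<bar>" "\<bar>w s\<bar>"] that by (force simp: sp abs_mult mult.commute)
  have int: "integrable M (\<lambda>s. w s * \<phi> s)" if \<phi>: "\<phi> \<in> Cb" for \<phi>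
  proof -
    obtain C where C: "\<And>s. s \<ge> 0 \<Longrightarrow> \<bar>\<phi> s\<bar> \<le> C" using CbE[OF \<phi>] by metis
    show ?thesis
      by (rule Bochner_Integration.integrable_bound[OF integrable_mult_right[OF w, of C]])
         (use \<phi> bnd[where \<phi> = \<phi>, OF C] in auto)
  qed
  show ?thesis
    unfolding daniell_def
  proof (intro conjI ballI allI impI exI[of _ "\<integral>s. \<bar>w s\<bar> \<partial>M"])
    fix \<phi> C assume *: "\<phi> \<in> Cb" "\<forall>s\<ge>0. \<bar>\<phi> s\<bar> \<le> C"
    then have C: "C \<ge> 0" using abs_ge_zero[of "\<phi> 0"] by (meson order.trans order_refl)
    have "\<bar>\<integral>s. w s * \<phi> s \<partial>M\<bar> \<le> (\<integral>s. \<bar>w s * \<phi> s\<bar> \<partial>M)" by (rule integral_abs_bound)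
    also have "\<dots> \<le> (\<integral>s. \<bar>C * w s\<bar> \<partial>M)"
      using integrable_mult_right[OF w, of C] int[OF *(1)] bnd[of \<phi> C] * by (intro integral_mono integrable_abs) auto
    also have "\<dots> = C * (\<integral>s. \<bar>w s\<bar> \<partial>M)" using C by (simp add: abs_mult)
    finally show "\<bar>\<integral>s. w s * \<phi> s \<partial>M\<bar> \<le> (\<integral>s. \<bar>w s\<bar> \<partial>M) * C" by (simp add: mult.commute)
  next
    fix \<Phi> \<phi> C
    assume *: "\<forall>n::nat. \<Phi> n \<in> Cb" "\<phi> \<in> Cb" "\<forall>n. \<forall>s\<ge>0. \<bar>\<Phi> n s\<bar> \<le> C" "\<forall>s\<ge>0. (\<lambda>n. \<Phi> n s) \<longlonglongrightarrow> \<phi> s"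
    show "(\<lambda>n. \<integral>s. w s * \<Phi> n s \<partial>M) \<longlonglongrightarrow> (\<integral>s. w s * \<phi> s \<partial>M)"
    proof (rule integral_dominated_convergence[where w = "\<lambda>s. \<bar>C * w s\<bar>"])
      show "AE s in M. norm (w s * \<Phi> n s) \<le> \<bar>C * w s\<bar>" for n
        using bnd[of "\<Phi> n" C] * by auto
      show "AE s in M. (\<lambda>n. w s * \<Phi> n s) \<longlonglongrightarrow> w s * \<phi> s"
        using * by (auto simp: sp intro!: tendsto_intros)
    qed (use * w in auto)
  next
    fix \<phi> \<psi> assume "\<phi> \<in> Cb" "\<psi> \<in> Cb"
    then show "(\<integral>s. w s * (\<phi> s + \<psi> s) \<partial>M) = (\<integral>s. w s * \<phi> s \<partial>M) + (\<integral>s. w s * \<psi> s \<partial>M)"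
      using int by (simp add: distrib_left)
  qed (simp_all add: mult.left_commute)
qed

subsection \<open>Kernels on the half-line\<close>

abbreviation lborel0 :: "real measure" where
  "lborel0 \<equiv> restrict_space lborel {0..}"

lemma sets_lborel0: "sets lborel0 = sets (restrict_space borel {0..})"
  by (rule sets_restrict_space_cong) simp

lemma space_lborel0: "space lborel0 = {0..}"
  by (simp add: space_restrict_space)

lemma has_bochner_integral_Gamma:
  fixes a c :: real
  assumes a: "a > 0" and c: "c > 0"
  shows "has_bochner_integral lborel0 (\<lambda>s. s powr (a - 1) * exp (- c * s)) (Gamma a / c powr a)"
proof (rule has_bochner_integral_nn_integral)
  have [measurable]: "(\<lambda>s. s powr (a - 1) * exp (- c * s)) \<in> borel_measurable borel" by measurable
  show "(\<lambda>s. s powr (a - 1) * exp (- c * s)) \<in> borel_measurable lborel0"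
    by (rule measurable_restrict_space1) simp
  show "AE s in lborel0. 0 \<le> s powr (a - 1) * exp (- c * s)" by simp
  show "0 \<le> Gamma a / c powr a" using Gamma_real_pos[OF a] by simp
  \<comment> \<open>Euler's integral after the substitution of c s for s.\<close>
  have "ennreal (Gamma a) = \<bar>c\<bar> * (\<integral>\<^sup>+s. ennreal (indicator {0..} (0 + c * s) * (0 + c * s) powr (a - 1) / exp (0 + c * s)) \<partial>lborel)"
    using c by (subst Gamma_conv_nn_integral_real[OF a], subst nn_integral_real_affine[of _ c 0]) auto
  also have "\<dots> = c * (\<integral>\<^sup>+s. ennreal (c powr (a - 1)) * (ennreal (s powr (a - 1) * exp (- c * s)) * indicator {0..} s) \<partial>lborel)"
    using c by (intro arg_cong2[where f = "(*)"] nn_integral_cong)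
      (auto simp: ennreal_mult'[symmetric] powr_mult exp_minus field_simps zero_le_mult_iff split: split_indicator)
  also have "\<dots> = c * (ennreal (c powr (a - 1)) * (\<integral>\<^sup>+s. ennreal (s powr (a - 1) * exp (- c * s)) * indicator {0..} s \<partial>lborel))"
    by (subst nn_integral_cmult) auto
  also have "\<dots> = ennreal (c * c powr (a - 1)) * (\<integral>\<^sup>+s. ennreal (s powr (a - 1) * exp (- c * s)) \<partial>lborel0)"
    using c by (simp add: nn_integral_restrict_space mult.assoc[symmetric] ennreal_mult'[symmetric])
  also have "c * c powr (a - 1) = c powr a" using c by (simp add: powr_mult_base)
  finally have "ennreal (1 / c powr a) * ennreal (Gamma a) = 
      ennreal (1 / c powr a) * ennreal (c powr a) * (\<integral>\<^sup>+s. ennreal (s powr (a - 1) * exp (- c * s)) \<partial>lborel0)"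
    by (simp add: mult.assoc)
  moreover have "ennreal (1 / c powr a) * ennreal (c powr a) = 1"
    using c by (simp add: ennreal_mult'[symmetric])
  moreover have "ennreal (1 / c powr a) * ennreal (Gamma a) = ennreal (Gamma a / c powr a)"
    by (simp add: ennreal_mult'[symmetric])
  ultimately show "(\<integral>\<^sup>+s. ennreal (s powr (a - 1) * exp (- c * s)) \<partial>lborel0) = ennreal (Gamma a / c powr a)"
    by simp
qed

lemma has_bochner_integral_power_exp:
  fixes c :: real
  assumes c: "c > 0"
  shows "has_bochner_integral lborel0 (\<lambda>s. s ^ i * exp (- c * s)) (fact i / c ^ Suc i)"
proof -
  have "has_bochner_integral lborel0 (\<lambda>s. s powr (real (Suc i) - 1) * exp (- c * s)) (Gamma (real (Suc i)) / c powr real (Suc i))"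
    using c by (intro has_bochner_integral_Gamma) auto
  also have "Gamma (real (Suc i)) / c powr real (Suc i) = fact i / c ^ Suc i"
    using Gamma_fact[of i, where ?'a = real] c
    by (simp add: powr_realpow[symmetric] add.commute del: power_Suc)
  finally show ?thesis
  proof (rule has_bochner_integral_cong_AE[THEN iffD1, rotated 3])
    \<comment> \<open>At s = 0 the two integrands differ when i = 0: 0 powr 0 is 0, whereas 0 ^ 0 is
      1. So equality holds only almost everywhere.\<close>
    show "AE s in lborel0. s powr (real (Suc i) - 1) * exp (- c * s) = s ^ i * exp (- c * s)"
    proof -
      have "AE s in lborel. s \<noteq> (0::real)" by (rule AE_lborel_singleton)
      then have "AE s in lborel0. s > 0" by (subst AE_restrict_space_iff) auto
      then show ?thesis by eventually_elim (simp add: powr_realpow)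
    qed
  qed (auto intro!: measurable_restrict_space1)
qed

section \<open>Absolute convergence of the binomial series at the boundary\<close>

lemma signed_gbinomial_Suc:
  fixes a :: real
  shows "(- 1) ^ Suc k * (a gchoose Suc k) = (- 1) ^ k * (a gchoose k) * ((real k - a) / real (Suc k))"
proof -
  have "(a gchoose Suc k) * real (Suc k) = (a - real k) * (a gchoose k)"
    using gbinomial_absorb_comp[of a k] gbinomial_absorption[of k a] by (simp only: mult.commute)
  then have "a gchoose Suc k = (a - real k) * (a gchoose k) / real (Suc k)"
    by (subst eq_divide_eq) simp
  then show ?thesis by (simp only: power_Suc) (simp add: field_simps del: of_nat_Suc)
qed

text \<open>Consecutive terms have ratio of modulus \<bar>m - (a - 1)\<bar> / (m + 1), at most 1
  since a - 1 lies in \<open>[-1,1]\<close>. Up to sign these numbers are the partial sums of the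
  coefficients of (1 - w)^a at w = 1.\<close>

lemma abs_gbinomial_le_1:
  fixes a :: real
  assumes "0 \<le> a" "a \<le> 2"
  shows "\<bar>a - 1 gchoose m\<bar> \<le> 1"
proof (induction m)
  case (Suc m)
  have "\<bar>a - 1 gchoose Suc m\<bar> = \<bar>(- 1) ^ Suc m * (a - 1 gchoose Suc m)\<bar>" by (simp add: abs_mult)
  also have "\<dots> = \<bar>a - 1 gchoose m\<bar> * (\<bar>real m - (a - 1)\<bar> / real (Suc m))"
    unfolding signed_gbinomial_Suc by (simp add: abs_mult)
  also have "\<dots> \<le> 1 * 1" using assms Suc by (intro mult_mono) (auto simp: field_simps)
  finally show ?case by simp
qed simp

text \<open>By \<open>signed_gbinomial_Suc\<close> the coefficient of (1 - w)^a is multiplied by (k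
  - a)/(k + 1) in each step, a nonnegative factor for k \<ge> j \<ge> a: from index j on the signs
  no longer change.\<close>

lemma signed_gbinomial_sign:
  fixes a :: real
  assumes "a \<le> real j"
  shows "sgn ((- 1) ^ j * (a gchoose j)) * ((- 1) ^ (j + k) * (a gchoose (j + k))) = \<bar>a gchoose (j + k)\<bar>"
proof (induction k)
  case 0
  have "sgn ((- 1) ^ j * (a gchoose j)) * ((- 1) ^ j * (a gchoose j)) = \<bar>(- 1) ^ j * (a gchoose j)\<bar>"
    by (metis abs_sgn mult.commute)
  then show ?case by (simp add: abs_mult)
next
  case (Suc k)
  have "\<bar>a gchoose (j + Suc k)\<bar> = \<bar>(- 1) ^ Suc (j + k) * (a gchoose Suc (j + k))\<bar>" by (simp add: abs_mult)
  also have "\<dots> = \<bar>a gchoose (j + k)\<bar> * ((real (j + k) - a) / real (Suc (j + k)))"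
    unfolding signed_gbinomial_Suc using assms by (simp add: abs_mult)
  finally show ?case using Suc signed_gbinomial_Suc[of "j + k" a] by (simp add: mult.assoc)
qed

text \<open>As a \<le> 2, the coefficients keep one sign from index 2 on, so absolute tail sums are,
  up to sign, partial sums minus the first two terms. These are bounded by 1, 1 and 2, whence the
  constant 4.\<close>

lemma summable_abs_gbinomial:
  fixes a :: real
  assumes a: "0 \<le> a" "a \<le> 2"
  shows "summable (\<lambda>k. \<bar>a gchoose k\<bar>)"
proof -
  define c where "c k = (- 1) ^ k * (a gchoose k)" for k :: nat
  have partial: "\<bar>\<Sum>k\<le>m. c k\<bar> \<le> 1" for m
    using gbinomial_sum_lower_neg[of a m] abs_gbinomial_le_1[OF a, of m]
    by (simp add: c_def mult.commute abs_mult)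
  have "(\<Sum>k<n. \<bar>a gchoose (k + 2)\<bar>) \<le> 4" for n
  proof -
    have "(\<Sum>k<n. \<bar>a gchoose (k + 2)\<bar>) = sgn (c 2) * (\<Sum>k<n. c (2 + k))"
      using a signed_gbinomial_sign[of a 2] by (simp add: sum_distrib_left c_def add.commute)
    also have "(\<Sum>k<n. c (2 + k)) = (\<Sum>k\<le>Suc n. c k) - c 0 - c 1"
      by (simp add: lessThan_Suc_atMost[symmetric] sum.lessThan_Suc_shift del: sum.lessThan_Suc)
    also have "sgn (c 2) * \<dots> \<le> \<bar>sgn (c 2)\<bar> * \<bar>(\<Sum>k\<le>Suc n. c k) - c 0 - c 1\<bar>"
      by (metis abs_ge_self abs_mult)
    also have "\<dots> \<le> 1 * 4"
    proof (intro mult_mono)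
      show "\<bar>(\<Sum>k\<le>Suc n. c k) - c 0 - c 1\<bar> \<le> 4"
        using partial[of "Suc n"] a by (simp add: c_def)
    qed (auto simp: abs_sgn_eq)
    finally show ?thesis by simp
  qed
  then have "summable (\<lambda>k. \<bar>a gchoose (k + 2)\<bar>)"
    by (intro summableI_nonneg_bounded) auto
  then show ?thesis using summable_iff_shift[of "\<lambda>k. \<bar>a gchoose k\<bar>" 2] by simp
qed

text \<open>For a \<le> 1 all coefficients after the first are nonpositive, so the sum of their
  moduli is 1 minus a partial sum, and the partial sums are nonnegative. Together with the leading
  coefficient 1 this is the total mass 2 used in the interpolation.\<close>

lemma suminf_abs_gbinomial_le_1:
  fixes a :: real
  assumes a: "0 \<le> a" "a \<le> 1"
  shows "(\<Sum>k. \<bar>a gchoose Suc k\<bar>) \<le> 1"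
proof (rule suminf_le_const)
  show "summable (\<lambda>k. \<bar>a gchoose Suc k\<bar>)"
    using summable_abs_gbinomial[of a] a by (subst summable_Suc_iff) auto
  fix n
  have "\<bar>a gchoose Suc k\<bar> = - ((- 1) ^ Suc k * (a gchoose Suc k))" for k
  proof (cases "a = 0")
    case False
    then have "sgn ((- 1) ^ 1 * (a gchoose 1)) = -1" using a by simp
    then show ?thesis using signed_gbinomial_sign[of a 1 k] a by simp
  qed simp
  then have "(\<Sum>k<n. \<bar>a gchoose Suc k\<bar>) = 1 - (\<Sum>k\<le>n. (a gchoose k) * (- 1) ^ k)"
    by (simp add: lessThan_Suc_atMost[symmetric] sum.lessThan_Suc_shift sum_negf mult.commute del: sum.lessThan_Suc)
  also have "\<dots> = 1 - (- 1) ^ n * (a - 1 gchoose n)" by (simp only: gbinomial_sum_lower_neg)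
  also have "\<dots> \<le> 1"
    using signed_gbinomial_sign[of "a - 1" 0 n] a by (simp add: sgn_if)
  finally show "(\<Sum>k<n. \<bar>a gchoose Suc k\<bar>) \<le> 1" .
qed

text \<open>With \<open>w = \<epsilon> / (z + \<epsilon>)\<close> one has \<open>(z / (z + \<epsilon>))\<^sup>\<alpha> = (1 - w)\<^sup>\<alpha>\<close>, and the powers of \<open>w\<close> are the
  Laplace transforms of Gamma densities.\<close>

lemma binomial_kernel:
  fixes a \<epsilon> :: real
  assumes a: "0 \<le> a" "a \<le> 2" and \<epsilon>: "\<epsilon> > 0"
  obtains \<kappa> where "integrable lborel0 \<kappa>"
    "(\<integral>s. \<bar>\<kappa> s\<bar> \<partial>lborel0) \<le> (\<Sum>k. \<bar>a gchoose Suc k\<bar>)"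
    "\<And>z. z > 0 \<Longrightarrow> (\<integral>s. \<kappa> s * exp (- z * s) \<partial>lborel0) = (z / (z + \<epsilon>)) powr a - 1"
proof -
  define c where "c k = (- 1) ^ k * (a gchoose k)" for k :: nat
  have abs_c: "\<bar>c k\<bar> = \<bar>a gchoose k\<bar>" for k by (simp add: c_def abs_mult)
  have sumc: "summable (\<lambda>k. \<bar>c (Suc k)\<bar>)"
    using summable_abs_gbinomial[OF a] unfolding abs_c by (subst summable_Suc_iff)
  \<comment> \<open>Up to the coefficient this is the Gamma density with transform (\<epsilon>/(z +
    \<epsilon>))^(i+1). The index starts at power 1: power 0 is an atom at the origin and has no
    density, which accounts for the \<open>- 1\<close> in the conclusion.\<close>
  define f where "f i s = c (Suc i) * (\<epsilon> ^ Suc i / fact i) * (s ^ i * exp (- \<epsilon> * s))" for i s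
  define \<kappa> where "\<kappa> s = (\<Sum>i. f i s)" for s
  have f_exp: "f i s * exp (- z * s) = c (Suc i) * (\<epsilon> ^ Suc i / fact i) * (s ^ i * exp (- (\<epsilon> + z) * s))" for i s z
    by (simp add: f_def exp_add[symmetric] algebra_simps)
  have int_exp: "has_bochner_integral lborel0 (\<lambda>s. f i s * exp (- z * s)) (c (Suc i) * (\<epsilon> / (z + \<epsilon>)) ^ Suc i)" if "z \<ge> 0" for i z
  proof -
    have "has_bochner_integral lborel0 (\<lambda>s. f i s * exp (- z * s)) (c (Suc i) * (\<epsilon> ^ Suc i / fact i) * (fact i / (\<epsilon> + z) ^ Suc i))"
      unfolding f_exp using that \<epsilon> by (intro has_bochner_integral_mult_right has_bochner_integral_power_exp) auto
    then show ?thesis by (simp add: power_divide add.commute del: power_Suc)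
  qed
  have int_abs: "has_bochner_integral lborel0 (\<lambda>s. \<bar>f i s\<bar>) \<bar>c (Suc i)\<bar>" for i
  proof -
    have "has_bochner_integral lborel0 (\<lambda>s. \<bar>c (Suc i)\<bar> * (\<epsilon> ^ Suc i / fact i) * (s ^ i * exp (- \<epsilon> * s)))
       (\<bar>c (Suc i)\<bar> * (\<epsilon> ^ Suc i / fact i) * (fact i / \<epsilon> ^ Suc i))"
      using \<epsilon> by (intro has_bochner_integral_mult_right has_bochner_integral_power_exp) auto
    moreover have "\<bar>c (Suc i)\<bar> * (\<epsilon> ^ Suc i / fact i) * (fact i / \<epsilon> ^ Suc i) = \<bar>c (Suc i)\<bar>" using \<epsilon> by simp
    moreover have "\<bar>f i s\<bar> = \<bar>c (Suc i)\<bar> * (\<epsilon> ^ Suc i / fact i) * (s ^ i * exp (- \<epsilon> * s))" if "s \<in> space lborel0" for s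
      using that \<epsilon> by (simp add: f_def abs_mult space_lborel0)
    ultimately show ?thesis by (subst has_bochner_integral_cong[OF refl _ refl]) auto
  qed
  have f_int: "integrable lborel0 (f i)" for i using int_exp[of 0 i] by (auto simp: has_bochner_integral_iff)
  obtain C where C: "\<And>k. \<bar>c (Suc k)\<bar> \<le> C"
    using summable_imp_Bseq[OF sumc] by (auto simp: Bseq_def)
  have summ: "summable (\<lambda>i. \<bar>f i s\<bar>)" if s: "s \<ge> 0" for s
  proof (rule summable_comparison_test')
    show "summable (\<lambda>i. C * \<epsilon> * (inverse (fact i) * (\<epsilon> * s) ^ i))"
      by (intro summable_mult summable_exp)
    fix i
    have "\<bar>f i s\<bar> = \<bar>c (Suc i)\<bar> * (\<epsilon> * (inverse (fact i) * (\<epsilon> * s) ^ i)) * exp (- \<epsilon> * s)"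
      using s \<epsilon> by (simp add: f_def abs_mult power_mult_distrib field_simps)
    also have "\<dots> \<le> C * (\<epsilon> * (inverse (fact i) * (\<epsilon> * s) ^ i)) * 1"
      using s \<epsilon> C[of i] by (intro mult_mono) auto
    finally show "norm \<bar>f i s\<bar> \<le> C * \<epsilon> * (inverse (fact i) * (\<epsilon> * s) ^ i)" by simp
  qed
  have AE_summ: "AE s in lborel0. summable (\<lambda>i. norm (f i s))"
    by (rule AE_I2) (auto simp: space_lborel0 summ)
  have sums_norm: "summable (\<lambda>i. \<integral>s. norm (f i s) \<partial>lborel0)"
    using sumc int_abs by (simp add: has_bochner_integral_iff)
  have \<kappa>_int: "integrable lborel0 \<kappa>"
    unfolding \<kappa>_def by (rule integrable_suminf[OF f_int AE_summ sums_norm])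
  show ?thesis
  proof (rule that[OF \<kappa>_int])
    have "(\<integral>s. \<bar>\<kappa> s\<bar> \<partial>lborel0) \<le> (\<integral>s. (\<Sum>i. \<bar>f i s\<bar>) \<partial>lborel0)"
    proof (rule integral_mono)
      show "integrable lborel0 (\<lambda>s. \<Sum>i. \<bar>f i s\<bar>)"
        by (rule integrable_suminf) (use f_int AE_summ sums_norm in auto)
      show "\<bar>\<kappa> s\<bar> \<le> (\<Sum>i. \<bar>f i s\<bar>)" if "s \<in> space lborel0" for s
        unfolding \<kappa>_def using that by (intro summable_rabs summ) (simp add: space_lborel0)
    qed (use \<kappa>_int in auto)
    also have "\<dots> = (\<Sum>i. \<integral>s. \<bar>f i s\<bar> \<partial>lborel0)"
      by (rule integral_suminf) (use f_int AE_summ sums_norm in auto)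
    also have "\<dots> = (\<Sum>k. \<bar>a gchoose Suc k\<bar>)"
      using int_abs by (simp add: has_bochner_integral_iff abs_c)
    finally show "(\<integral>s. \<bar>\<kappa> s\<bar> \<partial>lborel0) \<le> (\<Sum>k. \<bar>a gchoose Suc k\<bar>)" .
  next
    fix z :: real assume z: "z > 0"
    define w where "w = \<epsilon> / (z + \<epsilon>)"
    have w: "0 < w" "w < 1" "1 - w = z / (z + \<epsilon>)" using z \<epsilon> by (auto simp: w_def field_simps)
    have le: "\<bar>f i s * exp (- z * s)\<bar> \<le> \<bar>f i s\<bar>" if "s \<in> space lborel0" for i s
      using that z by (simp add: abs_mult space_lborel0 mult_left_le)
    have "(\<integral>s. \<kappa> s * exp (- z * s) \<partial>lborel0) = (\<integral>s. (\<Sum>i. f i s * exp (- z * s)) \<partial>lborel0)"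
      unfolding \<kappa>_def using summ
      by (intro Bochner_Integration.integral_cong refl suminf_mult2)
         (auto simp: space_lborel0 intro: summable_rabs_cancel)
    also have "\<dots> = (\<Sum>i. \<integral>s. f i s * exp (- z * s) \<partial>lborel0)"
    proof (rule integral_suminf)
      show "AE s in lborel0. summable (\<lambda>i. norm (f i s * exp (- z * s)))"
      proof (rule AE_I2)
        fix s assume s: "s \<in> space lborel0"
        show "summable (\<lambda>i. norm (f i s * exp (- z * s)))"
          by (rule summable_comparison_test'[OF summ[of s]]) (use le[OF s] s in \<open>auto simp: space_lborel0\<close>)
      qed
      show "summable (\<lambda>i. \<integral>s. norm (f i s * exp (- z * s)) \<partial>lborel0)"
      proof (rule summable_comparison_test'[OF sums_norm])
        fix i :: nat
        have "(\<integral>s. norm (f i s * exp (- z * s)) \<partial>lborel0) \<le> (\<integral>s. norm (f i s) \<partial>lborel0)"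
          using le int_exp[of z i] z f_int[of i]
          by (intro integral_mono) (auto simp: has_bochner_integral_iff)
        then show "norm (\<integral>s. norm (f i s * exp (- z * s)) \<partial>lborel0) \<le> (\<integral>s. norm (f i s) \<partial>lborel0)"
          by simp
      qed
    qed (use int_exp z in \<open>auto simp: has_bochner_integral_iff\<close>)
    also have "\<dots> = (\<Sum>i. c (Suc i) * w ^ Suc i)"
      using int_exp z by (simp add: has_bochner_integral_iff w_def)
    also have "\<dots> = (1 - w) powr a - 1"
    proof -
      have "(\<lambda>n. (a gchoose n) * (- w) ^ n) sums (1 + (- w)) powr a"
        using w by (intro gen_binomial_real) auto
      then have "(\<lambda>n. c n * w ^ n) sums (1 - w) powr a"
        by (simp add: c_def power_minus[of w] mult_ac)
      then have "(\<lambda>n. c (Suc n) * w ^ Suc n) sums ((1 - w) powr a - c 0 * w ^ 0)"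
        using sums_Suc_iff[of "\<lambda>n. c n * w ^ n" "(1 - w) powr a - c 0 * w ^ 0"] by simp
      then show ?thesis by (simp add: sums_unique[symmetric] c_def)
    qed
    finally show "(\<integral>s. \<kappa> s * exp (- z * s) \<partial>lborel0) = (z / (z + \<epsilon>)) powr a - 1"
      by (simp add: w)
  qed
qed

text \<open>The atom at \<open>0\<close> is produced by collapsing the interval \<open>[-1,0)\<close>.\<close>

lemma represents_mu_mu:
  assumes a: "0 \<le> a" "a \<le> 2"
  shows "represents_mu a (mu a)"
proof -
  obtain \<kappa> where \<kappa>: "integrable lborel0 \<kappa>"
    "\<And>z. z > 0 \<Longrightarrow> (\<integral>s. \<kappa> s * exp (- z * s) \<partial>lborel0) = (z / (z + 1)) powr a - 1"
    using binomial_kernel[OF a zero_less_one] by metis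
  \<comment> \<open>The interval to be collapsed has mass 1, the constant term split off in
    \<open>binomial_kernel\<close>. The positive part of \<kappa> goes into \<open>P\<close>, the
    negative part into \<open>N\<close>.\<close>
  define h where "h s = indicator {-1..<0} s + indicator {0..} s * max 0 (\<kappa> s)" for s :: real
  have pos_int: "integrable lborel0 (\<lambda>s. max 0 (\<kappa> s))" and neg_int: "integrable lborel0 (\<lambda>s. max 0 (- \<kappa> s))"
    using \<kappa>(1) by auto
  have h1: "integrable lborel (\<lambda>s. indicator {0..} s * max 0 (\<kappa> s))"
    using pos_int by (subst (asm) integrable_restrict_space) auto
  have h2: "integrable lborel (indicator {-1..<0} :: real \<Rightarrow> real)" by simp
  have h_int: "integrable lborel h" unfolding h_def by (intro Bochner_Integration.integrable_add h1 h2)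
  have h_meas[measurable]: "h \<in> borel_measurable borel" using borel_measurable_integrable[OF h_int] by simp
  have h0: "h s \<ge> 0" for s by (simp add: h_def)
  define P where "P = distr (density lborel h) (restrict_space borel {0..}) (\<lambda>s. max 0 s)"
  define N where "N = density lborel0 (\<lambda>s. max 0 (- \<kappa> s))"
  have max_meas: "(\<lambda>s. max 0 s) \<in> measurable (density lborel h) (restrict_space borel {0..})"
    by (intro measurable_restrict_space2) auto
  have neg_meas[measurable]: "(\<lambda>s. max 0 (- \<kappa> s)) \<in> borel_measurable lborel0" using neg_int by auto
  have "finite_measure (density lborel h)"
    by (rule finite_measureI)
       (use h_int h0 in \<open>auto simp: emeasure_density integrable_iff_bounded less_top[symmetric]\<close>)
  then have finP: "finite_measure P" unfolding P_def by (rule finite_measure.finite_measure_distr[OF _ max_meas])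
  have finN: "finite_measure N"
  proof (rule finite_measureI)
    have "emeasure N (space N) = (\<integral>\<^sup>+s. ennreal (max 0 (- \<kappa> s)) \<partial>lborel0)"
      unfolding N_def by (simp add: emeasure_density space_lborel0 sets_restrict_space_iff cong: nn_integral_cong_simp) 
    also have "\<dots> = (\<integral>\<^sup>+s. ennreal (norm (max 0 (- \<kappa> s))) \<partial>lborel0)" by simp
    also have "\<dots> < \<infinity>" using neg_int unfolding integrable_iff_bounded by blast
    finally show "emeasure N (space N) \<noteq> \<infinity>" by simp
  qed
  have "(\<integral>s. exp (- z * s) \<partial>P) - (\<integral>s. exp (- z * s) \<partial>N) = (z / (z + 1)) powr a" if z: "z > 0" for z
  proof -
    have em: "(\<lambda>s. exp (- z * s)) \<in> borel_measurable (restrict_space borel {0..})"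
      "(\<lambda>s. exp (- z * s)) \<in> borel_measurable lborel0" by (rule measurable_restrict_space1, simp)+
    have le1: "norm (w * exp (- z * s)) \<le> norm w" if "s \<ge> 0" for w s
      using that z by (simp add: abs_mult mult_left_le)
    have ip: "integrable lborel0 (\<lambda>s. max 0 (\<kappa> s) * exp (- z * s))"
      by (rule Bochner_Integration.integrable_bound[OF pos_int]) (use pos_int em(2) le1 in \<open>auto simp: space_lborel0 simp del: real_norm_def norm_mult\<close>)
    have "in": "integrable lborel0 (\<lambda>s. max 0 (- \<kappa> s) * exp (- z * s))"
      by (rule Bochner_Integration.integrable_bound[OF neg_int]) (use neg_int em(2) le1 in \<open>auto simp: space_lborel0 simp del: real_norm_def norm_mult\<close>)
    have ip': "integrable lborel (\<lambda>s. indicator {0..} s * (max 0 (\<kappa> s) * exp (- z * s)))"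
      using ip by (subst (asm) integrable_restrict_space) auto
    have "(\<integral>s. exp (- z * s) \<partial>P) = (\<integral>s. h s * exp (- z * max 0 s) \<partial>lborel)"
      unfolding P_def using h0 by (subst integral_distr[OF max_meas em(1)], subst integral_density) auto
    also have "\<dots> = (\<integral>s. indicator {-1..<0} s + indicator {0..} s * (max 0 (\<kappa> s) * exp (- z * s)) \<partial>lborel)"
      by (intro Bochner_Integration.integral_cong) (auto simp: h_def split: split_indicator)
    also have "\<dots> = 1 + (\<integral>s. max 0 (\<kappa> s) * exp (- z * s) \<partial>lborel0)"
      using ip' by (subst Bochner_Integration.integral_add) (auto simp: integral_restrict_space)
    finally have "(\<integral>s. exp (- z * s) \<partial>P) = 1 + (\<integral>s. max 0 (\<kappa> s) * exp (- z * s) \<partial>lborel0)" .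
    moreover have "(\<integral>s. exp (- z * s) \<partial>N) = (\<integral>s. max 0 (- \<kappa> s) * exp (- z * s) \<partial>lborel0)"
      unfolding N_def using em(2) neg_meas by (subst integral_density) auto
    moreover have "(\<integral>s. max 0 (\<kappa> s) * exp (- z * s) \<partial>lborel0) - (\<integral>s. max 0 (- \<kappa> s) * exp (- z * s) \<partial>lborel0)
        = (\<integral>s. \<kappa> s * exp (- z * s) \<partial>lborel0)"
      unfolding Bochner_Integration.integral_diff[OF ip "in", symmetric]
      by (intro Bochner_Integration.integral_cong) (auto simp: max_def)
    ultimately show ?thesis using \<kappa>(2)[OF z] by simp
  qed
  then have "represents_mu a (P, N)"
    using finP finN by (simp add: represents_mu_def P_def N_def sets_lborel0)
  then show ?thesis unfolding mu_def by (rule someI)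
qed

subsection \<open>A functional calculus for bounded semigroups\<close>

context bounded_c0_semigroup
begin

text \<open>In this equivalent norm the semigroup is contractive, which makes all constants below linear
  in the bound of the semigroup.\<close>

definition q :: "'a \<Rightarrow> real" where
  "q x = (SUP s\<in>{0..}. norm (T s x))"

definition bound :: real where
  "bound = (SUP s\<in>{0..}. norm (T s))"

lemma norm_T_le: "s \<ge> 0 \<Longrightarrow> norm (T s) \<le> bound"
  unfolding bound_def
  using bounded_semigroup
  by (intro cSUP_upper) (auto simp: bounded_iff bdd_above_def)

lemma bound_nonneg: "bound \<ge> 0"
  using norm_T_le[of 0] norm_ge_zero[of "T 0"] by linarith

lemma norm_T_le_bound: "s \<ge> 0 \<Longrightarrow> norm (T s x) \<le> bound * norm x"
  by (meson mult_right_mono norm_T_le norm_blinfun norm_ge_zero order.trans)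

lemma T_T: "s \<ge> 0 \<Longrightarrow> t \<ge> 0 \<Longrightarrow> T s (T t x) = T (s + t) x"
  by (simp add: semigroup_add)

lemma T_0 [simp]: "T 0 x = x"
  by (simp add: semigroup_zero)

lemma norm_T_le_q: "s \<ge> 0 \<Longrightarrow> norm (T s x) \<le> q x"
  unfolding q_def
  by (intro cSUP_upper) (auto intro!: bdd_aboveI norm_T_le_bound)

lemma norm_le_q: "norm x \<le> q x"
  using norm_T_le_q[of 0 x] by simp

lemma q_nonneg: "q x \<ge> 0"
  using norm_le_q[of x] norm_ge_zero[of x] by linarith

lemma q_leI: "(\<And>s. s \<ge> 0 \<Longrightarrow> norm (T s x) \<le> c) \<Longrightarrow> q x \<le> c"
  unfolding q_def by (intro cSUP_least) auto

lemma q_le_bound: "q x \<le> bound * norm x"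
  by (intro q_leI norm_T_le_bound)

lemma q_T: "s \<ge> 0 \<Longrightarrow> q (T s x) \<le> q x"
  by (rule q_leI) (simp add: T_T norm_T_le_q)

lemma q_add: "q (x + y) \<le> q x + q y"
proof (rule q_leI)
  fix s :: real assume "s \<ge> 0"
  then show "norm (T s (x + y)) \<le> q x + q y"
    using norm_triangle_ineq[of "T s x" "T s y"] norm_T_le_q[of s x] norm_T_le_q[of s y]
    by (simp add: blinfun.add_right)
qed

lemma q_scaleR: "q (c *\<^sub>R x) \<le> \<bar>c\<bar> * q x"
  by (rule q_leI) (simp add: blinfun.scaleR_right mult_left_mono norm_T_le_q)

lemma q_minus: "q (- x) = q x"
  using q_scaleR[of "- 1" x] q_scaleR[of "- 1" "- x"] by simp

lemma q_diff: "q (x - y) \<le> q x + q y"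
  using q_add[of x "- y"] by (simp add: q_minus)

lemma q_0 [simp]: "q 0 = 0"
  using q_scaleR[of 0 0] q_nonneg[of 0] by simp

lemma tendsto_q:
  assumes "(f \<longlongrightarrow> x) F"
  shows "((\<lambda>n. q (f n)) \<longlongrightarrow> q x) F"
proof (rule LIM_zero_cancel, rule Lim_null_comparison)
  have "\<bar>q a - q b\<bar> \<le> bound * norm (a - b)" for a b
    using q_add[of "a - b" b] q_add[of "b - a" a] q_minus[of "a - b"] q_le_bound[of "a - b"] by simp
  then show "\<forall>\<^sub>F n in F. norm (q (f n) - q x) \<le> bound * norm (f n - x)" by simp
  have "((\<lambda>n. bound * norm (f n - x)) \<longlongrightarrow> bound * norm (x - x)) F"
    by (intro tendsto_intros assms)
  then show "((\<lambda>n. bound * norm (f n - x)) \<longlongrightarrow> 0) F" by simp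
qed

text \<open>Factoring out the operator at the smaller time reduces continuity from both sides at any
  time to right continuity at 0.\<close>

lemma norm_T_diff:
  assumes "s \<ge> 0" "t \<ge> 0"
  shows "norm (T t x - T s x) \<le> bound * norm (T \<bar>t - s\<bar> x - x)"
proof -
  have *: "norm (T t x - T s x) \<le> bound * norm (T (t - s) x - x)" if "0 \<le> s" "s \<le> t" for s t
  proof -
    have "T t x - T s x = T s (T (t - s) x - x)" using that by (simp add: blinfun.diff_right T_T)
    then show ?thesis using norm_T_le_bound[OF that(1)] by metis
  qed
  show ?thesis
    using *[of s t] *[of t s] assms by (cases "s \<le> t") (auto simp: norm_minus_commute)
qed

lemma continuous_on_T: "continuous_on {0..} (\<lambda>s. T s x)"
  unfolding continuous_on_iff
proof (intro ballI allI impI)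
  fix t e :: real assume t: "t \<in> {0..}" and e: "e > 0"
  define e' where "e' = e / (bound + 1)"
  have e': "e' > 0" using e bound_nonneg by (simp add: e'_def)
  obtain d where d: "d > 0" "\<And>h. 0 < h \<Longrightarrow> h < d \<Longrightarrow> dist (T h x) x < e'"
    using tendstoD[OF strongly_continuous e', of x] by (auto simp: eventually_at_right_field)
  have "dist (T s x) (T t x) < e" if s: "s \<in> {0..}" "dist s t < d" for s
  proof -
    have "norm (T \<bar>s - t\<bar> x - x) < e'"
      using d(2)[of "\<bar>s - t\<bar>"] s e' by (cases "s = t") (auto simp: dist_norm)
    then have "bound * norm (T \<bar>s - t\<bar> x - x) \<le> bound * e'"
      using bound_nonneg by (intro mult_left_mono) auto
    also have "\<dots> < e" using e bound_nonneg by (simp add: e'_def field_simps)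
    finally show ?thesis using norm_T_diff[of t s x] s t by (simp add: dist_norm)
  qed
  then show "\<exists>d>0. \<forall>s\<in>{0..}. dist s t < d \<longrightarrow> dist (T s x) (T t x) < e" using d(1) by blast
qed

lemma bounded_orbit: "bounded ((\<lambda>s. T s x) ` {0..})"
  by (auto simp: bounded_iff intro!: exI[of _ "q x"] norm_T_le_q)

lemma Cb_orbit: "bounded_linear f \<Longrightarrow> (\<lambda>s. f (T s x)) \<in> Cb"
  unfolding Cb_def
  using bounded_linear_image[OF bounded_orbit[of x], of f]
  by (auto simp: image_image intro: bounded_linear.continuous_on continuous_on_T)

text \<open>The operator \<open>B\<close> is \<open>\<integral> T\<^sub>s d\<mu>(s)\<close>, in the weak sense, for a finite signed measure \<open>\<mu>\<close> with
  Laplace transform \<open>L\<close>.\<close>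

definition rep :: "('a \<Rightarrow> 'a) \<Rightarrow> (real \<Rightarrow> real) \<Rightarrow> bool" where
  "rep B L \<longleftrightarrow> (\<exists>\<Lambda>. daniell \<Lambda> \<and> (\<forall>f x. bounded_linear f \<longrightarrow> f (B x) = \<Lambda> (\<lambda>s. f (T s x))) \<and>
     (\<forall>z>0. \<Lambda> (\<lambda>s. exp (- z * s)) = L z))"

lemma repI:
  assumes "daniell \<Lambda>" "\<And>f x. bounded_linear f \<Longrightarrow> f (B x) = \<Lambda> (\<lambda>s. f (T s x))"
    "\<And>z. z > 0 \<Longrightarrow> \<Lambda> (\<lambda>s. exp (- z * s)) = L z"
  shows "rep B L"
  unfolding rep_def by (intro exI[of _ \<Lambda>] conjI allI impI assms)

lemma repE:
  assumes "rep B L"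
  obtains \<Lambda> where "daniell \<Lambda>" "\<And>f x. bounded_linear f \<Longrightarrow> f (B x) = \<Lambda> (\<lambda>s. f (T s x))"
    "\<And>z. z > 0 \<Longrightarrow> \<Lambda> (\<lambda>s. exp (- z * s)) = L z"
proof -
  obtain \<Lambda> where \<Lambda>: "daniell \<Lambda> \<and> (\<forall>f x. bounded_linear f \<longrightarrow> f (B x) = \<Lambda> (\<lambda>s. f (T s x))) \<and>
     (\<forall>z>0. \<Lambda> (\<lambda>s. exp (- z * s)) = L z)"
    using assms unfolding rep_def ..
  show ?thesis
    by (rule that[of \<Lambda>]) (rule \<Lambda>[THEN conjunct1] \<Lambda>[THEN conjunct2, THEN conjunct1, rule_format]
      \<Lambda>[THEN conjunct2, THEN conjunct2, rule_format]; assumption?)+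
qed

text \<open>The difference of the two functionals kills all exponentials, hence by
  \<open>daniell_eq_0\<close> every test function, in particular
  \<open>s \<mapsto> f (T s x)\<close>. This reduces operator identities to scalar identities for z
  > 0.\<close>

lemma rep_unique:
  assumes B: "rep B L" and C: "rep C L'" and eq: "\<And>z. z > 0 \<Longrightarrow> L z = L' z"
  shows "B x = C x"
proof (rule eq_if_functionals_eq)
  fix f :: "'a \<Rightarrow> real" assume f: "bounded_linear f"
  obtain \<Lambda> where \<Lambda>: "daniell \<Lambda>" "\<And>f x. bounded_linear f \<Longrightarrow> f (B x) = \<Lambda> (\<lambda>s. f (T s x))"
    "\<And>z. z > 0 \<Longrightarrow> \<Lambda> (\<lambda>s. exp (- z * s)) = L z" by (rule repE[OF B], rule that)
  obtain \<Lambda>' where \<Lambda>': "daniell \<Lambda>'" "\<And>f x. bounded_linear f \<Longrightarrow> f (C x) = \<Lambda>' (\<lambda>s. f (T s x))"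
    "\<And>z. z > 0 \<Longrightarrow> \<Lambda>' (\<lambda>s. exp (- z * s)) = L' z" by (rule repE[OF C], rule that)
  have "1 * \<Lambda> (\<lambda>s. exp (- z * s)) + (- 1) * \<Lambda>' (\<lambda>s. exp (- z * s)) = 0" if "z > 0" for z
    unfolding \<Lambda>(3)[OF that] \<Lambda>'(3)[OF that] eq[OF that] by simp
  then have "1 * \<Lambda> (\<lambda>s. f (T s x)) + (- 1) * \<Lambda>' (\<lambda>s. f (T s x)) = 0"
    by (rule daniell_eq_0[OF daniell_lincomb[OF \<Lambda>(1) \<Lambda>'(1)] _ Cb_orbit[OF f]])
  then show "f (B x) = f (C x)" by (simp add: \<Lambda>(2)[OF f] \<Lambda>'(2)[OF f])
qed

text \<open>For fixed s the map \<open>y \<mapsto> f (T s y)\<close> is itself a bounded functional,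
  so the representation of \<open>C\<close> applies under the outer functional; the semigroup law
  then turns the iterated expression into a convolution.\<close>

lemma rep_compose:
  assumes B: "rep B L" and C: "rep C L'"
  shows "rep (\<lambda>x. B (C x)) (\<lambda>z. L z * L' z)"
proof -
  obtain \<Lambda> where \<Lambda>: "daniell \<Lambda>" "\<And>f x. bounded_linear f \<Longrightarrow> f (B x) = \<Lambda> (\<lambda>s. f (T s x))"
    "\<And>z. z > 0 \<Longrightarrow> \<Lambda> (\<lambda>s. exp (- z * s)) = L z" by (rule repE[OF B], rule that)
  obtain \<Lambda>' where \<Lambda>': "daniell \<Lambda>'" "\<And>f x. bounded_linear f \<Longrightarrow> f (C x) = \<Lambda>' (\<lambda>s. f (T s x))"
    "\<And>z. z > 0 \<Longrightarrow> \<Lambda>' (\<lambda>s. exp (- z * s)) = L' z" by (rule repE[OF C], rule that)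
  show ?thesis
  proof (rule repI[OF daniell_compose[OF \<Lambda>(1) \<Lambda>'(1)]])
    fix f :: "'a \<Rightarrow> real" and x assume f: "bounded_linear f"
    have "\<Lambda> (\<lambda>s. f (T s (C x))) = \<Lambda> (\<lambda>s. \<Lambda>' (\<lambda>r. f (T (s + r) x)))"
    proof (rule daniell_cong[OF \<Lambda>(1) Cb_orbit[OF f] Cb_daniell_shift[OF \<Lambda>'(1) Cb_orbit[OF f]]])
      fix s :: real assume s: "s \<ge> 0"
      have fT: "bounded_linear (\<lambda>y. f (T s y))"
        using bounded_linear_compose[OF f blinfun.bounded_linear_right] .
      have "f (T s (C x)) = \<Lambda>' (\<lambda>r. f (T s (T r x)))" by (rule \<Lambda>'(2)[OF fT])
      also have "\<dots> = \<Lambda>' (\<lambda>r. f (T (s + r) x))"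
        by (rule daniell_cong[OF \<Lambda>'(1) Cb_orbit[OF fT] Cb_shift[OF Cb_orbit[OF f] s]]) (use s in \<open>simp add: T_T\<close>)
      finally show "f (T s (C x)) = \<Lambda>' (\<lambda>r. f (T (s + r) x))" .
    qed
    then show "f (B (C x)) = \<Lambda> (\<lambda>s. \<Lambda>' (\<lambda>r. f (T (s + r) x)))" by (simp add: \<Lambda>(2)[OF f])
  next
    fix z :: real assume z: "z > 0"
    have "\<Lambda>' (\<lambda>r. exp (- z * (s + r))) = L' z * exp (- z * s)" for s
    proof -
      have "(\<lambda>r. exp (- z * (s + r))) = (\<lambda>r. exp (- z * s) * exp (- z * r))"
        by (simp add: exp_add[symmetric] algebra_simps)
      then show ?thesis using daniell_cmult[OF \<Lambda>'(1) Cb_exp[OF z], of "exp (- z * s)"] \<Lambda>'(3)[OF z] by simp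
    qed
    then show "\<Lambda> (\<lambda>s. \<Lambda>' (\<lambda>r. exp (- z * (s + r)))) = L z * L' z"
      using daniell_cmult[OF \<Lambda>(1) Cb_exp[OF z], of "L' z"] \<Lambda>(3)[OF z] by simp
  qed
qed

lemma rep_lincomb:
  assumes B: "rep B L" and C: "rep C L'"
  shows "rep (\<lambda>x. a *\<^sub>R B x + b *\<^sub>R C x) (\<lambda>z. a * L z + b * L' z)"
proof -
  obtain \<Lambda> where \<Lambda>: "daniell \<Lambda>" "\<And>f x. bounded_linear f \<Longrightarrow> f (B x) = \<Lambda> (\<lambda>s. f (T s x))"
    "\<And>z. z > 0 \<Longrightarrow> \<Lambda> (\<lambda>s. exp (- z * s)) = L z" by (rule repE[OF B], rule that)
  obtain \<Lambda>' where \<Lambda>': "daniell \<Lambda>'" "\<And>f x. bounded_linear f \<Longrightarrow> f (C x) = \<Lambda>' (\<lambda>s. f (T s x))"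
    "\<And>z. z > 0 \<Longrightarrow> \<Lambda>' (\<lambda>s. exp (- z * s)) = L' z" by (rule repE[OF C], rule that)
  show ?thesis
  proof (rule repI[OF daniell_lincomb[OF \<Lambda>(1) \<Lambda>'(1)]])
    show "f (a *\<^sub>R B x + b *\<^sub>R C x) = a * \<Lambda> (\<lambda>s. f (T s x)) + b * \<Lambda>' (\<lambda>s. f (T s x))"
      if f: "bounded_linear f" for f x
      by (simp add: linear_simps[OF f] \<Lambda>(2)[OF f] \<Lambda>'(2)[OF f])
    show "a * \<Lambda> (\<lambda>s. exp (- z * s)) + b * \<Lambda>' (\<lambda>s. exp (- z * s)) = a * L z + b * L' z" if "z > 0" for z
      by (simp only: \<Lambda>(3)[OF that] \<Lambda>'(3)[OF that])
  qed
qed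

lemma rep_cong:
  assumes "rep B L" "\<And>x. B' x = B x" "\<And>z. z > 0 \<Longrightarrow> L' z = L z"
  shows "rep B' L'"
proof -
  have "B' = B" using assms(2) by (rule ext)
  obtain \<Lambda> where \<Lambda>: "daniell \<Lambda>" "\<And>f x. bounded_linear f \<Longrightarrow> f (B x) = \<Lambda> (\<lambda>s. f (T s x))"
    "\<And>z. z > 0 \<Longrightarrow> \<Lambda> (\<lambda>s. exp (- z * s)) = L z" by (rule repE[OF assms(1)], rule that)
  show ?thesis
    unfolding \<open>B' = B\<close>
    by (rule repI[OF \<Lambda>(1)]) (rule \<Lambda>(2), assumption, simp only: \<Lambda>(3) assms(3))
qed

lemma rep_T: "s \<ge> 0 \<Longrightarrow> rep (T s) (\<lambda>z. exp (- z * s))"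
  by (rule repI[OF daniell_at]) (assumption | rule refl)+

lemma rep_id: "rep (\<lambda>x. x) (\<lambda>z. 1)"
  by (rule rep_cong[OF rep_T[OF order_refl]]) simp_all

text \<open>Linearity is inherited from the functional by testing. For the norm, a functional
  norming \<open>B x\<close> turns the bound \<open>K\<close> of the representing functional into
  the operator bound \<open>K * bound\<close>.\<close>

lemma rep_bounded_linear:
  assumes "rep B L"
  shows "bounded_linear B"
proof -
  obtain \<Lambda> where \<Lambda>: "daniell \<Lambda>" "\<And>f x. bounded_linear f \<Longrightarrow> f (B x) = \<Lambda> (\<lambda>s. f (T s x))"
    by (rule repE[OF assms], rule that)
  obtain K where K: "\<And>\<phi> C. \<phi> \<in> Cb \<Longrightarrow> (\<And>s. s \<ge> 0 \<Longrightarrow> \<bar>\<phi> s\<bar> \<le> C) \<Longrightarrow> \<bar>\<Lambda> \<phi>\<bar> \<le> K * C" "K \<ge> 0"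
    using daniell_bound[OF \<Lambda>(1)] by blast
  show ?thesis
  proof (rule bounded_linear_intro)
    show "B (x + y) = B x + B y" for x y
    proof (rule eq_if_functionals_eq)
      fix f :: "'a \<Rightarrow> real" assume f: "bounded_linear f"
      show "f (B (x + y)) = f (B x + B y)"
        by (simp add: \<Lambda>(2)[OF f] linear_simps[OF f] blinfun.add_right daniell_add[OF \<Lambda>(1) Cb_orbit[OF f] Cb_orbit[OF f]])
    qed
    show "B (c *\<^sub>R x) = c *\<^sub>R B x" for c x
    proof (rule eq_if_functionals_eq)
      fix f :: "'a \<Rightarrow> real" assume f: "bounded_linear f"
      show "f (B (c *\<^sub>R x)) = f (c *\<^sub>R B x)"
        by (simp add: \<Lambda>(2)[OF f] linear_simps[OF f] blinfun.scaleR_right daniell_cmult[OF \<Lambda>(1) Cb_orbit[OF f]])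
    qed
    show "norm (B x) \<le> norm x * (K * bound)" for x
    proof -
      obtain f :: "'a \<Rightarrow> real" where f: "bounded_linear f" "\<And>x. \<bar>f x\<bar> \<le> norm x" "f (B x) = norm (B x)"
        using norming_functional by metis
      have "\<bar>\<Lambda> (\<lambda>s. f (T s x))\<bar> \<le> K * (bound * norm x)"
        by (intro K Cb_orbit f(1)) (metis f(2) norm_T_le_bound order.trans)
      then show ?thesis using f(3) \<Lambda>(2)[OF f(1)] by (simp add: mult_ac)
    qed
  qed
qed

lemma rep_commute: "rep B L \<Longrightarrow> rep C L' \<Longrightarrow> B (C x) = C (B x)"
  by (rule rep_unique[OF rep_compose rep_compose]) (assumption | rule mult.commute)+

section \<open>Operators given by densities, and their bounds in the new norm\<close>

definition opk :: "(real \<Rightarrow> real) \<Rightarrow> 'a \<Rightarrow> 'a" where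
  "opk w x = bochner_int lborel0 (\<lambda>s. w s *\<^sub>R T s x)"

lemma opk_functional:
  "integrable lborel0 w \<Longrightarrow> bounded_linear f \<Longrightarrow> f (opk w x) = (\<integral>s. w s * f (T s x) \<partial>lborel0)"
  unfolding opk_def by (rule bochner_int_functional[OF sets_lborel0 _ continuous_on_T bounded_orbit])

lemma rep_opk:
  assumes "integrable lborel0 w" "\<And>z. z > 0 \<Longrightarrow> (\<integral>s. w s * exp (- z * s) \<partial>lborel0) = L z"
  shows "rep (opk w) L"
proof (rule repI[OF daniell_integral[OF sets_lborel0 assms(1)]])
  show "f (opk w x) = (\<integral>s. w s * f (T s x) \<partial>lborel0)" if "bounded_linear f" for f :: "'a \<Rightarrow> real" and x
    by (rule opk_functional[OF assms(1) that])
qed (rule assms(2))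

lemma integrable_mult_Cb:
  assumes "integrable lborel0 w" "\<phi> \<in> Cb"
  shows "integrable lborel0 (\<lambda>s. w s * \<phi> s)"
proof -
  obtain C where C: "\<And>s. s \<ge> 0 \<Longrightarrow> \<bar>\<phi> s\<bar> \<le> C" "C \<ge> 0" using CbE[OF assms(2)] by metis
  have m: "\<phi> \<in> borel_measurable lborel0"
    unfolding measurable_cong_sets[OF sets_lborel0 refl]
    using assms(2) by (intro borel_measurable_continuous_on_restrict) (auto simp: Cb_def)
  show ?thesis
  proof (rule Bochner_Integration.integrable_bound[OF integrable_mult_right[OF assms(1), of C]])
    show "(\<lambda>s. w s * \<phi> s) \<in> borel_measurable lborel0" using assms(1) m by (intro borel_measurable_times) auto
    show "AE s in lborel0. norm (w s * \<phi> s) \<le> norm (C * w s)"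
      using C by (intro AE_I2) (auto simp: space_lborel0 abs_mult mult.commute intro!: mult_right_mono)
  qed
qed

text \<open>This is the triangle inequality for the integral of w(s) (T s x - y). The majorant
  \<open>g\<close> avoids any question of measurability of \<open>s \<mapsto> q (T s x - y)\<close>.
  With y = 0 it gives the mass bound \<open>q_opk\<close>; with y = x or y = \<open>T h x\<close> it
  gives Taylor remainders.\<close>

lemma q_opk_diff:
  assumes w: "integrable lborel0 w" and g: "integrable lborel0 g"
    and le: "\<And>s. s \<ge> 0 \<Longrightarrow> \<bar>w s\<bar> * q (T s x - y) \<le> g s"
  shows "q (opk w x - (\<integral>s. w s \<partial>lborel0) *\<^sub>R y) \<le> (\<integral>s. g s \<partial>lborel0)"
proof (rule q_leI)
  fix r :: real assume r: "r \<ge> 0"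
  let ?c = "\<integral>s. w s \<partial>lborel0"
  obtain f :: "'a \<Rightarrow> real" where f: "bounded_linear f" "\<And>x. \<bar>f x\<bar> \<le> norm x"
    "f (T r (opk w x - ?c *\<^sub>R y)) = norm (T r (opk w x - ?c *\<^sub>R y))"
    using norming_functional by metis
  have fT: "bounded_linear (\<lambda>y. f (T r y))"
    using bounded_linear_compose[OF f(1) blinfun.bounded_linear_right] .
  have i1: "integrable lborel0 (\<lambda>s. w s * f (T r (T s x)))"
    by (rule integrable_mult_Cb[OF w Cb_orbit[OF fT]])
  have "norm (T r (opk w x - ?c *\<^sub>R y)) = f (T r (opk w x)) - ?c * f (T r y)"
    using f(3) by (simp add: linear_simps[OF fT])
  also have "\<dots> = (\<integral>s. w s * f (T r (T s x)) \<partial>lborel0) - (\<integral>s. w s * f (T r y) \<partial>lborel0)"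
    by (simp add: opk_functional[OF w fT])
  also have "\<dots> = (\<integral>s. w s * f (T r (T s x)) - w s * f (T r y) \<partial>lborel0)"
    using i1 w by (intro Bochner_Integration.integral_diff[symmetric]) auto
  also have "\<dots> \<le> (\<integral>s. g s \<partial>lborel0)"
  proof (rule integral_mono)
    show "integrable lborel0 (\<lambda>s. w s * f (T r (T s x)) - w s * f (T r y))"
      using i1 w by (intro Bochner_Integration.integrable_diff) auto
    fix s assume "s \<in> space lborel0"
    then have s: "s \<ge> 0" by (simp add: space_lborel0)
    have "w s * f (T r (T s x)) - w s * f (T r y) = w s * f (T r (T s x - y))"
      by (simp add: linear_simps[OF fT] right_diff_distrib)
    also have "\<dots> \<le> \<bar>w s\<bar> * \<bar>f (T r (T s x - y))\<bar>" by (metis abs_ge_self abs_mult)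
    also have "\<dots> \<le> \<bar>w s\<bar> * q (T s x - y)"
      using f(2)[of "T r (T s x - y)"] norm_T_le_q[OF r, of "T s x - y"] by (intro mult_left_mono) auto
    also have "\<dots> \<le> g s" by (rule le[OF s])
    finally show "w s * f (T r (T s x)) - w s * f (T r y) \<le> g s" .
  qed (rule g)
  finally show "norm (T r (opk w x - ?c *\<^sub>R y)) \<le> (\<integral>s. g s \<partial>lborel0)" .
qed

lemma q_opk:
  assumes w: "integrable lborel0 w"
  shows "q (opk w x) \<le> (\<integral>s. \<bar>w s\<bar> \<partial>lborel0) * q x"
proof -
  have "q (opk w x - (\<integral>s. w s \<partial>lborel0) *\<^sub>R 0) \<le> (\<integral>s. \<bar>w s\<bar> * q x \<partial>lborel0)"
    using w by (intro q_opk_diff) (auto intro!: mult_left_mono q_T)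
  then show ?thesis by simp
qed

lemma rep_measure:
  assumes "finite_measure P" "sets P = sets (restrict_space borel {0..})"
  shows "rep (\<lambda>x. bochner_int P (\<lambda>s. T s x)) (\<lambda>z. \<integral>s. exp (- z * s) \<partial>P)"
proof -
  have int1: "integrable P (\<lambda>s. 1 :: real)" using assms(1) by (simp add: finite_measure.integrable_const)
  show ?thesis
  proof (rule repI[OF daniell_integral[OF assms(2) int1]])
    show "f (bochner_int P (\<lambda>s. T s x)) = (\<integral>s. 1 * f (T s x) \<partial>P)" if "bounded_linear f" for f :: "'a \<Rightarrow> real" and x
      using bochner_int_functional[OF assms(2) int1 continuous_on_T bounded_orbit that, of x] by simp
  qed simp
qed

lemma rep_u_op:
  assumes "0 \<le> a" "a \<le> 2"
  shows "rep (u_op T a) (\<lambda>z. (z / (z + 1)) powr a)"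
proof -
  obtain P N where PN: "mu a = (P, N)" by fastforce
  have "represents_mu a (P, N)" using represents_mu_mu[OF assms] by (simp add: PN)
  then have *: "finite_measure P" "sets P = sets (restrict_space borel {0..})"
    "finite_measure N" "sets N = sets (restrict_space borel {0..})"
    "\<And>z. z > 0 \<Longrightarrow> (\<integral>s. exp (- z * s) \<partial>P) - (\<integral>s. exp (- z * s) \<partial>N) = (z / (z + 1)) powr a"
    by (auto simp: represents_mu_def)
  show ?thesis
    by (rule rep_cong[OF rep_lincomb[OF rep_measure[OF *(1,2)] rep_measure[OF *(3,4)], of 1 "- 1"]])
       (use *(5) in \<open>simp_all add: u_op_def PN\<close>)
qed

text \<open>This operator is the power - a of c + A. Its density is nonnegative, so the total mass
  is the integral itself, the transform evaluated at z = 0.\<close>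

lemma rep_Gamma:
  assumes a: "a > 0" and c: "c > 0"
  shows "rep (opk (\<lambda>s. (1 / Gamma a) * (s powr (a - 1) * exp (- c * s)))) (\<lambda>z. (c + z) powr - a)"
    and "q (opk (\<lambda>s. (1 / Gamma a) * (s powr (a - 1) * exp (- c * s))) x) \<le> c powr - a * q x"
proof -
  let ?w = "\<lambda>s. (1 / Gamma a) * (s powr (a - 1) * exp (- c * s))"
  have G: "Gamma a > 0" using a by simp
  have w: "has_bochner_integral lborel0 ?w ((1 / Gamma a) * (Gamma a / c powr a))"
    by (intro has_bochner_integral_mult_right has_bochner_integral_Gamma a c)
  then have wi: "integrable lborel0 ?w" by (simp add: has_bochner_integral_iff)
  show "rep (opk ?w) (\<lambda>z. (c + z) powr - a)"
  proof (rule rep_opk[OF wi])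
    fix z :: real assume z: "z > 0"
    have "has_bochner_integral lborel0 (\<lambda>s. (1 / Gamma a) * (s powr (a - 1) * exp (- (c + z) * s))) ((1 / Gamma a) * (Gamma a / (c + z) powr a))"
      using z c by (intro has_bochner_integral_mult_right has_bochner_integral_Gamma a) auto
    moreover have "(\<lambda>s. (1 / Gamma a) * (s powr (a - 1) * exp (- (c + z) * s))) = (\<lambda>s. ?w s * exp (- z * s))"
      by (simp add: fun_eq_iff distrib_right exp_add exp_diff exp_minus field_simps)
    ultimately have "(\<integral>s. ?w s * exp (- z * s) \<partial>lborel0) = (1 / Gamma a) * (Gamma a / (c + z) powr a)"
      by (simp only: has_bochner_integral_iff)
    then show "(\<integral>s. ?w s * exp (- z * s) \<partial>lborel0) = (c + z) powr - a"
      using G by (simp only: powr_minus_divide) simp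
  qed
  have "(\<integral>s. \<bar>?w s\<bar> \<partial>lborel0) = (\<integral>s. ?w s \<partial>lborel0)" using G by (intro Bochner_Integration.integral_cong) (auto simp: abs_mult)
  also have "\<dots> = (1 / Gamma a) * (Gamma a / c powr a)" using w by (simp only: has_bochner_integral_iff)
  also have "\<dots> = c powr - a" using G by (simp only: powr_minus_divide) simp
  finally show "q (opk ?w x) \<le> c powr - a * q x" using q_opk[OF wi, of x] by metis
qed

lemma rep_v_op:
  assumes "a > 0"
  shows "rep (v_op T a) (\<lambda>z. (1 + z) powr - a)"
proof -
  have w: "integrable lborel0 (\<lambda>s. s powr (a - 1) * exp (- s))"
    using has_bochner_integral_Gamma[OF assms, of 1] by (simp add: has_bochner_integral_iff)
  have "rep (opk (\<lambda>s. s powr (a - 1) * exp (- s))) (\<lambda>z. Gamma a * (1 + z) powr - a)"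
  proof (rule rep_opk[OF w])
    fix z :: real assume z: "z > 0"
    have "(\<lambda>s. s powr (a - 1) * exp (- (1 + z) * s)) = (\<lambda>s. s powr (a - 1) * exp (- s) * exp (- z * s))"
      by (simp add: fun_eq_iff distrib_right exp_add exp_diff exp_minus field_simps)
    then show "(\<integral>s. s powr (a - 1) * exp (- s) * exp (- z * s) \<partial>lborel0) = Gamma a * (1 + z) powr - a"
      using has_bochner_integral_Gamma[OF assms, of "1 + z"] z by (simp add: has_bochner_integral_iff powr_minus_divide)
  qed
  then have "rep (\<lambda>x. (1 / Gamma a) *\<^sub>R opk (\<lambda>s. s powr (a - 1) * exp (- s)) x + 0 *\<^sub>R x) (\<lambda>z. (1 / Gamma a) * (Gamma a * (1 + z) powr - a) + 0 * 1)"
    by (rule rep_lincomb[OF _ rep_id])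
  then show ?thesis
    using Gamma_real_pos[OF assms] by (elim rep_cong) (auto simp: v_op_def opk_def)
qed

end

subsection \<open>Resolvents and averages\<close>

lemma has_bochner_integral_Icc0:
  fixes f F :: "real \<Rightarrow> real"
  assumes h: "0 \<le> h" and f: "f \<in> borel_measurable borel"
    and F: "\<And>s. 0 \<le> s \<Longrightarrow> s \<le> h \<Longrightarrow> DERIV F s :> f s" and nn: "\<And>s. 0 \<le> s \<Longrightarrow> s \<le> h \<Longrightarrow> 0 \<le> f s"
  shows "has_bochner_integral lborel0 (\<lambda>s. indicator {0..h} s * f s) (F h - F 0)"
proof -
  have "has_bochner_integral lborel (\<lambda>s. f s * indicator {0..h} s) (F h - F 0)"
    using assms by (intro has_bochner_integral_FTC_Icc_nonneg) auto
  moreover have "(\<lambda>s. f s * indicator {0..h} s) = (\<lambda>s. indicator {0..} s *\<^sub>R (indicator {0..h} s * f s))"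
    by (auto simp: fun_eq_iff split: split_indicator)
  ultimately show ?thesis
    by (simp add: has_bochner_integral_iff integrable_restrict_space integral_restrict_space)
qed

context bounded_c0_semigroup
begin

text \<open>The resolvent, that is the inverse of \<epsilon> + A, as the Laplace transform of the
  semigroup; \<open>A_R\<close> and \<open>R_A\<close> justify this reading.\<close>

definition R :: "real \<Rightarrow> 'a \<Rightarrow> 'a" where
  "R \<epsilon> = opk (\<lambda>s. exp (- \<epsilon> * s))"

text \<open>The integral of the orbit over \<open>[0,h]\<close>. It expresses differences of the
  semigroup through A (\<open>J_A\<close>) without differentiating orbits.\<close>

definition J :: "real \<Rightarrow> 'a \<Rightarrow> 'a" where
  "J h = opk (indicator {0..h})"

lemma has_bochner_integral_exp: "c > 0 \<Longrightarrow> has_bochner_integral lborel0 (\<lambda>s. exp (- c * s)) (1 / c)"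
  using has_bochner_integral_power_exp[of c 0] by simp

lemma rep_R:
  assumes "\<epsilon> > 0"
  shows "rep (R \<epsilon>) (\<lambda>z. 1 / (z + \<epsilon>))"
  unfolding R_def
proof (rule rep_opk)
  show "integrable lborel0 (\<lambda>s. exp (- \<epsilon> * s))"
    using has_bochner_integral_exp[OF assms] by (simp only: has_bochner_integral_iff)
  fix z :: real assume z: "z > 0"
  have "(\<lambda>s. exp (- \<epsilon> * s) * exp (- z * s)) = (\<lambda>s. exp (- (z + \<epsilon>) * s))"
    by (simp add: fun_eq_iff exp_add[symmetric] algebra_simps)
  then show "(\<integral>s. exp (- \<epsilon> * s) * exp (- z * s) \<partial>lborel0) = 1 / (z + \<epsilon>)"
    using has_bochner_integral_exp[of "z + \<epsilon>"] z assms by (simp only: has_bochner_integral_iff)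
qed

lemma q_R:
  assumes "\<epsilon> > 0"
  shows "\<epsilon> * q (R \<epsilon> x) \<le> q x"
proof -
  note i = has_bochner_integral_exp[OF assms, unfolded has_bochner_integral_iff]
  have "q (R \<epsilon> x) \<le> (\<integral>s. \<bar>exp (- \<epsilon> * s)\<bar> \<partial>lborel0) * q x"
    unfolding R_def by (rule q_opk[OF i[THEN conjunct1]])
  also have "\<dots> = 1 / \<epsilon> * q x" using i by simp
  finally show ?thesis using assms by (simp add: field_simps)
qed

lemma has_bochner_integral_Icc:
  "h \<ge> 0 \<Longrightarrow> has_bochner_integral lborel0 (indicator {0..h}) h"
  using has_bochner_integral_Icc0[of h "\<lambda>s. 1" "\<lambda>s. s"] by (simp add: DERIV_ident)

lemma rep_J:
  assumes h: "h \<ge> 0"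
  shows "rep (J h) (\<lambda>z. (1 - exp (- z * h)) / z)"
  unfolding J_def
proof (rule rep_opk)
  show "integrable lborel0 (indicator {0..h} :: real \<Rightarrow> real)"
    using has_bochner_integral_Icc[OF h] by (simp only: has_bochner_integral_iff)
  fix z :: real assume z: "z > 0"
  have "has_bochner_integral lborel0 (\<lambda>s. indicator {0..h} s * exp (- z * s)) (- exp (- z * h) / z - - exp (- z * 0) / z)"
    using h z by (intro has_bochner_integral_Icc0[where F = "\<lambda>s. - exp (- z * s) / z"]) (auto intro!: derivative_eq_intros)
  then have "(\<integral>s. indicator {0..h} s * exp (- z * s) \<partial>lborel0) = - exp (- z * h) / z - - exp (- z * 0) / z"
    by (simp only: has_bochner_integral_iff)
  then show "(\<integral>s. indicator {0..h} s * exp (- z * s) \<partial>lborel0) = (1 - exp (- z * h)) / z"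
    using z by (simp add: diff_divide_distrib)
qed

lemma q_J_diff:
  assumes h: "h \<ge> 0" and g: "has_bochner_integral lborel0 (\<lambda>s. indicator {0..h} s * g s) c"
    and le: "\<And>s. 0 \<le> s \<Longrightarrow> s \<le> h \<Longrightarrow> q (T s x - y) \<le> g s"
  shows "q (J h x - h *\<^sub>R y) \<le> c"
proof -
  note i = has_bochner_integral_Icc[OF h, unfolded has_bochner_integral_iff]
  note j = g[unfolded has_bochner_integral_iff]
  have "q (opk (indicator {0..h}) x - (\<integral>s. indicator {0..h} s \<partial>lborel0) *\<^sub>R y) \<le> (\<integral>s. indicator {0..h} s * g s \<partial>lborel0)"
    using i j le by (intro q_opk_diff) (auto split: split_indicator)
  then show ?thesis using i j by (simp add: J_def)
qed

lemma J_tendsto: "((\<lambda>h. (1 / h) *\<^sub>R J h x) \<longlongrightarrow> x) (at_right 0)"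
proof (rule tendstoI)
  fix e :: real assume e: "e > 0"
  have "((\<lambda>s. q (T s x - x)) \<longlongrightarrow> q (x - x)) (at_right 0)"
    by (intro tendsto_q tendsto_diff strongly_continuous tendsto_const)
  then have "\<forall>\<^sub>F s in at_right 0. q (T s x - x) < e / 2" using e by (intro order_tendstoD(2)) auto
  then obtain b where b: "b > 0" "\<And>s. 0 < s \<Longrightarrow> s < b \<Longrightarrow> q (T s x - x) < e / 2"
    unfolding eventually_at_right_field by blast
  have "dist ((1 / h) *\<^sub>R J h x) x < e" if h: "0 < h" "h < b" for h
  proof -
    have "q (J h x - h *\<^sub>R x) \<le> h * (e / 2)"
    proof (rule q_J_diff)
      show "has_bochner_integral lborel0 (\<lambda>s. indicator {0..h} s * (e / 2)) (h * (e / 2))"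
        using h by (intro has_bochner_integral_mult_left has_bochner_integral_Icc) auto
      show "q (T s x - x) \<le> e / 2" if "0 \<le> s" "s \<le> h" for s
        using b(2)[of s] that h e by (cases "s = 0") auto
    qed (use h in auto)
    then have le: "norm (J h x - h *\<^sub>R x) \<le> h * (e / 2)" using norm_le_q order.trans by blast
    have "(1 / h) *\<^sub>R J h x - x = (1 / h) *\<^sub>R (J h x - h *\<^sub>R x)" using h by (simp add: scaleR_diff_right)
    then have "dist ((1 / h) *\<^sub>R J h x) x = (1 / h) * norm (J h x - h *\<^sub>R x)"
      using h by (simp only: dist_norm norm_scaleR) simp
    also have "\<dots> \<le> (1 / h) * (h * (e / 2))" using h le by (intro mult_left_mono) auto
    also have "\<dots> < e" using h e by simp
    finally show ?thesis .
  qed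
  then show "\<forall>\<^sub>F h in at_right 0. dist ((1 / h) *\<^sub>R J h x) x < e"
    unfolding eventually_at_right_field using b(1) by blast
qed

end

section \<open>The unbounded generator: domain, resolvent, Taylor remainders\<close>

locale semigroup_generator = bounded_c0_semigroup T
  for T :: "real \<Rightarrow> 'a::complex_banach \<Rightarrow>\<^sub>L 'a" +
  fixes D :: "'a set" and A :: "'a \<Rightarrow> 'a"
  assumes generator: "is_generator T D (\<lambda>y. - A y)"
begin

lemma generator_tendsto: "x \<in> D \<Longrightarrow> ((\<lambda>h. (1 / h) *\<^sub>R (T h x - x)) \<longlongrightarrow> - A x) (at_right 0)"
  using generator unfolding is_generator_def by blast

lemma
  assumes "((\<lambda>h. (1 / h) *\<^sub>R (T h x - x)) \<longlongrightarrow> - y) (at_right 0)"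
  shows generator_domI: "x \<in> D" and generator_eqI: "A x = y"
proof -
  show "x \<in> D" using generator assms unfolding is_generator_def by blast
  then show "A x = y" using tendsto_unique[OF _ generator_tendsto assms] by simp
qed

lemma
  assumes "x \<in> D" and B: "bounded_linear B" and comm: "\<And>s y. s \<ge> 0 \<Longrightarrow> B (T s y) = T s (B y)"
  shows commuting_dom: "B x \<in> D" and commuting_eq: "A (B x) = B (A x)"
proof -
  have "((\<lambda>h. B ((1 / h) *\<^sub>R (T h x - x))) \<longlongrightarrow> B (- A x)) (at_right 0)"
    by (rule bounded_linear.tendsto[OF B generator_tendsto[OF assms(1)]])
  then have "((\<lambda>h. B ((1 / h) *\<^sub>R (T h x - x))) \<longlongrightarrow> - B (A x)) (at_right 0)"
    by (simp add: linear_simps[OF B])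
  then have *: "((\<lambda>h. (1 / h) *\<^sub>R (T h (B x) - B x)) \<longlongrightarrow> - B (A x)) (at_right 0)"
  proof (rule Lim_transform_eventually)
    show "\<forall>\<^sub>F h in at_right 0. B ((1 / h) *\<^sub>R (T h x - x)) = (1 / h) *\<^sub>R (T h (B x) - B x)"
      using eventually_at_right_less[of 0] by eventually_elim (simp add: linear_simps[OF B] comm)
  qed
  show "B x \<in> D" by (rule generator_domI[OF *])
  show "A (B x) = B (A x)" by (rule generator_eqI[OF *])
qed

lemma
  assumes "rep B L" "x \<in> D"
  shows rep_dom: "B x \<in> D" and rep_A: "A (B x) = B (A x)"
  by (rule commuting_dom[OF assms(2) rep_bounded_linear[OF assms(1)] rep_commute[OF assms(1) rep_T]], assumption)
    (rule commuting_eq[OF assms(2) rep_bounded_linear[OF assms(1)] rep_commute[OF assms(1) rep_T]], assumption)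

lemma
  assumes "x \<in> D" "y \<in> D"
  shows add_dom: "x + y \<in> D" and A_add: "A (x + y) = A x + A y"
proof -
  have "((\<lambda>h. (1 / h) *\<^sub>R (T h x - x) + (1 / h) *\<^sub>R (T h y - y)) \<longlongrightarrow> - A x + - A y) (at_right 0)"
    by (intro tendsto_add generator_tendsto assms)
  then have *: "((\<lambda>h. (1 / h) *\<^sub>R (T h (x + y) - (x + y))) \<longlongrightarrow> - (A x + A y)) (at_right 0)"
    by (simp add: algebra_simps blinfun.add_right)
  show "x + y \<in> D" by (rule generator_domI[OF *])
  show "A (x + y) = A x + A y" by (rule generator_eqI[OF *])
qed

lemma
  assumes "x \<in> D"
  shows scaleR_dom: "c *\<^sub>R x \<in> D" and A_scaleR: "A (c *\<^sub>R x) = c *\<^sub>R A x"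
proof -
  have "((\<lambda>h. c *\<^sub>R ((1 / h) *\<^sub>R (T h x - x))) \<longlongrightarrow> c *\<^sub>R (- A x)) (at_right 0)"
    by (intro tendsto_scaleR tendsto_const generator_tendsto assms)
  then have *: "((\<lambda>h. (1 / h) *\<^sub>R (T h (c *\<^sub>R x) - c *\<^sub>R x)) \<longlongrightarrow> - (c *\<^sub>R A x)) (at_right 0)"
    by (simp add: scaleR_diff_right blinfun.scaleR_right mult.commute)
  show "c *\<^sub>R x \<in> D" by (rule generator_domI[OF *])
  show "A (c *\<^sub>R x) = c *\<^sub>R A x" by (rule generator_eqI[OF *])
qed

lemma
  assumes "x \<in> D" "y \<in> D"
  shows diff_dom: "x - y \<in> D" and A_diff: "A (x - y) = A x - A y"
  using add_dom[OF assms(1) scaleR_dom[OF assms(2), of "- 1"]]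
    A_add[OF assms(1) scaleR_dom[OF assms(2), of "- 1"]] A_scaleR[OF assms(2), of "- 1"] by simp_all

text \<open>After division by r and r \<rightarrow> 0 the right-hand side tends to - w by
  \<open>J_tendsto\<close>, so the difference quotient of \<open>u\<close> converges. As both sides
  of the hypothesis are bounded operators in the applications, membership in \<open>D\<close> can be
  proved by comparing Laplace transforms.\<close>

lemma
  assumes "\<And>r. r > 0 \<Longrightarrow> T r u - u = - J r w"
  shows J_domI: "u \<in> D" and J_eqI: "A u = w"
proof -
  have "((\<lambda>h. - ((1 / h) *\<^sub>R J h w)) \<longlongrightarrow> - w) (at_right 0)" by (intro tendsto_minus J_tendsto)
  then have *: "((\<lambda>h. (1 / h) *\<^sub>R (T h u - u)) \<longlongrightarrow> - w) (at_right 0)"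
  proof (rule Lim_transform_eventually)
    show "\<forall>\<^sub>F h in at_right 0. - ((1 / h) *\<^sub>R J h w) = (1 / h) *\<^sub>R (T h u - u)"
      using eventually_at_right_less[of 0] by eventually_elim (simp add: assms)
  qed
  show "u \<in> D" by (rule generator_domI[OF *])
  show "A u = w" by (rule generator_eqI[OF *])
qed

text \<open>On the level of symbols, 1 - \<epsilon>/(z + \<epsilon>) = z/(z + \<epsilon>), and the
  factor z cancels the denominator in the symbol of \<open>J r\<close>.\<close>

lemma J_R:
  assumes e: "\<epsilon> > 0" and r: "r > 0"
  shows "T r (R \<epsilon> x) - R \<epsilon> x = - J r (x - \<epsilon> *\<^sub>R R \<epsilon> x)"
proof -
  have "rep (\<lambda>x. 1 *\<^sub>R T r (R \<epsilon> x) + (- 1) *\<^sub>R R \<epsilon> x) (\<lambda>z. 1 * (exp (- z * r) * (1 / (z + \<epsilon>))) + (- 1) * (1 / (z + \<epsilon>)))"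
    by (intro rep_lincomb rep_compose rep_T rep_R) (use assms in auto)
  moreover have "rep (\<lambda>x. J r (( - 1) *\<^sub>R x + \<epsilon> *\<^sub>R R \<epsilon> x)) (\<lambda>z. (1 - exp (- z * r)) / z * ((- 1) * 1 + \<epsilon> * (1 / (z + \<epsilon>))))"
    by (intro rep_lincomb rep_compose rep_J rep_R rep_id) (use assms in auto)
  ultimately have "1 *\<^sub>R T r (R \<epsilon> x) + (- 1) *\<^sub>R R \<epsilon> x = J r (( - 1) *\<^sub>R x + \<epsilon> *\<^sub>R R \<epsilon> x)"
  proof (rule rep_unique)
    fix z :: real assume z: "z > 0"
    have "(- 1) * 1 + \<epsilon> * (1 / (z + \<epsilon>)) = - (z / (z + \<epsilon>))" using z e by (simp add: field_simps)
    moreover have "(1 - exp (- z * r)) / z * - (z / (z + \<epsilon>)) = (exp (- z * r) - 1) / (z + \<epsilon>)"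
      using z by simp (simp only: minus_divide_left minus_diff_eq)
    ultimately show "1 * (exp (- z * r) * (1 / (z + \<epsilon>))) + (- 1) * (1 / (z + \<epsilon>)) = (1 - exp (- z * r)) / z * ((- 1) * 1 + \<epsilon> * (1 / (z + \<epsilon>)))"
      by (simp add: diff_divide_distrib)
  qed
  also have "J r (( - 1) *\<^sub>R x + \<epsilon> *\<^sub>R R \<epsilon> x) = - J r (x - \<epsilon> *\<^sub>R R \<epsilon> x)"
    using rep_bounded_linear[OF rep_J[of r]] r by (simp add: linear_simps)
  finally show ?thesis by simp
qed

lemma
  assumes "\<epsilon> > 0"
  shows R_dom: "R \<epsilon> x \<in> D" and A_R: "A (R \<epsilon> x) = x - \<epsilon> *\<^sub>R R \<epsilon> x"
  by (rule J_domI[OF J_R[OF assms]], assumption) (rule J_eqI[OF J_R[OF assms]], assumption)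

text \<open>Both sides have the symbol - (1 - exp(- z r)) (1 - exp(- z h)) / z, which is symmetric
  in r and h.\<close>

lemma J_T_commute:
  assumes h: "h \<ge> 0" and r: "r > 0"
  shows "T r (J h x) - J h x = - J r (x - T h x)"
proof -
  have "rep (\<lambda>x. 1 *\<^sub>R T r (J h x) + (- 1) *\<^sub>R J h x) (\<lambda>z. 1 * (exp (- z * r) * ((1 - exp (- z * h)) / z)) + (- 1) * ((1 - exp (- z * h)) / z))"
    by (intro rep_lincomb rep_compose rep_T rep_J) (use assms in auto)
  moreover have "rep (\<lambda>x. J r (( - 1) *\<^sub>R x + 1 *\<^sub>R T h x)) (\<lambda>z. (1 - exp (- z * r)) / z * ((- 1) * 1 + 1 * exp (- z * h)))"
    by (intro rep_lincomb rep_compose rep_J rep_T rep_id) (use assms in auto)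
  ultimately have "1 *\<^sub>R T r (J h x) + (- 1) *\<^sub>R J h x = J r (( - 1) *\<^sub>R x + 1 *\<^sub>R T h x)"
  proof (rule rep_unique)
    fix z :: real assume "z > 0"
    then have "1 * (a * ((1 - b) / z)) + (- 1) * ((1 - b) / z) = (1 - a) / z * ((- 1) * 1 + 1 * b)" for a b
      by (simp add: field_simps)
    then show "1 * (exp (- z * r) * ((1 - exp (- z * h)) / z)) + (- 1) * ((1 - exp (- z * h)) / z)
      = (1 - exp (- z * r)) / z * ((- 1) * 1 + 1 * exp (- z * h))" .
  qed
  also have "J r (( - 1) *\<^sub>R x + 1 *\<^sub>R T h x) = - J r (x - T h x)"
    using rep_bounded_linear[OF rep_J[of r]] r by (simp add: linear_simps)
  finally show ?thesis by simp
qed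

lemma
  assumes "h \<ge> 0"
  shows J_dom: "J h x \<in> D" and A_J: "A (J h x) = x - T h x"
  by (rule J_domI[OF J_T_commute[OF assms]], assumption) (rule J_eqI[OF J_T_commute[OF assms]], assumption)

lemma J_A: "h \<ge> 0 \<Longrightarrow> x \<in> D \<Longrightarrow> J h (A x) = x - T h x"
  by (rule trans[OF rep_A[OF rep_J, symmetric] A_J])

lemma R_A: "\<epsilon> > 0 \<Longrightarrow> x \<in> D \<Longrightarrow> R \<epsilon> (A x) = x - \<epsilon> *\<^sub>R R \<epsilon> x"
  by (rule trans[OF rep_A[OF rep_R, symmetric] A_R])

lemma R_inj:
  assumes "\<epsilon> > 0" "R \<epsilon> x = R \<epsilon> y"
  shows "x = y"
proof -
  have "x - \<epsilon> *\<^sub>R R \<epsilon> y = A (R \<epsilon> y)" using A_R[OF assms(1), of x] by (simp only: assms(2))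
  also have "\<dots> = y - \<epsilon> *\<^sub>R R \<epsilon> y" by (rule A_R[OF assms(1)])
  finally show ?thesis by simp
qed

text \<open>Since a + b A = b (a/b + A), the resolvent at a/b solves the equation by
  \<open>A_R\<close>; by \<open>R_A\<close> it is also a left inverse on \<open>D\<close>, which
  gives the injectivity that \<open>inv_into\<close> requires.\<close>

lemma op_inv_eq:
  assumes a: "a > 0" and b: "b > 0"
  shows "op_inv a b D A y = (1 / b) *\<^sub>R R (a / b) y"
  unfolding op_inv_def
proof (rule inv_into_f_eq)
  have ab: "a / b > 0" using a b by simp
  note lin = linear_simps[OF rep_bounded_linear[OF rep_R[OF ab]]]
  show "(1 / b) *\<^sub>R R (a / b) y \<in> D" by (intro scaleR_dom R_dom ab)
  show "a *\<^sub>R ((1 / b) *\<^sub>R R (a / b) y) + b *\<^sub>R A ((1 / b) *\<^sub>R R (a / b) y) = y"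
    using b by (simp add: A_scaleR[OF R_dom[OF ab]] A_R[OF ab] scaleR_diff_right)
  show "inj_on (\<lambda>x. a *\<^sub>R x + b *\<^sub>R A x) D"
  proof (rule inj_on_inverseI)
    fix x assume "x \<in> D"
    then have "R (a / b) (a *\<^sub>R x + b *\<^sub>R A x) = b *\<^sub>R x"
      using b by (simp add: lin R_A[OF ab] scaleR_diff_right)
    then show "(1 / b) *\<^sub>R R (a / b) (a *\<^sub>R x + b *\<^sub>R A x) = x" using b by simp
  qed
qed

lemma q_J_le:
  assumes h: "h \<ge> 0"
  shows "q (J h x) \<le> h * q x"
proof -
  have "q (J h x - h *\<^sub>R 0) \<le> h * q x"
    by (rule q_J_diff[OF h has_bochner_integral_mult_left[OF has_bochner_integral_Icc[OF h]]]) (simp add: q_T)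
  then show ?thesis by simp
qed

lemma q_T_diff_le:
  assumes "x \<in> D" "s \<ge> 0"
  shows "q (T s x - x) \<le> s * q (A x)"
  using q_J_le[OF assms(2), of "A x"] q_minus[of "T s x - x"] by (simp add: J_A[OF assms(2,1)])

text \<open>First-order Taylor remainder at the left endpoint: \<open>T s x\<close> differs from x
  by at most s \<open>q (A x)\<close>, and integrating s over \<open>[0,h]\<close> gives h^2/2. For
  x replaced by \<open>A x\<close> it estimates x - \<open>T h x\<close> - h
  \<open>A x\<close>.\<close>

lemma q_J_diff_self:
  assumes "x \<in> D" and h: "h \<ge> 0"
  shows "q (J h x - h *\<^sub>R x) \<le> h\<^sup>2 / 2 * q (A x)"
proof (rule q_J_diff[OF h])
  have "has_bochner_integral lborel0 (\<lambda>s. indicator {0..h} s * s) (h\<^sup>2 / 2 - 0\<^sup>2 / 2)"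
    using h by (intro has_bochner_integral_Icc0[where F = "\<lambda>s. s\<^sup>2 / 2"]) (auto intro!: derivative_eq_intros)
  then have "has_bochner_integral lborel0 (\<lambda>s. indicator {0..h} s * s * q (A x)) ((h\<^sup>2 / 2 - 0\<^sup>2 / 2) * q (A x))"
    by (rule has_bochner_integral_mult_left)
  then show "has_bochner_integral lborel0 (\<lambda>s. indicator {0..h} s * (s * q (A x))) (h\<^sup>2 / 2 * q (A x))"
    by (simp add: mult.assoc)
qed (use assms q_T_diff_le in auto)

text \<open>The same remainder taken at the right endpoint, with h - s in place of s; this is the
  form that an implicit Euler step produces.\<close>

lemma q_J_diff_T:
  assumes "x \<in> D" and h: "h \<ge> 0"
  shows "q (J h x - h *\<^sub>R T h x) \<le> h\<^sup>2 / 2 * q (A x)"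
proof (rule q_J_diff[OF h])
  have "has_bochner_integral lborel0 (\<lambda>s. indicator {0..h} s * (h - s)) ((h * h - h\<^sup>2 / 2) - (h * 0 - 0\<^sup>2 / 2))"
    using h by (intro has_bochner_integral_Icc0[where F = "\<lambda>s. h * s - s\<^sup>2 / 2"]) (auto intro!: derivative_eq_intros)
  then have "has_bochner_integral lborel0 (\<lambda>s. indicator {0..h} s * (h - s) * q (A x)) (((h * h - h\<^sup>2 / 2) - (h * 0 - 0\<^sup>2 / 2)) * q (A x))"
    by (rule has_bochner_integral_mult_left)
  then show "has_bochner_integral lborel0 (\<lambda>s. indicator {0..h} s * ((h - s) * q (A x))) (h\<^sup>2 / 2 * q (A x))"
    by (simp add: mult.assoc power2_eq_square)
  fix s assume s: "0 \<le> s" "s \<le> h"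
  have "T h x - T s x = T s (T (h - s) x - x)" using s by (simp add: blinfun.diff_right T_T)
  then have "q (T h x - T s x) \<le> q (T (h - s) x - x)" using q_T[OF s(1)] by metis
  also have "\<dots> \<le> (h - s) * q (A x)" using s assms by (intro q_T_diff_le) auto
  finally show "q (T s x - T h x) \<le> (h - s) * q (A x)" using q_minus[of "T s x - T h x"] by simp
qed

end

subsection \<open>Interpolation between powers of the generator\<close>

context semigroup_generator
begin

text \<open>\<open>v_op T a\<close> is the power - a of 1 + A. Multiplying it by the power a - 3
  gives the third power of the injective operator \<open>R 1\<close>; the exponent 3 keeps 3 - a
  positive for all a \<le> 2.\<close>

lemma v_op_inj:
  assumes a: "0 < a" "a \<le> 2" and eq: "v_op T a x = v_op T a y"
  shows "x = y"
proof -
  have *: "v_op T (3 - a) (v_op T a w) = R 1 (R 1 (R 1 w))" for w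
  proof (rule rep_unique[where B = "\<lambda>w. v_op T (3 - a) (v_op T a w)" and C = "\<lambda>w. R 1 (R 1 (R 1 w))"])
    show "rep (\<lambda>w. v_op T (3 - a) (v_op T a w)) (\<lambda>z. (1 + z) powr - (3 - a) * (1 + z) powr - a)"
      by (intro rep_compose rep_v_op) (use a in auto)
    show "rep (\<lambda>w. R 1 (R 1 (R 1 w))) (\<lambda>z. 1 / (z + 1) * (1 / (z + 1) * (1 / (z + 1))))"
      by (intro rep_compose rep_R) auto
    fix z :: real assume z: "z > 0"
    have "(1 + z) powr - (3 - a) * (1 + z) powr - a = (1 + z) powr - 3"
      by (simp add: powr_add[symmetric])
    also have "\<dots> = 1 / (1 + z) ^ 3" using z by (simp add: powr_minus_divide)
    finally show "(1 + z) powr - (3 - a) * (1 + z) powr - a = 1 / (z + 1) * (1 / (z + 1) * (1 / (z + 1)))"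
      by (simp add: power3_eq_cube add.commute)
  qed
  have "R 1 (R 1 (R 1 x)) = R 1 (R 1 (R 1 y))"
    unfolding *[symmetric] eq ..
  then show ?thesis by (rule R_inj[OF zero_less_one R_inj[OF zero_less_one R_inj[OF zero_less_one]]])
qed

text \<open>The symbol \<open>z\<^sup>1\<^sup>-\<^sup>b / (z + \<epsilon>)\<close> factors as \<open>(z + \<epsilon>)\<^sup>-\<^sup>b \<cdot> (z / (z + \<epsilon>))\<^sup>1\<^sup>-\<^sup>b\<close>. The measures of the two
  factors have total mass \<open>\<epsilon>\<^sup>-\<^sup>b\<close> and at most \<open>2\<close>.\<close>

lemma ex_regularizer:
  assumes b: "0 < b" "b \<le> 1" and e: "\<epsilon> > 0"
  obtains B where "rep B (\<lambda>z. (\<epsilon> + z) powr - b * (z / (z + \<epsilon>)) powr (1 - b))"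
    "\<And>x. q (B x) \<le> 2 * \<epsilon> powr - b * q x"
proof -
  obtain \<kappa> where \<kappa>: "integrable lborel0 \<kappa>"
    "(\<integral>s. \<bar>\<kappa> s\<bar> \<partial>lborel0) \<le> (\<Sum>k. \<bar>1 - b gchoose Suc k\<bar>)"
    "\<And>z. z > 0 \<Longrightarrow> (\<integral>s. \<kappa> s * exp (- z * s) \<partial>lborel0) = (z / (z + \<epsilon>)) powr (1 - b) - 1"
    using binomial_kernel[of "1 - b" \<epsilon>] b e by auto
  have k1: "(\<integral>s. \<bar>\<kappa> s\<bar> \<partial>lborel0) \<le> 1"
    using \<kappa>(2) suminf_abs_gbinomial_le_1[of "1 - b"] b by linarith
  define V where "V = opk (\<lambda>s. (1 / Gamma b) * (s powr (b - 1) * exp (- \<epsilon> * s)))"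
  show ?thesis
  \<comment> \<open>The summand \<open>1 *\<^sub>R x\<close> is the atom at 0 that is missing from
    \<kappa>; together they represent (z/(z + \<epsilon>)) powr (1 - b).\<close>
  proof (rule that[of "\<lambda>x. V (1 *\<^sub>R x + 1 *\<^sub>R opk \<kappa> x)"])
    have "rep (\<lambda>x. V (1 *\<^sub>R x + 1 *\<^sub>R opk \<kappa> x)) (\<lambda>z. (\<epsilon> + z) powr - b * (1 * 1 + 1 * ((z / (z + \<epsilon>)) powr (1 - b) - 1)))"
      unfolding V_def by (intro rep_compose rep_Gamma(1) rep_lincomb rep_id rep_opk \<kappa> b e)
    then show "rep (\<lambda>x. V (1 *\<^sub>R x + 1 *\<^sub>R opk \<kappa> x)) (\<lambda>z. (\<epsilon> + z) powr - b * (z / (z + \<epsilon>)) powr (1 - b))"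
      by simp
    fix x
    have "q (x + opk \<kappa> x) \<le> q x + q (opk \<kappa> x)" by (rule q_add)
    also have "q (opk \<kappa> x) \<le> 1 * q x"
      using q_opk[OF \<kappa>(1), of x] mult_right_mono[OF k1 q_nonneg[of x]] by linarith
    finally have le: "q (x + opk \<kappa> x) \<le> 2 * q x" by simp
    have "q (V (1 *\<^sub>R x + 1 *\<^sub>R opk \<kappa> x)) \<le> \<epsilon> powr - b * q (x + opk \<kappa> x)"
      using rep_Gamma(2)[OF b(1) e, of "x + opk \<kappa> x"] by (simp only: V_def scaleR_one)
    also have "\<dots> \<le> \<epsilon> powr - b * (2 * q x)" by (intro mult_left_mono le) simp
    finally show "q (V (1 *\<^sub>R x + 1 *\<^sub>R opk \<kappa> x)) \<le> 2 * \<epsilon> powr - b * q x" by (simp add: mult_ac)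
  qed
qed

text \<open>The hypothesis \<open>v\<close> says that y is the fractional power of x. Both sides are
  compared after applying the injective \<open>v_op T a\<close>, which permits replacing
  \<open>u_op T a x\<close> by \<open>v_op T a y\<close>. The symbols agree because the exponents of
  z add up to (1 - b) + a = j + 1 and those of 1/(z + \<epsilon>) to j + b + (1 - b) = j +
  1.\<close>

lemma regularizer_identity:
  assumes b: "0 < b" "b \<le> 1" and e: "\<epsilon> > 0" and j: "j \<le> 1" and a: "a = real j + b"
    and B: "rep B (\<lambda>z. (\<epsilon> + z) powr - b * (z / (z + \<epsilon>)) powr (1 - b))"
    and E: "\<And>x. E x = x - \<epsilon> *\<^sub>R R \<epsilon> x"
    and v: "v_op T a y = u_op T a x"
  shows "(E ^^ Suc j) x = (R \<epsilon> ^^ j) (B y)"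
proof -
  have a2: "0 < a" "a \<le> 2" using a b j by auto
  have repE': "rep E (\<lambda>z. z / (z + \<epsilon>))"
  proof (rule rep_cong[OF rep_lincomb[OF rep_id rep_R[OF e]]])
    show "E x = 1 *\<^sub>R x + (- \<epsilon>) *\<^sub>R R \<epsilon> x" for x by (simp add: E)
    show "z / (z + \<epsilon>) = 1 * 1 + (- \<epsilon>) * (1 / (z + \<epsilon>))" if "z > 0" for z
      using that e by (simp add: field_simps)
  qed
  have rep_funpow: "rep (C ^^ k) (\<lambda>z. L z ^ k)" if "rep C L" for C L k
  proof (induction k)
    case 0 then show ?case using rep_id by (simp add: id_def)
  next
    case (Suc k) then show ?case using rep_compose[OF that Suc] by (simp add: comp_def)
  qed
  have Rj: "rep (R \<epsilon> ^^ j) (\<lambda>z. (1 / (z + \<epsilon>)) ^ j)" by (rule rep_funpow[OF rep_R[OF e]])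
  have vE: "v_op T a ((E ^^ Suc j) w) = (R \<epsilon> ^^ j) (B (u_op T a w))" for w
  proof (rule rep_unique[where B = "\<lambda>w. v_op T a ((E ^^ Suc j) w)" and C = "\<lambda>w. (R \<epsilon> ^^ j) (B (u_op T a w))"])
    show "rep (\<lambda>w. v_op T a ((E ^^ Suc j) w)) (\<lambda>z. (1 + z) powr - a * (z / (z + \<epsilon>)) ^ Suc j)"
      by (intro rep_compose rep_v_op rep_funpow repE' a2)
    show "rep (\<lambda>w. (R \<epsilon> ^^ j) (B (u_op T a w)))
      (\<lambda>z. (1 / (z + \<epsilon>)) ^ j * ((\<epsilon> + z) powr - b * (z / (z + \<epsilon>)) powr (1 - b) * (z / (z + 1)) powr a))"
      using a2 by (intro rep_compose Rj B rep_u_op) auto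
    fix z :: real assume z: "z > 0"
    define p where "p = z + \<epsilon>"
    have p: "p > 0" using z e by (simp add: p_def)
    have "(1 / p) ^ j * (p powr - b * (z / p) powr (1 - b) * (z / (z + 1)) powr a)
        = (p powr - real j * p powr - b * p powr - (1 - b)) * (z powr (1 - b) * z powr a) * (1 + z) powr - a"
    proof -
      have "p powr - real j = 1 / p ^ j" using p by (simp add: powr_minus_divide powr_realpow)
      moreover have "(z / p) powr (1 - b) = z powr (1 - b) * p powr - (1 - b)"
        using z p by (simp only: powr_minus_divide) (simp add: powr_divide)
      moreover have "(z / (z + 1)) powr a = z powr a * (1 + z) powr - a"
        using z by (simp add: powr_divide powr_minus_divide add.commute)
      ultimately show ?thesis by (simp only: power_one_over mult_ac)
    qed
    also have "p powr - real j * p powr - b * p powr - (1 - b) = p powr - real (Suc j)"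
      unfolding powr_add[symmetric] by (rule arg_cong[where f = "(powr) p"]) simp
    also have "z powr (1 - b) * z powr a = z powr real (Suc j)"
      by (simp add: powr_add[symmetric] a)
    also have "p powr - real (Suc j) * z powr real (Suc j) = (z / p) ^ Suc j"
      using z p by (simp add: powr_minus_divide powr_realpow power_divide del: of_nat_Suc power_Suc)
    finally show "(1 + z) powr - a * (z / (z + \<epsilon>)) ^ Suc j =
      (1 / (z + \<epsilon>)) ^ j * ((\<epsilon> + z) powr - b * (z / (z + \<epsilon>)) powr (1 - b) * (z / (z + 1)) powr a)"
      by (simp add: p_def add.commute mult.commute)
  qed
  have vRB: "v_op T a ((R \<epsilon> ^^ j) (B y)) = (R \<epsilon> ^^ j) (B (v_op T a y))"
    by (rule rep_commute[OF rep_v_op[OF a2(1)] rep_compose[OF Rj B]])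
  show ?thesis
    by (rule v_op_inj[OF a2]) (simp only: vE vRB v)
qed

text \<open>With \<open>K = s\<^sup>2/2\<close>, Landau's step splits \<open>w\<close> into its average over the time interval \<open>[0,s]\<close> and the
  remainder, and \<open>\<epsilon> = 1/s\<close> balances the two summands of the interpolation.\<close>

lemma q_interpolation:
  assumes add: "\<And>v w. \<Delta> (v + w) = \<Delta> v + \<Delta> w"
    and le0: "\<And>w. q (\<Delta> w) \<le> 2 * q w"
    and le2: "\<And>w. w \<in> D \<Longrightarrow> A w \<in> D \<Longrightarrow> q (\<Delta> w) \<le> s\<^sup>2 / 2 * q (A (A w))"
    and s: "s > 0" and a: "0 < a" "a \<le> 2" and v: "v_op T a y = u_op T a x"
  shows "q (\<Delta> x) \<le> 8 * s powr a * q y"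
proof -
  \<comment> \<open>Balanced choice: \<open>le0\<close> on w - u and \<open>le2\<close> on the
    average u each contribute s \<open>q (A w)\<close>.\<close>
  have le1: "q (\<Delta> w) \<le> 2 * s * q (A w)" if w: "w \<in> D" for w
  proof -
    define u where "u = (1 / s) *\<^sub>R J s w"
    have s0: "s \<ge> 0" using s by simp
    have "w - u = (- 1 / s) *\<^sub>R (J s w - s *\<^sub>R w)" using s by (simp add: u_def scaleR_diff_right)
    then have "q (w - u) \<le> 1 / s * q (J s w - s *\<^sub>R w)" using q_scaleR[of "- 1 / s"] s by simp
    also have "\<dots> \<le> 1 / s * (s\<^sup>2 / 2 * q (A w))" using s by (intro mult_left_mono q_J_diff_self w) auto
    also have "\<dots> = s / 2 * q (A w)" using s by (simp add: power2_eq_square)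
    finally have 1: "q (w - u) \<le> s / 2 * q (A w)" .
    have uD: "u \<in> D" unfolding u_def by (intro scaleR_dom J_dom s0)
    have Au: "A u = (1 / s) *\<^sub>R (w - T s w)" by (simp add: u_def A_scaleR[OF J_dom[OF s0]] A_J[OF s0])
    have TwD: "T s w \<in> D" and ATw: "A (T s w) = T s (A w)"
      by (rule rep_dom[OF rep_T[OF s0] w], rule rep_A[OF rep_T[OF s0] w])
    have AuD: "A u \<in> D" unfolding Au by (intro scaleR_dom diff_dom w TwD)
    have "A (A u) = (1 / s) *\<^sub>R (A w - T s (A w))"
      unfolding Au by (simp add: A_scaleR[OF diff_dom[OF w TwD]] A_diff[OF w TwD] ATw)
    then have "q (A (A u)) \<le> 1 / s * q (A w - T s (A w))" using q_scaleR[of "1 / s"] s by simp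
    also have "\<dots> \<le> 1 / s * (2 * q (A w))"
      using s q_diff[of "A w" "T s (A w)"] q_T[OF s0, of "A w"] by (intro mult_left_mono) auto
    finally have "s\<^sup>2 / 2 * q (A (A u)) \<le> s\<^sup>2 / 2 * (1 / s * (2 * q (A w)))" by (intro mult_left_mono) auto
    also have "\<dots> = s * q (A w)" using s by (simp add: power2_eq_square)
    finally have 2: "q (\<Delta> u) \<le> s * q (A w)" using le2[OF uD AuD] by linarith
    have "q (\<Delta> w) \<le> q (\<Delta> (w - u)) + q (\<Delta> u)"
      using q_add[of "\<Delta> (w - u)" "\<Delta> u"] add[of "w - u" u] by simp
    also have "\<dots> \<le> 2 * (s / 2 * q (A w)) + s * q (A w)"
      using le0[of "w - u"] 1 2 by linarith
    finally show ?thesis by simp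
  qed
  \<comment> \<open>The integer part is chosen so that b lies in (0,1], hence b = 1 at both integer
    exponents.\<close>
  define j :: nat where "j = (if a \<le> 1 then 0 else 1)"
  define b where "b = a - real j"
  have b: "0 < b" "b \<le> 1" "a = real j + b" and j: "j \<le> 1" using a by (auto simp: b_def j_def)
  define \<epsilon> where "\<epsilon> = 1 / s"
  have e: "\<epsilon> > 0" using s by (simp add: \<epsilon>_def)
  obtain B where B: "rep B (\<lambda>z. (\<epsilon> + z) powr - b * (z / (z + \<epsilon>)) powr (1 - b))"
    "\<And>x. q (B x) \<le> 2 * \<epsilon> powr - b * q x" using ex_regularizer[OF b(1,2) e] by metis
  have By: "q (B y) \<le> 2 * s powr b * q y"
  proof -
    have "\<epsilon> powr - b = s powr b" using s by (simp add: \<epsilon>_def powr_minus_divide powr_divide)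
    then show ?thesis using B(2)[of y] by (simp only:)
  qed
  define E where "E x = x - \<epsilon> *\<^sub>R R \<epsilon> x" for x
  have id: "(E ^^ Suc j) x = (R \<epsilon> ^^ j) (B y)"
    by (rule regularizer_identity[OF b(1,2) e j b(3) B(1) E_def v])
  note Rlin = linear_simps[OF rep_bounded_linear[OF rep_R[OF e]]]
  have split: "q (\<Delta> x) \<le> q (\<Delta> (E x)) + q (\<Delta> (\<epsilon> *\<^sub>R R \<epsilon> x))"
    using q_add[of "\<Delta> (E x)" "\<Delta> (\<epsilon> *\<^sub>R R \<epsilon> x)"] add[of "E x" "\<epsilon> *\<^sub>R R \<epsilon> x"] by (simp add: E_def)
  have RxD: "\<epsilon> *\<^sub>R R \<epsilon> x \<in> D" by (intro scaleR_dom R_dom e)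
  have ARx: "A (\<epsilon> *\<^sub>R R \<epsilon> x) = \<epsilon> *\<^sub>R E x" by (simp add: A_scaleR[OF R_dom[OF e]] A_R[OF e] E_def)
  \<comment> \<open>For a \<le> 1 both summands contribute 2 \<open>q (B y)\<close>, in total 4; for
    a > 1 they contribute 2 s and s/2 times \<open>q (B y)\<close>. The factor 2 in
    \<open>By\<close> turns this into 8 and 5, and the constant 8 covers both cases.\<close>
  show ?thesis
  proof (cases "a \<le> 1")
    case True
    then have ab: "a = b" and "j = 0" by (auto simp: j_def b_def)
    then have Ex: "E x = B y" using id by simp
    have "q (\<Delta> (\<epsilon> *\<^sub>R R \<epsilon> x)) \<le> 2 * s * q (\<epsilon> *\<^sub>R B y)" using le1[OF RxD] by (simp only: ARx Ex)
    also have "\<dots> \<le> 2 * s * (\<epsilon> * q (B y))" using q_scaleR[of \<epsilon> "B y"] e s by (intro mult_left_mono) auto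
    also have "\<dots> = 2 * q (B y)" using s by (simp add: \<epsilon>_def)
    finally have "q (\<Delta> x) \<le> 4 * q (B y)" using split le0[of "B y"] by (simp add: Ex)
    also have "\<dots> \<le> 4 * (2 * s powr b * q y)" by (intro mult_left_mono By) simp
    finally show ?thesis by (simp add: ab)
  next
    case False
    then have "j = 1" by (simp add: j_def)
    then have EE: "E (E x) = R \<epsilon> (B y)" using id by simp
    \<comment> \<open>Here x \<in> D is not yet known. Expanding (1 - \<epsilon> R)^2 x and solving
      for x leaves only vectors in the range of the resolvent, the last one by
      \<open>EE\<close>.\<close>
    have "x = \<epsilon> *\<^sub>R R \<epsilon> x + \<epsilon> *\<^sub>R R \<epsilon> x - (\<epsilon> * \<epsilon>) *\<^sub>R R \<epsilon> (R \<epsilon> x) + E (E x)"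
      by (simp add: E_def Rlin algebra_simps)
    moreover have "\<epsilon> *\<^sub>R R \<epsilon> x + \<epsilon> *\<^sub>R R \<epsilon> x - (\<epsilon> * \<epsilon>) *\<^sub>R R \<epsilon> (R \<epsilon> x) + E (E x) \<in> D"
      unfolding EE by (intro add_dom diff_dom scaleR_dom R_dom e)
    ultimately have xD: "x \<in> D" by (simp only:)
    have ExR: "E x = R \<epsilon> (A x)" unfolding E_def R_A[OF e xD] ..
    \<comment> \<open>Now that \<open>A x\<close> makes sense, one resolvent can be cancelled from
      \<open>EE\<close>; the result \<open>E (A x) = B y\<close> provides both
      \<open>A (E x)\<close> and the second application of A to \<epsilon>
      \<open>R \<epsilon> x\<close>.\<close>
    have "R \<epsilon> (E (A x)) = E (R \<epsilon> (A x))" by (simp add: E_def Rlin)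
    also have "\<dots> = R \<epsilon> (B y)" by (simp only: ExR[symmetric] EE)
    finally have EA: "E (A x) = B y" by (rule R_inj[OF e])
    have ExD: "E x \<in> D" unfolding ExR by (rule R_dom[OF e])
    have "A (E x) = A x - \<epsilon> *\<^sub>R R \<epsilon> (A x)" unfolding ExR by (rule A_R[OF e])
    then have AE: "A (E x) = B y" by (simp only: EA[symmetric] E_def)
    have 1: "q (\<Delta> (E x)) \<le> 2 * s * q (B y)" using le1[OF ExD] by (simp only: AE)
    have "A (\<epsilon> *\<^sub>R R \<epsilon> x) \<in> D" unfolding ARx by (rule scaleR_dom[OF ExD])
    moreover have "A (A (\<epsilon> *\<^sub>R R \<epsilon> x)) = \<epsilon> *\<^sub>R B y" unfolding ARx A_scaleR[OF ExD] AE ..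
    ultimately have "q (\<Delta> (\<epsilon> *\<^sub>R R \<epsilon> x)) \<le> s\<^sup>2 / 2 * q (\<epsilon> *\<^sub>R B y)" using le2[OF RxD] by simp
    also have "\<dots> \<le> s\<^sup>2 / 2 * (\<epsilon> * q (B y))" using q_scaleR[of \<epsilon> "B y"] e by (intro mult_left_mono) auto
    also have "\<dots> = s / 2 * q (B y)" using s by (simp add: \<epsilon>_def power2_eq_square)
    finally have "q (\<Delta> x) \<le> 5 / 2 * s * q (B y)" using split 1 by simp
    also have "\<dots> \<le> 5 / 2 * s * (2 * s powr b * q y)" using By s by (intro mult_left_mono) auto
    also have "\<dots> = 5 * (s * s powr b) * q y" by simp
    also have "s * s powr b = s powr a" using s by (simp add: powr_mult_base b(3) \<open>j = 1\<close>)
    also have "5 * s powr a * q y \<le> 8 * s powr a * q y"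
      using q_nonneg[of y] by (intro mult_right_mono) auto
    finally show ?thesis .
  qed
qed

end

subsection \<open>Exponentials of bounded operators\<close>

lemma norm_blinfun_funpow_le:
  fixes C :: "'a::real_normed_vector \<Rightarrow>\<^sub>L 'a"
  shows "norm ((blinfun_apply C ^^ k) x) \<le> norm C ^ k * norm x"
proof (induction k)
  case (Suc k)
  have "norm (C ((blinfun_apply C ^^ k) x)) \<le> norm C * norm ((blinfun_apply C ^^ k) x)" by (rule norm_blinfun)
  also have "\<dots> \<le> norm C * (norm C ^ k * norm x)" by (intro mult_left_mono Suc) simp
  finally show ?case by (simp add: mult.assoc)
qed simp

lemma
  fixes C :: "'a::banach \<Rightarrow>\<^sub>L 'a"
  shows op_exp_apply: "op_exp C x = (\<Sum>k. (1 / fact k) *\<^sub>R (blinfun_apply C ^^ k) x)" (is ?eq)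
    and summable_op_exp: "summable (\<lambda>k. (1 / fact k) *\<^sub>R (blinfun_apply C ^^ k) x)" (is ?sum)
proof -
  define P where "P k = ((o\<^sub>L) C ^^ k) id_blinfun" for k
  have P: "P k y = (blinfun_apply C ^^ k) y" for k y
    unfolding P_def by (induction k) auto
  have "summable (\<lambda>k. (1 / fact k) *\<^sub>R P k)"
  proof (rule summable_comparison_test')
    show "summable (\<lambda>k. inverse (fact k) * norm C ^ k)" by (rule summable_exp)
    fix k
    have "norm (P k) \<le> norm C ^ k"
      by (rule norm_blinfun_bound) (simp_all add: P norm_blinfun_funpow_le)
    then have "inverse (fact k) * norm (P k) \<le> inverse (fact k) * norm C ^ k"
      by (intro mult_left_mono) auto
    then show "norm ((1 / fact k) *\<^sub>R P k) \<le> inverse (fact k) * norm C ^ k"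
      by (simp add: inverse_eq_divide)
  qed
  then have *: "(\<lambda>k. ((1 / fact k) *\<^sub>R P k) x) sums (op_exp C x)"
    unfolding op_exp_def P_def[symmetric]
    by (intro bounded_linear.sums[OF blinfun.bounded_linear_left] summable_sums)
  then have "(\<lambda>k. (1 / fact k) *\<^sub>R (blinfun_apply C ^^ k) x) sums (op_exp C x)"
    by (simp add: blinfun.scaleR_left P)
  then show ?eq ?sum by (auto simp: sums_iff)
qed

lemma binomial_operator:
  fixes C :: "'a::real_normed_vector \<Rightarrow>\<^sub>L 'a"
  shows "((\<lambda>y. y + c *\<^sub>R C y) ^^ N) x = (\<Sum>k\<le>N. (real (N choose k) * c ^ k) *\<^sub>R (blinfun_apply C ^^ k) x)"
proof (induction N)
  case (Suc N)
  let ?p = "\<lambda>N k. (real (N choose k) * c ^ k) *\<^sub>R (blinfun_apply C ^^ k) x"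
  have "((\<lambda>y. y + c *\<^sub>R C y) ^^ Suc N) x = (\<Sum>k\<le>N. ?p N k) + c *\<^sub>R C (\<Sum>k\<le>N. ?p N k)"
    by (simp add: Suc)
  also have "c *\<^sub>R C (\<Sum>k\<le>N. ?p N k) = (\<Sum>k\<le>N. (real (N choose k) * c ^ Suc k) *\<^sub>R (blinfun_apply C ^^ Suc k) x)"
    by (simp add: blinfun.sum_right blinfun.scaleR_right scaleR_sum_right mult_ac)
  also have "(\<Sum>k\<le>N. ?p N k) = (\<Sum>k\<le>Suc N. ?p N k)" by simp
  also have "\<dots> = x + (\<Sum>k\<le>N. ?p N (Suc k))" by (subst sum.atMost_Suc_shift) simp
  also have "\<dots> + (\<Sum>k\<le>N. (real (N choose k) * c ^ Suc k) *\<^sub>R (blinfun_apply C ^^ Suc k) x) = x + (\<Sum>k\<le>N. ?p (Suc N) (Suc k))"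
    by (simp add: sum.distrib[symmetric] scaleR_left_distrib distrib_right add.assoc add.commute del: funpow.simps power_Suc)
  also have "\<dots> = (\<Sum>k\<le>Suc N. ?p (Suc N) k)" by (subst sum.atMost_Suc_shift) simp
  finally show ?case .
qed simp

lemma choose_over_power:
  assumes "N > 0"
  shows "real (N choose k) * (1 / real N) ^ k = (\<Prod>i<k. 1 - real i / real N) / fact k"
proof -
  have "real (N choose k) * (1 / real N) ^ k = (\<Prod>i<k. real N - real i) / fact k * (\<Prod>i<k. 1 / real N)"
    by (simp add: binomial_gbinomial gbinomial_prod_rev atLeast0LessThan)
  also have "\<dots> = (\<Prod>i<k. (real N - real i) * (1 / real N)) / fact k" by (simp only: prod.distrib) simp
  also have "(\<Prod>i<k. (real N - real i) * (1 / real N)) = (\<Prod>i<k. 1 - real i / real N)"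
    using assms by (intro prod.cong) (auto simp: field_simps)
  finally show ?thesis .
qed

text \<open>Tannery's theorem for the coefficients: by \<open>choose_over_power\<close> those of the
  N-th power lie between 0 and 1/k! and converge to 1/k!, so the differences \<open>d k N\<close>
  are dominated by the exponential series of \<open>norm C\<close>.\<close>

lemma op_exp_LIMSEQ:
  fixes C :: "'a::banach \<Rightarrow>\<^sub>L 'a"
  shows "(\<lambda>N. ((\<lambda>y. y + (1 / real N) *\<^sub>R C y) ^^ N) x) \<longlonglongrightarrow> op_exp C x"
proof -
  define d where "d k N = (1 / fact k - real (N choose k) * (1 / real N) ^ k) * norm C ^ k" for k N
  have bnd: "0 \<le> real (N choose k) * (1 / real N) ^ k \<and> real (N choose k) * (1 / real N) ^ k \<le> 1 / fact k" if N: "N > 0" for k N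
  proof (cases "k \<le> N")
    case True
    have "(\<Prod>i<k. 1 - real i / real N) \<le> 1" using True N by (intro prod_le_1) (auto simp: field_simps)
    then show ?thesis unfolding choose_over_power[OF N] by (simp add: divide_right_mono choose_over_power[OF N, symmetric])
      (metis choose_over_power[OF N] divide_right_mono fact_ge_zero)
  qed (simp add: binomial_eq_0)
  have d_bnd: "0 \<le> d k N \<and> d k N \<le> inverse (fact k) * norm C ^ k" if "N > 0" for k N
    unfolding d_def inverse_eq_divide
    using bnd[OF that, of k] by (intro conjI mult_right_mono mult_nonneg_nonneg) auto
  have sum_exp: "summable (\<lambda>k. inverse (fact k) * norm C ^ k)" by (rule summable_exp)
  have "(\<lambda>N. \<Sum>k. d k N) \<longlonglongrightarrow> (\<Sum>k. 0)"
  proof (rule tannerys_theorem[THEN conjunct2, THEN conjunct2])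
    show "(\<lambda>N. d k N) \<longlonglongrightarrow> 0" for k
    proof -
      have "(\<lambda>N. \<Prod>i<k. 1 - real i * (1 / real N)) \<longlonglongrightarrow> (\<Prod>i<k. 1 - real i * 0)"
        by (intro tendsto_prod tendsto_diff tendsto_mult tendsto_const lim_1_over_n)
      then have "(\<lambda>N. (1 / fact k - (\<Prod>i<k. 1 - real i / real N) / fact k) * norm C ^ k) \<longlonglongrightarrow> (1 / fact k - 1 / fact k) * norm C ^ k"
        by (intro tendsto_mult tendsto_diff tendsto_divide tendsto_const) auto
      then have "(\<lambda>N. (1 / fact k - (\<Prod>i<k. 1 - real i / real N) / fact k) * norm C ^ k) \<longlonglongrightarrow> 0" by simp
      then show ?thesis
      proof (rule Lim_transform_eventually)
        show "\<forall>\<^sub>F N in sequentially. (1 / fact k - (\<Prod>i<k. 1 - real i / real N) / fact k) * norm C ^ k = d k N"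
          using eventually_gt_at_top[of 0] by eventually_elim (simp only: d_def choose_over_power)
      qed
    qed
    show "\<forall>\<^sub>F (k, N) in sequentially \<times>\<^sub>F sequentially. norm (d k N) \<le> inverse (fact k) * norm C ^ k"
      unfolding eventually_prod_filter
      using eventually_gt_at_top[of "0::nat"] d_bnd
      by (intro exI[of _ "\<lambda>k. True"] exI[of _ "\<lambda>N. N > 0"]) auto
  qed (use sum_exp in auto)
  then have lim: "(\<lambda>N. (\<Sum>k. d k N) * norm x) \<longlonglongrightarrow> 0" using tendsto_mult_left_zero by auto
  have close: "norm (((\<lambda>y. y + (1 / real N) *\<^sub>R C y) ^^ N) x - op_exp C x) \<le> (\<Sum>k. d k N) * norm x" if N: "N > 0" for N
  proof -
    let ?a = "\<lambda>k. (real (N choose k) * (1 / real N) ^ k) *\<^sub>R (blinfun_apply C ^^ k) x"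
    let ?b = "\<lambda>k. (1 / fact k) *\<^sub>R (blinfun_apply C ^^ k) x"
    have fin: "?a sums (\<Sum>k\<le>N. ?a k)" by (rule sums_finite) auto
    have "(\<lambda>k. ?b k - ?a k) sums (op_exp C x - (\<Sum>k\<le>N. ?a k))"
      unfolding op_exp_apply by (intro sums_diff fin summable_sums summable_op_exp)
    then have eq: "op_exp C x - ((\<lambda>y. y + (1 / real N) *\<^sub>R C y) ^^ N) x = (\<Sum>k. ?b k - ?a k)"
      unfolding binomial_operator by (rule sums_unique)
    have d_sum: "summable (\<lambda>k. d k N)"
      by (rule summable_comparison_test'[OF sum_exp]) (use d_bnd[OF N] in auto)
    have le: "norm (?b k - ?a k) \<le> d k N * norm x" for k
    proof -
      have "norm (?b k - ?a k) = (1 / fact k - real (N choose k) * (1 / real N) ^ k) * norm ((blinfun_apply C ^^ k) x)"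
        using bnd[OF N, of k] by (simp only: scaleR_left_diff_distrib[symmetric] norm_scaleR) simp
      also have "\<dots> \<le> (1 / fact k - real (N choose k) * (1 / real N) ^ k) * (norm C ^ k * norm x)"
        using bnd[OF N, of k] by (intro mult_left_mono norm_blinfun_funpow_le) auto
      finally show ?thesis by (simp only: d_def mult.assoc)
    qed
    have s1: "summable (\<lambda>k. norm (?b k - ?a k))"
      by (rule summable_comparison_test'[OF summable_mult2[OF d_sum, of "norm x"]]) (use le in auto)
    have "norm (\<Sum>k. ?b k - ?a k) \<le> (\<Sum>k. norm (?b k - ?a k))" by (rule summable_norm[OF s1])
    also have "\<dots> \<le> (\<Sum>k. d k N * norm x)" by (intro suminf_le le s1 summable_mult2 d_sum)
    also have "\<dots> = (\<Sum>k. d k N) * norm x" by (rule suminf_mult2[OF d_sum, symmetric])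
    finally show ?thesis unfolding eq[symmetric] by (simp only: norm_minus_commute)
  qed
  have "\<forall>\<^sub>F N in sequentially. norm (((\<lambda>y. y + (1 / real N) *\<^sub>R C y) ^^ N) x - op_exp C x) \<le> (\<Sum>k. d k N) * norm x"
    using eventually_gt_at_top[of 0] by (rule eventually_mono) (rule close)
  then show ?thesis by (rule LIM_zero_cancel[OF Lim_null_comparison[OF _ lim]])
qed

subsection \<open>Approximation on the domain of the squared generator\<close>

context bounded_c0_semigroup
begin

lemma T_funpow: "h \<ge> 0 \<Longrightarrow> (blinfun_apply (T h) ^^ n) x = T (real n * h) x"
  by (induction n) (simp_all add: T_T distrib_right)

lemma q_funpow:
  assumes "\<And>x. q (S x) \<le> q x"
  shows "q ((S ^^ n) x) \<le> q x"
  by (induction n) (auto intro: order.trans[OF assms])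

text \<open>Each summand of the telescoping sum has the factor S - U. Commutation moves the powers
  of S and U to its left, where contractivity removes them, so only the one-step error at x itself
  remains.\<close>

lemma q_telescope:
  assumes S: "bounded_linear S" "\<And>x. q (S x) \<le> q x" and U: "bounded_linear U" "\<And>x. q (U x) \<le> q x"
    and comm: "\<And>x. S (U x) = U (S x)"
  shows "q ((S ^^ n) x - (U ^^ n) x) \<le> real n * q (S x - U x)"
proof (induction n arbitrary: x)
  case (Suc n)
  have lin: "(S ^^ n) (v - w) = (S ^^ n) v - (S ^^ n) w" for v w
    by (induction n) (simp_all add: linear_simps[OF S(1)])
  have "(S ^^ Suc n) x - (U ^^ Suc n) x = (S ^^ n) (S x - U x) + ((S ^^ n) (U x) - (U ^^ n) (U x))"
    by (simp add: lin funpow_swap1)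
  then have "q ((S ^^ Suc n) x - (U ^^ Suc n) x) \<le> q ((S ^^ n) (S x - U x)) + q ((S ^^ n) (U x) - (U ^^ n) (U x))"
    using q_add by metis
  also have "q ((S ^^ n) (S x - U x)) \<le> q (S x - U x)" by (rule q_funpow[OF S(2)])
  also have "q ((S ^^ n) (U x) - (U ^^ n) (U x)) \<le> real n * q (S (U x) - U (U x))" by (rule Suc)
  also have "S (U x) - U (U x) = U (S x - U x)" by (simp add: comm linear_simps[OF U(1)])
  also have "real n * q (U (S x - U x)) \<le> real n * q (S x - U x)" by (intro mult_left_mono U) simp
  finally show ?case by (simp add: algebra_simps)
qed simp

end

context semigroup_generator
begin

lemma generator_LIMSEQ:
  assumes "x \<in> D" "t > 0"
  shows "(\<lambda>N. real N *\<^sub>R (T (t / real N) x - x)) \<longlonglongrightarrow> - (t *\<^sub>R A x)"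
proof -
  have "filterlim (\<lambda>N. t / real N) (at_right 0) sequentially"
    unfolding filterlim_at
  proof
    show "\<forall>\<^sub>F N in sequentially. t / real N \<in> {0<..} \<and> t / real N \<noteq> 0"
      using eventually_gt_at_top[of 0] by eventually_elim (use assms(2) in simp)
    show "(\<lambda>N. t / real N) \<longlonglongrightarrow> 0" by (rule lim_const_over_n)
  qed
  from filterlim_compose[OF generator_tendsto[OF assms(1)] this]
  have "(\<lambda>N. t *\<^sub>R ((1 / (t / real N)) *\<^sub>R (T (t / real N) x - x))) \<longlonglongrightarrow> t *\<^sub>R - A x"
    by (intro tendsto_scaleR tendsto_const)
  then show ?thesis using assms(2) by simp
qed

text \<open>The approximant \<open>S N\<close> equals (1 - c/N) + (c/N) B, a convex combination of
  contractions for N \<ge> c; this gives the first claim in the limit. For the second, telescoping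
  against \<open>T (t / N)\<close> bounds the error by N times the one-step error, whose vector
  converges to c (x - B x) - t A x by the definition of the generator.\<close>

lemma
  fixes B :: "'a \<Rightarrow>\<^sub>L 'a"
  assumes B: "\<And>w. q (B w) \<le> q w" and comm: "\<And>s w. s \<ge> 0 \<Longrightarrow> T s (B w) = B (T s w)" and c: "c \<ge> 0"
  defines "E \<equiv> op_exp (- (c *\<^sub>R (id_blinfun - B)))"
  shows q_op_exp_le: "q (E x) \<le> q x"
    and q_T_diff_op_exp: "x \<in> D \<Longrightarrow> t > 0 \<Longrightarrow> q (T t x - E x) \<le> q (c *\<^sub>R (x - B x) - t *\<^sub>R A x)"
proof -
  define S where "S N y = y + (1 / real N) *\<^sub>R (- (c *\<^sub>R (id_blinfun - B))) y" for N y
  have S_eq: "S N y = (1 - c / real N) *\<^sub>R y + (c / real N) *\<^sub>R B y" for N y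
    by (simp add: S_def blinfun.diff_left blinfun.scaleR_left blinfun.minus_left algebra_simps)
  have S_lin: "bounded_linear (S N)" for N
    unfolding S_eq[abs_def] by (intro bounded_linear_intros)
  have ev: "\<forall>\<^sub>F N in sequentially. N > 0 \<and> c \<le> real N"
    using eventually_gt_at_top[of 0] eventually_ge_at_top[of "nat \<lceil>c\<rceil>"] by eventually_elim linarith
  have q_S: "q (S N y) \<le> q y" if "N > 0 \<and> c \<le> real N" for N y
  proof -
    have "q (S N y) \<le> \<bar>1 - c / real N\<bar> * q y + \<bar>c / real N\<bar> * q (B y)"
      unfolding S_eq by (intro order.trans[OF q_add] add_mono q_scaleR)
    also have "\<dots> \<le> \<bar>1 - c / real N\<bar> * q y + \<bar>c / real N\<bar> * q y"
      by (intro add_left_mono mult_left_mono B) simp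
    also have "\<dots> = q y" using that c by (simp add: field_simps)
    finally show ?thesis .
  qed
  have lim: "(\<lambda>N. (S N ^^ N) x) \<longlonglongrightarrow> E x"
    using op_exp_LIMSEQ[of "- (c *\<^sub>R (id_blinfun - B))" x] by (simp only: S_def[abs_def] E_def)
  show "q (E x) \<le> q x"
  proof (rule tendsto_upperbound[OF tendsto_q[OF lim]])
    show "\<forall>\<^sub>F N in sequentially. q ((S N ^^ N) x) \<le> q x"
      using ev by eventually_elim (intro q_funpow q_S)
  qed simp
  assume x: "x \<in> D" and t: "t > 0"
  have S_diff: "real N *\<^sub>R (S N x - x) = - (c *\<^sub>R (x - B x))" if "N > 0" for N
    using that by (simp add: S_eq algebra_simps)
  have "(\<lambda>N. q (real N *\<^sub>R (T (t / real N) x - x) - - (c *\<^sub>R (x - B x)))) \<longlonglongrightarrow> q (- (t *\<^sub>R A x) - - (c *\<^sub>R (x - B x)))"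
    by (intro tendsto_q tendsto_diff generator_LIMSEQ x t tendsto_const)
  then have lim1: "(\<lambda>N. q (real N *\<^sub>R (T (t / real N) x - x) - - (c *\<^sub>R (x - B x)))) \<longlonglongrightarrow> q (c *\<^sub>R (x - B x) - t *\<^sub>R A x)"
    by (simp add: algebra_simps)
  have lim2: "(\<lambda>N. q (T t x - (S N ^^ N) x)) \<longlonglongrightarrow> q (T t x - E x)"
    by (intro tendsto_q tendsto_diff lim tendsto_const)
  show "q (T t x - E x) \<le> q (c *\<^sub>R (x - B x) - t *\<^sub>R A x)"
  proof (rule tendsto_le[OF _ lim1 lim2])
    show "\<forall>\<^sub>F N in sequentially. q (T t x - (S N ^^ N) x) \<le> q (real N *\<^sub>R (T (t / real N) x - x) - - (c *\<^sub>R (x - B x)))"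
      using ev
    proof eventually_elim
      case (elim N)
      have tN: "t / real N \<ge> 0" using t by simp
      have "T (t / real N) (S N y) = S N (T (t / real N) y)" for y
        by (simp add: S_eq comm[OF tN] blinfun.add_right blinfun.scaleR_right)
      then have "q ((blinfun_apply (T (t / real N)) ^^ N) x - (S N ^^ N) x) \<le> real N * q (T (t / real N) x - S N x)"
        by (rule q_telescope[OF blinfun.bounded_linear_right q_T[OF tN] S_lin q_S[OF elim]])
      moreover have "(blinfun_apply (T (t / real N)) ^^ N) x = T t x" using elim by (simp add: T_funpow[OF tN])
      ultimately have "q (T t x - (S N ^^ N) x) \<le> real N * q (T (t / real N) x - S N x)" by (simp only:)
      also have "\<dots> \<le> q (real N *\<^sub>R (T (t / real N) x - S N x))"
      proof -
        have "q ((1 / real N) *\<^sub>R (real N *\<^sub>R (T (t / real N) x - S N x))) \<le> \<bar>1 / real N\<bar> * q (real N *\<^sub>R (T (t / real N) x - S N x))"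
          by (rule q_scaleR)
        then show ?thesis using elim by (simp add: field_simps)
      qed
      also have "real N *\<^sub>R (T (t / real N) x - S N x) = real N *\<^sub>R (T (t / real N) x - x) - real N *\<^sub>R (S N x - x)"
        by (simp add: algebra_simps)
      also have "real N *\<^sub>R (S N x - x) = - (c *\<^sub>R (x - B x))" using S_diff elim by blast
      finally show ?case .
    qed
  qed simp
qed

text \<open>Choose s as the square root of 2K, so that s^2/2 = K and s powr a is the desired power.
  Returning to the original norm costs the factor \<open>bound\<close> only on the right.\<close>

lemma norm_le_of_interpolation:
  assumes add: "\<And>v w. \<Delta> (v + w) = \<Delta> v + \<Delta> w"
    and le0: "\<And>w. q (\<Delta> w) \<le> 2 * q w"
    and le2: "\<And>w. w \<in> D \<Longrightarrow> A w \<in> D \<Longrightarrow> q (\<Delta> w) \<le> K * q (A (A w))"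
    and K: "K > 0" and a: "0 < a" "a \<le> 2" and x: "x \<in> frac_pow_dom T a"
  shows "norm (\<Delta> x) \<le> 8 * bound * (2 * K) powr (a / 2) * norm (frac_pow T a x)"
proof -
  \<comment> \<open>The value picked by \<open>inv\<close> enters the estimate only through this
    equation.\<close>
  have v: "v_op T a (frac_pow T a x) = u_op T a x"
    using x unfolding frac_pow_dom_def frac_pow_def by (intro f_inv_into_f) simp
  define s where "s = (2 * K) powr (1 / 2)"
  have s: "s > 0" "s\<^sup>2 / 2 = K" using K by (simp_all add: s_def powr_power)
  have sa: "s powr a = (2 * K) powr (a / 2)" by (simp add: s_def powr_powr)
  have "q (\<Delta> x) \<le> 8 * s powr a * q (frac_pow T a x)"
    using q_interpolation[OF add le0 _ s(1) a v] le2 s(2) by simp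
  also have "\<dots> \<le> 8 * s powr a * (bound * norm (frac_pow T a x))"
    by (intro mult_left_mono q_le_bound) simp
  finally show ?thesis using norm_le_q[of "\<Delta> x"] by (simp add: sa mult_ac)
qed

lemma q_diff_le_2: "q v \<le> q x \<Longrightarrow> q w \<le> q x \<Longrightarrow> q (v - w) \<le> 2 * q x"
  using q_diff[of v w] by linarith

text \<open>With B = \<open>T (1 / n)\<close> and c = n t, the defect is n t times the Taylor
  remainder of \<open>A w\<close> over an interval of length 1/n, hence at most n t / (2 n^2) =
  t/(2n).\<close>

lemma dunford_segal:
  assumes "t > 0" "n \<ge> 1" "0 < a" "a \<le> 2" "x \<in> frac_pow_dom T a"
  shows "norm (T t x - op_exp (- ((real n * t) *\<^sub>R (id_blinfun - T (1 / real n)))) x)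
       \<le> 8 * bound * (t / real n) powr (a / 2) * norm (frac_pow T a x)"
proof -
  define E where "E = op_exp (- ((real n * t) *\<^sub>R (id_blinfun - T (1 / real n))))"
  have n: "1 / real n \<ge> 0" and c: "real n * t \<ge> 0" using assms by auto
  have comm: "T s (T (1 / real n) w) = T (1 / real n) (T s w)" if "s \<ge> 0" for s w
    using that n by (simp add: T_T add.commute)
  have E_le: "q (E w) \<le> q w" for w
    unfolding E_def by (rule q_op_exp_le[OF q_T[OF n] _ c]) (rule comm)
  have E_diff: "q (T t w - E w) \<le> q ((real n * t) *\<^sub>R (w - T (1 / real n) w) - t *\<^sub>R A w)" if "w \<in> D" for w
    unfolding E_def by (rule q_T_diff_op_exp[OF q_T[OF n] _ c that assms(1)]) (rule comm)
  have "norm (T t x - E x) \<le> 8 * bound * (2 * (t / (2 * real n))) powr (a / 2) * norm (frac_pow T a x)"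
  proof (rule norm_le_of_interpolation)
    show "q (T t w - E w) \<le> 2 * q w" for w
      by (intro q_diff_le_2 q_T E_le) (use assms in auto)
    fix w assume w: "w \<in> D" "A w \<in> D"
    have "(real n * t) *\<^sub>R (w - T (1 / real n) w) - t *\<^sub>R A w = (real n * t) *\<^sub>R (J (1 / real n) (A w) - (1 / real n) *\<^sub>R A w)"
      using assms by (simp add: J_A[OF n w(1)] scaleR_diff_right)
    then have "q (T t w - E w) \<le> \<bar>real n * t\<bar> * q (J (1 / real n) (A w) - (1 / real n) *\<^sub>R A w)"
      using order.trans[OF E_diff[OF w(1)]] q_scaleR by metis
    also have "\<dots> \<le> \<bar>real n * t\<bar> * ((1 / real n)\<^sup>2 / 2 * q (A (A w)))"
      by (intro mult_left_mono q_J_diff_self w n) simp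
    also have "\<dots> = t / (2 * real n) * q (A (A w))" using assms by (simp add: power2_eq_square)
    finally show "q (T t w - E w) \<le> t / (2 * real n) * q (A (A w))" .
  qed (use assms in \<open>auto simp: blinfun.add_right\<close>)
  then show ?thesis by (simp add: E_def)
qed

lemma q_scaled_R: "\<epsilon> > 0 \<Longrightarrow> q (\<epsilon> *\<^sub>R R \<epsilon> w) \<le> q w"
  using q_scaleR[of \<epsilon> "R \<epsilon> w"] q_R[of \<epsilon> w] by simp

text \<open>Yosida's operator is 1 - B with the contraction B = n R(n). For c = n t the defect
  collapses to - t R(n) A^2 w, and the resolvent at n contributes the factor 1/n.\<close>

lemma yosida_approximation:
  assumes "t > 0" "n \<ge> 1" "0 < a" "a \<le> 2" "x \<in> frac_pow_dom T a"
  shows "norm (T t x - op_exp (- ((real n * t) *\<^sub>R yosida D A n)) x)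
       \<le> 16 * bound * (t / real n) powr (a / 2) * norm (frac_pow T a x)"
proof -
  have n: "real n > 0" and c: "real n * t \<ge> 0" using assms by auto
  have lin: "bounded_linear (\<lambda>w. real n *\<^sub>R R (real n) w)"
    by (intro bounded_linear_scaleR_right[THEN bounded_linear_compose] rep_bounded_linear[OF rep_R[OF n]])
  define B where "B = Blinfun (\<lambda>w. real n *\<^sub>R R (real n) w)"
  have B: "B w = real n *\<^sub>R R (real n) w" for w by (simp add: B_def bounded_linear_Blinfun_apply[OF lin])
  have "(\<lambda>w. A (op_inv (real n) 1 D A w)) = blinfun_apply (id_blinfun - B)"
    by (rule ext) (simp add: op_inv_eq[OF n zero_less_one] A_R[OF n] B blinfun.diff_left)
  then have Y: "yosida D A n = id_blinfun - B" by (simp add: yosida_def blinfun_apply_inverse)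
  define E where "E = op_exp (- ((real n * t) *\<^sub>R (id_blinfun - B)))"
  have q_B: "q (B w) \<le> q w" for w unfolding B by (rule q_scaled_R[OF n])
  have comm: "T s (B w) = B (T s w)" if "s \<ge> 0" for s w
    unfolding B blinfun.scaleR_right by (simp only: rep_commute[OF rep_T[OF that] rep_R[OF n]])
  have E_le: "q (E w) \<le> q w" for w
    unfolding E_def by (rule q_op_exp_le[OF q_B _ c]) (rule comm)
  have E_diff: "q (T t w - E w) \<le> q ((real n * t) *\<^sub>R (w - B w) - t *\<^sub>R A w)" if "w \<in> D" for w
    unfolding E_def by (rule q_T_diff_op_exp[OF q_B _ c that assms(1)]) (rule comm)
  have "norm (T t x - E x) \<le> 8 * bound * (2 * (t / real n)) powr (a / 2) * norm (frac_pow T a x)"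
  proof (rule norm_le_of_interpolation)
    show "q (T t w - E w) \<le> 2 * q w" for w
      by (intro q_diff_le_2 q_T E_le) (use assms in auto)
    fix w assume w: "w \<in> D" "A w \<in> D"
    have "(real n * t) *\<^sub>R (w - B w) - t *\<^sub>R A w = t *\<^sub>R (real n *\<^sub>R R (real n) (A w) - A w)"
      by (simp add: R_A[OF n w(1)] B scaleR_diff_right mult.commute)
    also have "real n *\<^sub>R R (real n) (A w) - A w = - R (real n) (A (A w))"
      by (simp add: R_A[OF n w(2)])
    finally have "q (T t w - E w) \<le> \<bar>t\<bar> * q (- R (real n) (A (A w)))"
      using order.trans[OF E_diff[OF w(1)]] q_scaleR by metis
    also have "\<dots> \<le> t / real n * q (A (A w))"
      using q_R[OF n, of "A (A w)"] assms(1) n by (simp add: q_minus field_simps)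
    finally show "q (T t w - E w) \<le> t / real n * q (A (A w))" .
  qed (use assms in \<open>auto simp: blinfun.add_right\<close>)
  \<comment> \<open>Here 2K is 2t/n, so a factor 2 powr (a/2) \<le> 2 remains; it turns 8 into
    16.\<close>
  also have "8 * bound * (2 * (t / real n)) powr (a / 2) * norm (frac_pow T a x)
      \<le> 8 * bound * (2 * (t / real n) powr (a / 2)) * norm (frac_pow T a x)"
  proof (intro mult_right_mono mult_left_mono)
    have "(2 * (t / real n)) powr (a / 2) = 2 powr (a / 2) * (t / real n) powr (a / 2)"
      by (rule powr_mult)
    moreover have "2 powr (a / 2) \<le> (2::real) powr 1" using assms by (intro powr_mono) auto
    ultimately show "(2 * (t / real n)) powr (a / 2) \<le> 2 * (t / real n) powr (a / 2)"
      by (simp add: mult_right_mono)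
  qed (use bound_nonneg in auto)
  finally show ?thesis by (simp add: E_def Y)
qed

text \<open>With h = t/n and U the inverse of 1 + h A, the one-step error is U applied to (1 + h A)
  \<open>T h w\<close> - w, which is a Taylor remainder of \<open>A w\<close> at the right endpoint.
  Telescoping over n steps gives n h^2/2 = t^2/(2n).\<close>

lemma euler_approximation:
  assumes "t > 0" "n \<ge> 1" "0 < a" "a \<le> 2" "x \<in> frac_pow_dom T a"
  shows "norm (T t x - (op_inv 1 (t / real n) D A ^^ n) x)
       \<le> 8 * bound * (t\<^sup>2 / real n) powr (a / 2) * norm (frac_pow T a x)"
proof -
  define h where "h = t / real n"
  have h: "h > 0" and h0: "h \<ge> 0" and e: "1 / h > 0" and nh: "real n * h = t" using assms by (auto simp: h_def)
  define U where "U w = (1 / h) *\<^sub>R R (1 / h) w" for w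
  have U: "op_inv 1 (t / real n) D A = U"
    using op_inv_eq[OF zero_less_one h] by (simp add: fun_eq_iff U_def h_def[symmetric])
  have U_lin: "bounded_linear U"
    unfolding U_def by (intro bounded_linear_scaleR_right[THEN bounded_linear_compose] rep_bounded_linear[OF rep_R[OF e]])
  have q_U: "q (U w) \<le> q w" for w unfolding U_def by (rule q_scaled_R[OF e])
  have comm: "T h (U w) = U (T h w)" for w
    unfolding U_def blinfun.scaleR_right by (simp only: rep_commute[OF rep_T[OF h0] rep_R[OF e]])
  have U_add: "(U ^^ n) (v + w) = (U ^^ n) v + (U ^^ n) w" for v w
    by (induction n) (simp_all add: linear_simps[OF U_lin])
  have "norm (T t x - (U ^^ n) x) \<le> 8 * bound * (2 * (t\<^sup>2 / (2 * real n))) powr (a / 2) * norm (frac_pow T a x)"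
  proof (rule norm_le_of_interpolation)
    show "q (T t w - (U ^^ n) w) \<le> 2 * q w" for w
      by (intro q_diff_le_2 q_T q_funpow q_U) (use assms in auto)
    fix w assume w: "w \<in> D" "A w \<in> D"
    have U_inv: "U (v + h *\<^sub>R A v) = v" if "v \<in> D" for v
      using h by (simp add: U_def linear_simps[OF rep_bounded_linear[OF rep_R[OF e]]] R_A[OF e that] scaleR_add_right scaleR_diff_right)
    have TD: "T h w \<in> D" and AT: "A (T h w) = T h (A w)"
      by (rule rep_dom[OF rep_T[OF h0] w(1)], rule rep_A[OF rep_T[OF h0] w(1)])
    have "T h w - U w = U (T h w + h *\<^sub>R T h (A w) - w)"
      using U_inv[OF TD] by (simp add: AT linear_simps[OF U_lin])
    also have "T h w + h *\<^sub>R T h (A w) - w = - (J h (A w) - h *\<^sub>R T h (A w))"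
      by (simp add: J_A[OF h0 w(1)])
    finally have "q (T h w - U w) \<le> q (J h (A w) - h *\<^sub>R T h (A w))"
      using q_U q_minus by metis
    also have "\<dots> \<le> h\<^sup>2 / 2 * q (A (A w))" by (rule q_J_diff_T[OF w(2) h0])
    finally have step: "q (T h w - U w) \<le> h\<^sup>2 / 2 * q (A (A w))" .
    have "q (T t w - (U ^^ n) w) = q ((blinfun_apply (T h) ^^ n) w - (U ^^ n) w)"
      by (simp add: T_funpow[OF h0] nh)
    also have "\<dots> \<le> real n * q (T h w - U w)"
      by (rule q_telescope[OF blinfun.bounded_linear_right q_T[OF h0] U_lin q_U comm])
    also have "\<dots> \<le> real n * (h\<^sup>2 / 2 * q (A (A w)))" by (intro mult_left_mono step) simp
    also have "\<dots> = t\<^sup>2 / (2 * real n) * q (A (A w))"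
      using assms by (simp add: h_def power2_eq_square)
    finally show "q (T t w - (U ^^ n) w) \<le> t\<^sup>2 / (2 * real n) * q (A (A w))" .
  qed (use assms in \<open>auto simp: blinfun.add_right U_add\<close>)
  then show ?thesis by (simp add: U)
qed

end

theorem theorem1p3:
  fixes T :: "real \<Rightarrow> 'a::complex_banach \<Rightarrow>\<^sub>L 'a"
    and D :: "'a set" and A :: "'a \<Rightarrow> 'a"
    and M \<alpha> t :: real and x :: 'a and n :: nat
  assumes "bounded_c0_semigroup T"
    and "is_generator T D (\<lambda>y. - A y)"
    and "M = (SUP s\<in>{0..}. norm (T s))"
    and "0 < \<alpha>" and "\<alpha> \<le> 2"
    and "x \<in> frac_pow_dom T \<alpha>"
    and "0 < t" and "1 \<le> n"
  shows
    "norm (T t x - op_exp (- ((real n * t) *\<^sub>R yosida D A n)) x)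
       \<le> 16 * M * (t / real n) powr (\<alpha> / 2) * norm (frac_pow T \<alpha> x) \<and>
     norm (T t x - op_exp (- ((real n * t) *\<^sub>R (id_blinfun - T (1 / real n)))) x)
       \<le> 8 * M * (t / real n) powr (\<alpha> / 2) * norm (frac_pow T \<alpha> x) \<and>
     norm (T t x - (op_inv 1 (t / real n) D A ^^ n) x)
       \<le> 8 * M * (t\<^sup>2 / real n) powr (\<alpha> / 2) * norm (frac_pow T \<alpha> x)"
proof -
  interpret semigroup_generator T D A
    using assms(1,2) by (intro semigroup_generator.intro semigroup_generator_axioms.intro)
  have "M = bound" by (simp add: assms(3) bound_def)
  then show ?thesis
    using yosida_approximation dunford_segal euler_approximation assms(4-8) by blast
qed

end
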